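(* For any $x\in\mathbb{R}$, $$\lim_{n\to\infty}P_n\!\left(\frac{2}{r!}\,s_n^{\frac{r+1}{2}}\alpha_n^{\frac{r-1}{r}}H-\frac{\alpha_n}{(r-1)!}+\frac{r-1}{r}\log(\alpha_n)\le x\right)=e^{-e^{-x}}.$$
   Context: Throughout $r\ge 2$ is a fixed integer and $\mathbb{N}=\{1,2,\dots\}$, $\mathbb{N}_0=\mathbb{N}\cup\{0\}$. For $\mathbf{y}\in\mathbb{R}^r_{\ge0}$ put $$a(\mathbf{y}):=\frac{1}{c_r}\prod_{1\le\ell\le j\le r}(y_\ell+\dots+y_j),\qquad c_r:=r!\,(r-1)!\cdots1!.$$ Finite-dimensional irreducible representations $\rho_{\mathbf{k}}$ of $\mathfrak{sl}_{r+1}(\mathbb{C})$ are indexed (up to isomorphism) by $\mathbf{k}\in\mathbb{N}^r$, with $\dim\rho_{\mathbf{k}}=a(\mathbf{k})$. A finite-dimensional representation $\rho$ (up to isomorphism) is $\rho=\bigoplus_{\mathbf{k}\in\mathbb{N}^r}\rho_{\mathbf{k}}^{X_{\mathbf{k}}(\rho)}$ with multiplicities $X_{\mathbf{k}}(\rho)\in\mathbb{N}_0$, all but finitely many zero, and $\dim\rho=\sum_{\mathbf{k}}a(\mathbf{k})X_{\mathbf{k}}(\rho)$. $P_n$ is the uniform probability measure on the (finite) set of $n$-dimensional representations up to isomorphism. With $\mathbf{1}:=(1,\dots,1)$ and $$L(\mathbf{k}):=\frac12\sum_{1\le\ell\le j\le r}(k_\ell+\dots+k_j)=\frac12\sum_{j=1}^r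 j(r+1-j)k_j,$$ the height of a representation is $H:=\max_{X_{\mathbf{k}}>0}L(\mathbf{k}-\mathbf{1})$. For $n\in\mathbb{N}$, $q_n\in(0,1)$ is the unique solution $q$ of $\sum_{\mathbf{k}\in\mathbb{N}^r}\frac{a(\mathbf{k})q^{a(\mathbf{k})}}{1-q^{a(\mathbf{k})}}=n$, and $s_n>0$ is defined by $q_n=\exp\big(-s_n^{r(r+1)/2}\big)$. Finally, $$\alpha_n:=\Gamma(r+1)\log\!\left(2\,\Gamma(r)\,s_n^{-\frac{r+1}{2}}\right).$$ Since $s_n\to0$, $\alpha_n>0$ for all sufficiently large $n$. *)

theory Defs
  imports "HOL-Probability.Probability"
begin

text \<open>
  Vectors $(y_1, \dots, y_r)$ are functions on \<open>nat\<close> of which only the values at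
  \<open>1, \<dots>, r\<close> matter. The labels of the irreducible representations of
  $\mathfrak{sl}_{r+1}(\mathbb{C})$ are extensional, so that each one occurs exactly once.
\<close>

definition irrep_labels :: "nat \<Rightarrow> (nat \<Rightarrow> nat) set" where
  "irrep_labels r = ({1..r} \<rightarrow>\<^sub>E {1..})"

definition pos_root_pairs :: "nat \<Rightarrow> (nat \<times> nat) set" where
  "pos_root_pairs r = {(l, j). 1 \<le> l \<and> l \<le> j \<and> j \<le> r}"

definition weyl_const :: "nat \<Rightarrow> real" where
  "weyl_const r = (\<Prod>i=1..r. fact i)"

definition weyl_dim :: "nat \<Rightarrow> (nat \<Rightarrow> real) \<Rightarrow> real" where
  "weyl_dim r y = 1 / weyl_const r * (\<Prod>(l, j)\<in>pos_root_pairs r. \<Sum>i=l..j. y i)"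

definition irrep_dim :: "nat \<Rightarrow> (nat \<Rightarrow> nat) \<Rightarrow> real" where
  "irrep_dim r k = weyl_dim r (\<lambda>i. real (k i))"

text \<open>
  By complete reducibility, an isomorphism class of finite-dimensional representations is the
  same thing as the finitely supported family \<open>X\<close> of the multiplicities of the irreducible
  representations in it. The dimension is kept real-valued; it is an integer by Weyl's
  dimension formula.
\<close>

definition rep_support :: "((nat \<Rightarrow> nat) \<Rightarrow> nat) \<Rightarrow> (nat \<Rightarrow> nat) set" where
  "rep_support X = {k. X k > 0}"

definition fin_dim_reps :: "nat \<Rightarrow> ((nat \<Rightarrow> nat) \<Rightarrow> nat) set" where
  "fin_dim_reps r = {X. rep_support X \<subseteq> irrep_labels r \<and> finite (rep_support X)}"

definition rep_dim :: "nat \<Rightarrow> ((nat \<Rightarrow> nat) \<Rightarrow> nat) \<Rightarrow> real" where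
  "rep_dim r X = (\<Sum>k\<in>rep_support X. irrep_dim r k * real (X k))"

definition reps_of_dim :: "nat \<Rightarrow> nat \<Rightarrow> ((nat \<Rightarrow> nat) \<Rightarrow> nat) set" where
  "reps_of_dim r n = {X \<in> fin_dim_reps r. rep_dim r X = real n}"

definition rep_measure :: "nat \<Rightarrow> nat \<Rightarrow> ((nat \<Rightarrow> nat) \<Rightarrow> nat) measure" where
  "rep_measure r n = uniform_count_measure (reps_of_dim r n)"

definition weight_height :: "nat \<Rightarrow> (nat \<Rightarrow> real) \<Rightarrow> real" where
  "weight_height r y = 1 / 2 * (\<Sum>(l, j)\<in>pos_root_pairs r. \<Sum>i=l..j. y i)"

definition rep_height :: "nat \<Rightarrow> ((nat \<Rightarrow> nat) \<Rightarrow> nat) \<Rightarrow> real" where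
  "rep_height r X = Max ((\<lambda>k. weight_height r (\<lambda>i. real (k i) - 1)) ` rep_support X)"

definition saddle_q :: "nat \<Rightarrow> nat \<Rightarrow> real" where
  "saddle_q r n = (THE q. 0 < q \<and> q < 1 \<and>
     ((\<lambda>k. irrep_dim r k * q powr irrep_dim r k / (1 - q powr irrep_dim r k))
        has_sum real n) (irrep_labels r))"

definition saddle_s :: "nat \<Rightarrow> nat \<Rightarrow> real" where
  "saddle_s r n =
     (THE s. 0 < s \<and> saddle_q r n = exp (- (s powr (real r * (real r + 1) / 2))))"

definition height_alpha :: "nat \<Rightarrow> nat \<Rightarrow> real" where
  "height_alpha r n =
     Gamma (real r + 1) * ln (2 * Gamma (real r) * saddle_s r n powr (- (real r + 1) / 2))"


text \<open>
  The definitions above are well posed: there are finitely many representations of dimension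
  \<open>n\<close>, and at least one, so that the uniform measure on them is a probability measure.
\<close>

lemma finite_pos_root_pairs: "finite (pos_root_pairs r)"
  by (rule finite_subset[of _ "{..r} \<times> {..r}"]) (auto simp: pos_root_pairs_def)

lemma prod_pos_root_pairs:
  "(\<Prod>p\<in>pos_root_pairs r. f p) = (\<Prod>j=1..r. \<Prod>l=1..j. f (l, j :: nat) :: real)"
proof -
  have "(\<Prod>j=1..r. \<Prod>l=1..j. f (l, j)) = (\<Prod>(j, l)\<in>Sigma {1..r} (\<lambda>j. {1..j}). f (l, j))"
    by (rule prod.Sigma) auto
  also have "\<dots> = (\<Prod>p\<in>pos_root_pairs r. f p)"
    by (rule prod.reindex_bij_witness[of _ prod.swap prod.swap])
       (auto simp: pos_root_pairs_def)
  finally show ?thesis by simp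
qed

lemma weyl_const_eq: "weyl_const r = (\<Prod>(l, j)\<in>pos_root_pairs r. real (j + 1 - l))"
proof -
  have "(\<Prod>l=1..j. real (j + 1 - l)) = fact j" for j
  proof -
    have "(\<Prod>l=1..j. real (j + 1 - l)) = (\<Prod>l=1..j. real l)"
      by (rule prod.reindex_bij_witness[of _ "\<lambda>l. j + 1 - l" "\<lambda>l. j + 1 - l"]) auto
    thus ?thesis by (simp add: fact_prod)
  qed
  thus ?thesis by (simp add: weyl_const_def prod_pos_root_pairs)
qed

lemma weyl_dim_eq:
  "weyl_dim r y = (\<Prod>(l, j)\<in>pos_root_pairs r. (\<Sum>i=l..j. y i) / real (j + 1 - l))"
  unfolding weyl_dim_def weyl_const_eq by (simp add: case_prod_unfold prod_dividef)

lemma irrep_dim_ge_label: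
  assumes "k \<in> irrep_labels r" "i \<in> {1..r}"
  shows "irrep_dim r k \<ge> real (k i)"
proof -
  define g :: "nat \<times> nat \<Rightarrow> real"
    where "g = (\<lambda>(l, j). (\<Sum>i=l..j. real (k i)) / real (j + 1 - l))"
  have g: "g p \<ge> 1" if "p \<in> pos_root_pairs r" for p
  proof -
    obtain l j where p: "p = (l, j)" by fastforce
    with that have lj: "1 \<le> l" "l \<le> j" "j \<le> r" by (auto simp: pos_root_pairs_def)
    have "(\<Sum>i=l..j. real 1) \<le> (\<Sum>i=l..j. real (k i))"
      using assms lj by (intro sum_mono) (force simp: irrep_labels_def PiE_iff)
    thus ?thesis using lj by (simp add: p g_def of_nat_diff)
  qed
  have i: "(i, i) \<in> pos_root_pairs r" using assms by (auto simp: pos_root_pairs_def)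
  have "real (k i) = g (i, i)" by (simp add: g_def)
  also have "g (i, i) = g (i, i) * 1" by simp
  also have "\<dots> \<le> g (i, i) * prod g (pos_root_pairs r - {(i, i)})"
    using g i by (intro mult_left_mono prod_ge_1) (force intro: order_trans[of 0 1])+
  also have "\<dots> = prod g (pos_root_pairs r)"
    by (rule prod.remove[OF finite_pos_root_pairs i, symmetric])
  also have "\<dots> = irrep_dim r k"
    by (simp add: irrep_dim_def weyl_dim_eq g_def case_prod_unfold)
  finally show ?thesis .
qed

lemma finite_reps_of_dim:
  assumes "r \<ge> 1"
  shows "finite (reps_of_dim r n)"
proof -
  define F where "F = ({1..r} \<rightarrow>\<^sub>E {1..n})"
  have fF: "finite F" unfolding F_def by (intro finite_PiE) auto
  have main: "k \<in> F \<and> X k \<le> n" if X: "X \<in> reps_of_dim r n" and kX: "X k > 0" for X k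
  proof -
    have fin: "finite (rep_support X)" and sub: "rep_support X \<subseteq> irrep_labels r"
      and n: "rep_dim r X = real n"
      using X by (auto simp: reps_of_dim_def fin_dim_reps_def)
    have k: "k \<in> irrep_labels r" using sub kX by (auto simp: rep_support_def)
    have ge1: "irrep_dim r k' \<ge> 1" if "k' \<in> irrep_labels r" for k'
    proof -
      have "k' 1 \<ge> 1" using that assms by (force simp: irrep_labels_def PiE_iff)
      thus ?thesis using irrep_dim_ge_label[OF that, of 1] assms by simp
    qed
    have "irrep_dim r k * real (X k) \<le> rep_dim r X" unfolding rep_dim_def
      using fin kX sub ge1
      by (intro member_le_sum) (force simp: rep_support_def intro: order_trans[of 0 1])+
    hence le: "irrep_dim r k * real (X k) \<le> real n" using n by simp
    have "irrep_dim r k * 1 \<le> irrep_dim r k * real (X k)"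
      using ge1[OF k] kX by (intro mult_left_mono) auto
    with le have a: "irrep_dim r k \<le> real n" by linarith
    have "1 * real (X k) \<le> irrep_dim r k * real (X k)"
      using ge1[OF k] by (intro mult_right_mono) auto
    with le have b: "real (X k) \<le> real n" by linarith
    have "k i \<le> n" if "i \<in> {1..r}" for i
      using irrep_dim_ge_label[OF k that] a by linarith
    hence "k \<in> F" using k by (auto simp: F_def irrep_labels_def PiE_iff)
    with b show ?thesis by simp
  qed
  have "reps_of_dim r n \<subseteq> {X. \<forall>k. (k \<in> F \<longrightarrow> X k \<in> {..n}) \<and> (k \<notin> F \<longrightarrow> X k = 0)}"
  proof (intro subsetI CollectI allI conjI impI)
    fix X k assume X: "X \<in> reps_of_dim r n"
    show "X k \<in> {..n}" using main[OF X] by (cases "X k = 0") auto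
  next
    fix X k assume X: "X \<in> reps_of_dim r n" and "k \<notin> F"
    thus "X k = 0" using main[OF X, of k] by auto
  qed
  thus ?thesis by (rule finite_subset) (intro finite_set_of_finite_funs fF finite_atMost)
qed

lemma reps_of_dim_nonempty: "reps_of_dim r n \<noteq> {}"
proof -
  define k where "k = (\<lambda>i\<in>{1..r}. 1 :: nat)"
  define X where "X = (\<lambda>k'. if k' = k then n else 0)"
  have k: "k \<in> irrep_labels r" by (auto simp: k_def irrep_labels_def)
  have supp: "rep_support X = (if n = 0 then {} else {k})"
    by (auto simp: rep_support_def X_def)
  have "(\<Sum>i=l..j. real (k i)) / real (j + 1 - l) = 1" if "(l, j) \<in> pos_root_pairs r" for l j
  proof -
    have "(\<Sum>i=l..j. real (k i)) = (\<Sum>i=l..j. 1)"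
      using that by (intro sum.cong) (auto simp: k_def pos_root_pairs_def)
    thus ?thesis using that by (auto simp: pos_root_pairs_def of_nat_diff)
  qed
  hence "irrep_dim r k = 1"
    unfolding irrep_dim_def weyl_dim_eq by (intro prod.neutral) fast
  hence "X \<in> reps_of_dim r n"
    using k supp by (auto simp: reps_of_dim_def fin_dim_reps_def rep_dim_def X_def)
  thus ?thesis by blast
qed

lemma prob_space_rep_measure: "r \<ge> 1 \<Longrightarrow> prob_space (rep_measure r n)"
  unfolding rep_measure_def
  by (intro prob_space_uniform_count_measure finite_reps_of_dim reps_of_dim_nonempty)

end

theory Submission
  imports Defs "HOL-Computational_Algebra.Polynomial" "HOL-Real_Asymp.Real_Asymp"
begin

text \<open>
Write \<open>q = exp (- S)\<close>. If the multiplicities \<open>X k\<close> are made independent, \<open>X k\<close> geometric with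
ratio \<open>q ^ dim k\<close>, then conditioning on total dimension \<open>n\<close> gives the uniform distribution on the
representations of dimension \<open>n\<close>, for every \<open>q\<close>. The saddle point is the \<open>q\<close> for which the mean total
dimension is \<open>n\<close>. The probability that, in the independent model, no label of height above \<open>T\<close> occurs is
\<open>\<Prod> (1 - q ^ dim k)\<close>, the product running over these labels, and this is close to
\<open>exp (- \<Sum> exp (- S * dim k))\<close>. So two things have to be shown.

First, the sum of \<open>exp (- S * dim k)\<close> over the labels above the cutoff that belongs to \<open>x\<close> tends to
\<open>exp (- x)\<close> (lemma \<open>high_sum_tendsto\<close>). A label with a large height has a large dimension unless it
is one of the two corner labels of size \<open>m\<close>, the symmetric power \<open>Sym^m\<close> of the standard
representation or of its dual, whose dimension \<open>binomial (m + r, r)\<close> is only of order \<open>m^r\<close>. Every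
other label of comparable height has essentially at least twice the dimension of a corner label, which
squares the weight \<open>exp (- S * dim)\<close>, and there are too few of them to make up for that. The two corner
families give twice a sum that is compared with the integral of \<open>exp (- (h * y) ^ r / r!)\<close>, where
\<open>h ^ r = S\<close>, and the normalisation of the theorem is what turns it into \<open>exp (- x)\<close>. The factor 2 in
\<open>alpha\<close> counts the two families.

Second, conditioning on the total dimension does not change the limit: the probability that
the independent total equals \<open>n\<close> is asymptotically the same with and without the high labels
(lemma \<open>thinned_count_ratio_tendsto_1\<close>). Both probabilities are Fourier coefficients of products of
characteristic functions, and the two products differ at frequency \<open>t\<close> by at most \<open>\<bar>t\<bar>\<close> times the mean
contribution of the high labels, which is small against the standard deviation. This needs a
Gaussian bound for small \<open>t\<close> and an error term for the other \<open>t\<close> that beats every power of \<open>S\<close> (lemma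
\<open>label_char_prod_bound\<close>). For \<open>t\<close> of the order of \<open>S\<close> the labels in a box provide it. For
larger \<open>t\<close> the dimensions of \<open>r + 1\<close> consecutive corner labels cannot all be close to multiples of
\<open>2 * pi / t\<close>, because their \<open>r\<close>-th difference is 1. This argument replaces estimates of exponential sums.

The Fourier integral over one period presupposes that the dimensions are integers. This is
proved from Weyl's formula by interpolation (lemma \<open>vandermonde_ratio_Ints\<close>).
\<close>

section \<open>Counting solutions by Fourier inversion\<close>

text \<open>
Partitions of \<open>n\<close> into parts of sizes \<open>a k\<close>, the multiplicities being extended by 0 outside \<open>K\<close>. With
this convention removing labels from \<open>K\<close> selects a subset of the solutions.
\<close>

definition weighted_count :: "'k set \<Rightarrow> ('k \<Rightarrow> nat) \<Rightarrow> nat \<Rightarrow> nat" where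
  "weighted_count K a n = card {X. (\<forall>k. k \<notin> K \<longrightarrow> X k = 0) \<and> (\<Sum>k\<in>K. a k * X k) = n}"

lemma finite_weighted_solutions:
  fixes a :: "'k \<Rightarrow> nat"
  assumes "finite K" "\<And>k. k \<in> K \<Longrightarrow> a k \<ge> 1"
  shows "finite {X. (\<forall>k. k \<notin> K \<longrightarrow> X k = (0::nat)) \<and> (\<Sum>k\<in>K. a k * X k) = n}"
proof (rule finite_subset)
  show "finite {X. \<forall>k. (k \<in> K \<longrightarrow> X k \<in> {..n}) \<and> (k \<notin> K \<longrightarrow> X k = 0)}"
    using assms by (intro finite_set_of_finite_funs) auto
  show "{X. (\<forall>k. k \<notin> K \<longrightarrow> X k = 0) \<and> (\<Sum>k\<in>K. a k * X k) = n} \<subseteq>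
        {X. \<forall>k. (k \<in> K \<longrightarrow> X k \<in> {..n}) \<and> (k \<notin> K \<longrightarrow> X k = 0)}"
  proof (clarsimp)
    fix X :: "'k \<Rightarrow> nat" and k assume k: "k \<in> K"
    have "X k \<le> a k * X k" using assms(2)[OF k] by simp
    also have "\<dots> \<le> (\<Sum>k\<in>K. a k * X k)"
      by (rule member_le_sum) (use k assms in auto)
    finally show "X k \<le> (\<Sum>k\<in>K. a k * X k)" .
  qed
qed

text \<open>
Sorting the solutions by the amount \<open>i\<close> that the new part contributes makes the counts a Cauchy
product.
\<close>

lemma weighted_count_insert:
  assumes K: "finite K" "\<And>k. k \<in> insert k0 K \<Longrightarrow> a k \<ge> 1" "k0 \<notin> K"
  shows "weighted_count (insert k0 K) a n =
         (\<Sum>i\<le>n. (if a k0 dvd i then 1 else 0) * weighted_count K a (n - i))"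
proof -
  define A where "A = (\<lambda>i. {X. (\<forall>k. k \<notin> K \<longrightarrow> X k = (0::nat)) \<and> (\<Sum>k\<in>K. a k * X k) = n - i})"
  define I where "I = {i. i \<le> n \<and> a k0 dvd i}"
  have finI: "finite I" unfolding I_def by simp
  have pos: "a k0 > 0" using K(2)[of k0] by simp
  have upd: "(\<Sum>k\<in>K. a k * (X(k0 := j)) k) = (\<Sum>k\<in>K. a k * X k)" for X and j :: nat
    using K(3) by (intro sum.cong) auto
  have "{X. (\<forall>k. k \<notin> insert k0 K \<longrightarrow> X k = 0) \<and> (\<Sum>k\<in>insert k0 K. a k * X k) = n}
        = (\<Union>i\<in>I. (\<lambda>X. X(k0 := i div a k0)) ` A i)" (is "?L = ?R")
  proof (intro equalityI subsetI)
    fix X assume X: "X \<in> ?L"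
    let ?i = "a k0 * X k0"
    have s: "?i + (\<Sum>k\<in>K. a k * X k) = n" using X K by simp
    have "?i \<in> I" using s by (auto simp: I_def)
    moreover have "X(k0 := 0) \<in> A ?i" using X s upd[of X 0] by (auto simp: A_def)
    moreover have "X = (X(k0 := 0))(k0 := ?i div a k0)" using pos by auto
    ultimately show "X \<in> ?R" by blast
  next
    fix X assume "X \<in> ?R"
    then obtain i Y where i: "i \<in> I" and Y: "Y \<in> A i" "X = Y(k0 := i div a k0)" by blast
    show "X \<in> ?L" using i Y K pos upd[of Y "i div a k0"] by (auto simp: I_def A_def)
  qed
  hence "weighted_count (insert k0 K) a n = card (\<Union>i\<in>I. (\<lambda>X. X(k0 := i div a k0)) ` A i)"
    by (simp add: weighted_count_def)
  also have "\<dots> = (\<Sum>i\<in>I. card ((\<lambda>X. X(k0 := i div a k0)) ` A i))"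
  proof (rule card_UN_disjoint[OF finI])
    show "\<forall>i\<in>I. finite ((\<lambda>X. X(k0 := i div a k0)) ` A i)"
      unfolding A_def using K by (intro ballI finite_imageI finite_weighted_solutions) auto
    show "\<forall>i\<in>I. \<forall>j\<in>I. i \<noteq> j \<longrightarrow>
          (\<lambda>X. X(k0 := i div a k0)) ` A i \<inter> (\<lambda>X. X(k0 := j div a k0)) ` A j = {}"
    proof (intro ballI impI, rule ccontr)
      fix i j assume ij: "i \<in> I" "j \<in> I" "i \<noteq> j"
        and "(\<lambda>X. X(k0 := i div a k0)) ` A i \<inter> (\<lambda>X. X(k0 := j div a k0)) ` A j \<noteq> {}"
      then obtain X Y where "X(k0 := i div a k0) = Y(k0 := j div a k0)" by blast
      hence "i div a k0 = j div a k0" by (metis fun_upd_same)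
      hence "a k0 * (i div a k0) = a k0 * (j div a k0)" by simp
      moreover have "a k0 * (i div a k0) = i" "a k0 * (j div a k0) = j"
        using ij by (auto simp: I_def)
      ultimately show False using ij by simp
    qed
  qed
  also have "\<dots> = (\<Sum>i\<in>I. weighted_count K a (n - i))"
  proof (rule sum.cong[OF refl])
    fix i assume "i \<in> I"
    have "inj_on (\<lambda>X. X(k0 := i div a k0)) (A i)"
    proof (rule inj_onI)
      fix X Y assume "X \<in> A i" "Y \<in> A i" and e: "X(k0 := i div a k0) = Y(k0 := i div a k0)"
      hence "X k0 = Y k0" using K(3) by (simp add: A_def)
      thus "X = Y" using e by (metis fun_upd_triv fun_upd_upd)
    qed
    thus "card ((\<lambda>X. X(k0 := i div a k0)) ` A i) = weighted_count K a (n - i)"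
      by (simp add: card_image weighted_count_def A_def)
  qed
  also have "\<dots> = (\<Sum>i\<le>n. (if a k0 dvd i then 1 else 0) * weighted_count K a (n - i))"
    unfolding I_def by (rule sum.mono_neutral_cong_left) auto
  finally show ?thesis .
qed

lemma multiples_sums:
  fixes z :: "'a::{real_normed_field,banach}"
  assumes "norm z < 1" "a \<ge> (1::nat)"
  shows "(\<lambda>i. (if a dvd i then 1 else 0) * z ^ i) sums (1 / (1 - z ^ a))"
proof -
  have "norm (z ^ a) < 1" using assms by (simp add: norm_power power_less_one_iff)
  hence "(\<lambda>i. (z ^ a) ^ i) sums (1 / (1 - z ^ a))" by (rule geometric_sums)
  hence "(\<lambda>i. (if a dvd a * i then 1 else 0) * z ^ (a * i)) sums (1 / (1 - z ^ a))"
    by (simp add: power_mult)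
  moreover have "strict_mono (\<lambda>i. a * i)" using assms by (auto simp: strict_mono_def)
  ultimately show ?thesis
    by (subst (asm) sums_mono_reindex) (auto simp: image_iff)
qed

text \<open>
The Euler product of the generating function. Absolute convergence belongs to the induction,
since Cauchy products are multiplicative only for absolutely convergent series.
\<close>

lemma weighted_count_sums_and_summable:
  fixes z :: "'a::{real_normed_field,banach}"
  assumes "finite K" "\<And>k. k \<in> K \<Longrightarrow> a k \<ge> (1::nat)" "norm z < 1"
  shows "(\<lambda>m. of_nat (weighted_count K a m) * z ^ m) sums (\<Prod>k\<in>K. 1 / (1 - z ^ a k)) \<and>
         summable (\<lambda>m. norm (of_nat (weighted_count K a m) * z ^ m))"
  using assms(1,2)
proof (induction K rule: finite_induct)
  case empty
  have w: "weighted_count {} a m = (if m = 0 then 1 else 0)" for m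
  proof -
    have e: "{X. \<forall>k. X k = (0::nat)} = {\<lambda>k::'b. 0}" by auto
    show ?thesis by (auto simp: weighted_count_def e)
  qed
  have "(\<lambda>m. of_nat (weighted_count {} a m) * z ^ m) = (\<lambda>m. if m = 0 then 1 else 0)"
    by (auto simp: w)
  moreover have "(\<lambda>m. norm (of_nat (weighted_count {} a m) * z ^ m)) = (\<lambda>m. if m = 0 then 1 else 0)"
    by (auto simp: w)
  moreover have "(\<lambda>m. if m = 0 then 1 else 0 :: 'a) sums 1" by (rule sums_single)
  moreover have "summable (\<lambda>m. if m = 0 then 1 else 0 :: real)" by (rule sums_summable[OF sums_single])
  ultimately show ?case by simp
next
  case (insert k0 K)
  define A where "A = (\<lambda>i. (if a k0 dvd i then 1 else 0) * z ^ i)"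
  define B where "B = (\<lambda>m. of_nat (weighted_count K a m) * z ^ m)"
  define A' where "A' = (\<lambda>i. (if a k0 dvd i then 1 else 0) * norm z ^ i)"
  define B' where "B' = (\<lambda>m. of_nat (weighted_count K a m) * norm z ^ m)"
  have A: "A sums (1 / (1 - z ^ a k0))" unfolding A_def
    by (rule multiples_sums) (use assms insert in auto)
  have "A' sums (1 / (1 - norm z ^ a k0))" unfolding A'_def
    by (rule multiples_sums) (use assms insert in auto)
  hence sA': "summable A'" by (rule sums_summable)
  have nA: "norm (A i) = A' i" "norm (A' i) = A' i" for i by (auto simp: A_def A'_def norm_power)
  have nB: "norm (B i) = B' i" "norm (B' i) = B' i" for i by (auto simp: B_def B'_def norm_power norm_mult)
  have IH: "B sums (\<Prod>k\<in>K. 1 / (1 - z ^ a k))" "summable (\<lambda>m. norm (B m))"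
    unfolding B_def using insert by auto
  have sB': "summable B'" using IH(2) by (simp add: nB)
  have conv: "of_nat (weighted_count (insert k0 K) a m) * z ^ m = (\<Sum>i\<le>m. A i * B (m - i))" for m
  proof -
    have "of_nat (weighted_count (insert k0 K) a m) * z ^ m =
      (\<Sum>i\<le>m. (if a k0 dvd i then 1 else 0) * of_nat (weighted_count K a (m - i)) * z ^ m)"
      by (subst weighted_count_insert) (use insert in \<open>auto simp: sum_distrib_right intro!: sum.cong\<close>)
    also have "\<dots> = (\<Sum>i\<le>m. A i * B (m - i))"
      by (intro sum.cong) (auto simp: A_def B_def mult_ac simp flip: power_add)
    finally show ?thesis .
  qed
  have conv': "norm (of_nat (weighted_count (insert k0 K) a m) * z ^ m) = (\<Sum>i\<le>m. A' i * B' (m - i))" for m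
  proof -
    have "of_nat (weighted_count (insert k0 K) a m) * norm z ^ m =
      (\<Sum>i\<le>m. (if a k0 dvd i then 1 else 0) * of_nat (weighted_count K a (m - i)) * norm z ^ m)"
      by (subst weighted_count_insert) (use insert in \<open>auto simp: sum_distrib_right intro!: sum.cong\<close>)
    also have "\<dots> = (\<Sum>i\<le>m. A' i * B' (m - i))"
      by (intro sum.cong) (auto simp: A'_def B'_def mult_ac simp flip: power_add)
    finally show ?thesis by (simp add: norm_mult norm_power)
  qed
  have "(\<lambda>m. \<Sum>i\<le>m. A i * B (m - i)) sums (suminf A * suminf B)"
    by (rule Cauchy_product_sums) (use sA' IH nA nB in auto)
  moreover have "suminf A = 1 / (1 - z ^ a k0)" "suminf B = (\<Prod>k\<in>K. 1 / (1 - z ^ a k))"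
    using A IH by (auto simp: sums_iff)
  moreover have "summable (\<lambda>m. \<Sum>i\<le>m. A' i * B' (m - i))"
    by (rule summable_Cauchy_product) (use sA' sB' in \<open>simp_all only: nA nB\<close>)
  moreover from this have "summable (\<lambda>m. norm (of_nat (weighted_count (insert k0 K) a m) * z ^ m))"
    by (simp only: conv')
  ultimately show ?case using insert by (simp add: conv)
qed

lemma integral_cis_int:
  "((\<lambda>t. cis (real_of_int j * t)) has_integral (if j = 0 then 2 * pi else 0)) {- pi..pi}"
proof (cases "j = 0")
  case True
  have "((\<lambda>t::real. 1::complex) has_integral (pi - (-pi)) *\<^sub>R 1) {-pi..pi}"
    by (rule has_integral_const_real[THEN has_integral_eq_rhs]) auto
  thus ?thesis using True by (simp add: scaleR_conv_of_real)
next
  case False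
  have "((\<lambda>t. cis (real_of_int j * t)) has_integral
         (cis (j * pi) / (\<i> * j) - cis (j * (-pi)) / (\<i> * j))) {-pi..pi}"
  proof (rule fundamental_theorem_of_calculus)
    fix t :: real
    have "((\<lambda>t. cis (j * t) / (\<i> * j)) has_vector_derivative
            (j *\<^sub>R (\<i> * cis (j * t))) / (\<i> * j)) (at t within {-pi..pi})"
      unfolding has_vector_derivative_def
      by (auto intro!: derivative_eq_intros simp: scaleR_conv_of_real fun_eq_iff complex_eq_iff)
    thus "((\<lambda>t. cis (j * t) / (\<i> * j)) has_vector_derivative cis (j * t)) (at t within {-pi..pi})"
      using False by (simp add: scaleR_conv_of_real)
  qed auto
  moreover have "cis (j * pi) = cis (j * (-pi))"
    using sin_zero_iff_int2[of "j * pi"] by (auto simp: complex_eq_iff)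
  ultimately show ?thesis using False by simp
qed

text \<open>
The mean of a geometric random variable of ratio \<open>q ^ a\<close>, that is, the mean number of parts of
size \<open>a\<close> in the independent model.
\<close>

definition occupation :: "real \<Rightarrow> nat \<Rightarrow> real" where
  "occupation q a = q ^ a / (1 - q ^ a)"

text \<open>
The variance of \<open>a * X\<close> for the same geometric random variable \<open>X\<close>.
\<close>

definition part_variance :: "real \<Rightarrow> nat \<Rightarrow> real" where
  "part_variance q a = (real a)\<^sup>2 * occupation q a * (1 + occupation q a)"

text \<open>
The characteristic function of \<open>a * X\<close>.
\<close>

definition geom_char :: "real \<Rightarrow> nat \<Rightarrow> real \<Rightarrow> complex" where
  "geom_char q a t = of_real (1 - q ^ a) / (1 - of_real (q ^ a) * cis (real a * t))"

lemma norm_one_minus_cis_sq: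
  "(norm (1 - of_real p * cis \<theta>))\<^sup>2 = (1 - p)\<^sup>2 + 4 * p * (sin (\<theta> / 2))\<^sup>2"
proof -
  have "(norm (1 - of_real p * cis \<theta>))\<^sup>2 = (1 - p * cos \<theta>)\<^sup>2 + (p * sin \<theta>)\<^sup>2"
    by (simp add: cmod_power2)
  also have "\<dots> = 1 - 2 * p * cos \<theta> + p\<^sup>2 * ((sin \<theta>)\<^sup>2 + (cos \<theta>)\<^sup>2)"
    by algebra
  also have "\<dots> = 1 - 2 * p * cos \<theta> + p\<^sup>2"
    by simp
  also have "\<dots> = (1 - p)\<^sup>2 + 2 * p * (1 - cos \<theta>)"
    by (simp add: power2_eq_square algebra_simps)
  also have "1 - cos \<theta> = 2 * (sin (\<theta> / 2))\<^sup>2"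
    using cos_double_sin[of "\<theta> / 2"] by simp
  finally show ?thesis by simp
qed

lemma power_in_unit_interval:
  assumes "0 < (q::real)" "q < 1" "a \<ge> (1::nat)"
  shows "0 < q ^ a" "q ^ a < 1"
  using assms by (auto simp: power_less_one_iff)

lemma one_minus_cis_nonzero:
  assumes "0 < p" "p < (1::real)"
  shows "1 - of_real p * cis \<theta> \<noteq> 0"
proof
  assume "1 - of_real p * cis \<theta> = 0"
  hence "(1 - p)\<^sup>2 + 4 * p * (sin (\<theta> / 2))\<^sup>2 = 0"
    using norm_one_minus_cis_sq[of p \<theta>] by simp
  moreover have "(1 - p)\<^sup>2 > 0" "4 * p * (sin (\<theta> / 2))\<^sup>2 \<ge> 0" using assms by auto
  ultimately show False by linarith
qed

text \<open>
The modulus depends on \<open>t\<close> only through the distance of \<open>a * t\<close> from the multiples of \<open>2 * pi\<close>. All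
decay estimates below start from this formula.
\<close>

lemma norm_geom_char_sq:
  assumes "0 < q" "q < 1" "a \<ge> 1"
  shows "(norm (geom_char q a t))\<^sup>2 =
    1 / (1 + 4 * occupation q a * (1 + occupation q a) * (sin (real a * t / 2))\<^sup>2)"
proof -
  define p where "p = q ^ a"
  have p: "0 < p" "p < 1" using power_in_unit_interval assms by (auto simp: p_def)
  have pos: "(1 - p)\<^sup>2 + 4 * p * (sin (real a * t / 2))\<^sup>2 > 0"
    using p by (intro add_pos_nonneg) auto
  have o: "4 * occupation q a * (1 + occupation q a) = 4 * p / (1 - p)\<^sup>2"
    using p by (simp add: occupation_def flip: p_def) (simp add: field_simps power2_eq_square)
  have "(norm (geom_char q a t))\<^sup>2 = (1 - p)\<^sup>2 / ((1 - p)\<^sup>2 + 4 * p * (sin (real a * t / 2))\<^sup>2)"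
    by (simp add: geom_char_def norm_divide power_divide norm_one_minus_cis_sq flip: p_def
        del: of_real_power of_real_diff)
  also have "\<dots> = 1 / (1 + 4 * p / (1 - p)\<^sup>2 * (sin (real a * t / 2))\<^sup>2)"
    using p pos by (simp add: field_simps)
  finally show ?thesis by (simp add: o)
qed

lemma occupation_pos:
  assumes "0 < q" "q < 1" "a \<ge> 1"
  shows "occupation q a > 0"
  using power_in_unit_interval[OF assms] by (simp add: occupation_def)

lemma norm_geom_char_le_1:
  assumes "0 < q" "q < 1" "a \<ge> 1"
  shows "norm (geom_char q a t) \<le> 1"
proof -
  have "(norm (geom_char q a t))\<^sup>2 \<le> 1"
    unfolding norm_geom_char_sq[OF assms] using occupation_pos[OF assms]
    by (auto simp: divide_le_eq_1 add_pos_nonneg)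
  thus ?thesis by (simp add: power_le_one_iff abs_square_le_1)
qed

lemma norm_cis_minus_1_le: "norm (cis \<theta> - 1) \<le> \<bar>\<theta>\<bar>"
  using iexp_approx1[of \<theta> 0] by (simp add: cis_conv_exp)

text \<open>
A characteristic function differs from 1 at \<open>t\<close> by at most \<open>\<bar>t\<bar>\<close> times the mean.
\<close>

lemma norm_geom_char_minus_1:
  assumes "0 < q" "q < 1" "a \<ge> 1"
  shows "norm (1 - geom_char q a t) \<le> \<bar>t\<bar> * (real a * occupation q a)"
proof -
  define p where "p = q ^ a"
  have p: "0 < p" "p < 1" using power_in_unit_interval assms by (auto simp: p_def)
  let ?d = "1 - of_real p * cis (real a * t)"
  have nz: "?d \<noteq> 0" using one_minus_cis_nonzero[OF p] .
  have "1 - geom_char q a t = of_real p * (1 - cis (real a * t)) / ?d"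
    using nz by (simp add: geom_char_def flip: p_def del: of_real_power) (simp add: field_simps)
  moreover have "norm ?d \<ge> 1 - p"
    using norm_triangle_ineq2[of 1 "of_real p * cis (real a * t)"] p by (simp add: norm_mult)
  moreover have "norm (1 - cis (real a * t)) \<le> real a * \<bar>t\<bar>"
    using norm_cis_minus_1_le[of "real a * t"] by (simp add: norm_minus_commute abs_mult)
  ultimately have "norm (1 - geom_char q a t) \<le> p * (real a * \<bar>t\<bar>) / (1 - p)"
    using p by (simp add: norm_divide norm_mult) (intro frac_le mult_left_mono, auto)
  thus ?thesis by (simp add: occupation_def flip: p_def)  (simp add: mult_ac)
qed

text \<open>
Orthogonality of the exponentials applied to the generating function on the circle of radius \<open>q\<close>.
The factors \<open>1 - q ^ a k\<close> normalise it to a characteristic function, so that the count appears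
multiplied by the probability weight it has in the independent model.
\<close>

lemma weighted_count_fourier:
  fixes q :: real
  assumes K: "finite K" "\<And>k. k \<in> K \<Longrightarrow> a k \<ge> (1::nat)" and q: "0 < q" "q < 1"
  shows "((\<lambda>t. (\<Prod>k\<in>K. geom_char q (a k) t) * cis (- (real n * t))) has_integral
           of_real (2 * pi * (weighted_count K a n * q ^ n * (\<Prod>k\<in>K. 1 - q ^ a k)))) {-pi..pi}"
proof -
  define Z where "Z = (\<Prod>k\<in>K. 1 - q ^ a k)"
  define f where "f = (\<lambda>m t. of_real (Z * weighted_count K a m * q ^ m) * cis (real_of_int (int m - int n) * t))"
  have Z: "Z \<ge> 0" unfolding Z_def using q K power_in_unit_interval(2)[OF q]
    by (intro prod_nonneg) (auto simp: less_imp_le)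
  have f_eq: "f m t = of_real Z * cis (- (real n * t)) * (of_nat (weighted_count K a m) * (of_real q * cis t) ^ m)" for m t
  proof -
    have "cis (real_of_int (int m - int n) * t) = cis (- (real n * t)) * cis (real m * t)"
      by (simp add: cis_mult algebra_simps)
    thus ?thesis by (simp add: f_def power_mult_distrib Complex.DeMoivre)
  qed
  have sums: "(\<lambda>m. f m t) sums ((\<Prod>k\<in>K. geom_char q (a k) t) * cis (- (real n * t)))" for t
  proof -
    have "(\<lambda>m. of_nat (weighted_count K a m) * (of_real q * cis t) ^ m) sums
          (\<Prod>k\<in>K. 1 / (1 - (of_real q * cis t) ^ a k))"
      using weighted_count_sums_and_summable[OF K, where z = "of_real q * cis t"] q by (auto simp: norm_mult)
    hence "(\<lambda>m. f m t) sums (of_real Z * cis (- (real n * t)) * (\<Prod>k\<in>K. 1 / (1 - (of_real q * cis t) ^ a k)))"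
      unfolding f_eq by (rule sums_mult)
    also have "of_real Z * cis (- (real n * t)) * (\<Prod>k\<in>K. 1 / (1 - (of_real q * cis t) ^ a k))
             = (\<Prod>k\<in>K. geom_char q (a k) t) * cis (- (real n * t))"
      by (simp add: Z_def geom_char_def power_mult_distrib Complex.DeMoivre prod_dividef mult_ac)
    finally show ?thesis .
  qed
  define M where "M = (\<lambda>m. Z * (weighted_count K a m * q ^ m))"
  have sM: "summable M" unfolding M_def
    using weighted_count_sums_and_summable[OF K, where z = q] q by (intro summable_mult) (auto simp: norm_mult)
  have "uniform_limit {-pi..pi} (\<lambda>N t. \<Sum>i<N. f i t) (\<lambda>t. suminf (\<lambda>i. f i t)) sequentially"
    by (rule Weierstrass_m_test[OF _ sM]) (use Z q in \<open>auto simp: f_def M_def norm_mult norm_power\<close>)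
  hence ul: "uniform_limit {-pi..pi} (\<lambda>N t. \<Sum>i<N. f i t)
       (\<lambda>t. (\<Prod>k\<in>K. geom_char q (a k) t) * cis (- (real n * t))) sequentially"
    using sums by (simp add: sums_iff)
  obtain I J where I: "\<And>N. ((\<lambda>t. \<Sum>i<N. f i t) has_integral I N) {-pi..pi}"
    and J: "((\<lambda>t. (\<Prod>k\<in>K. geom_char q (a k) t) * cis (- (real n * t))) has_integral J) {-pi..pi}"
    and IJ: "I \<longlonglongrightarrow> J"
    by (rule uniform_limit_integral[OF ul]) (auto simp: f_def intro!: continuous_intros)
  have fi: "(f m has_integral (if m = n then of_real (2 * pi * M n) else 0)) {-pi..pi}" for m
  proof -
    have "(f m has_integral (of_real (Z * weighted_count K a m * q ^ m) *
            of_real (if int m - int n = 0 then 2 * pi else 0))) {-pi..pi}"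
      unfolding f_def by (intro has_integral_mult_right integral_cis_int)
    thus ?thesis by (rule has_integral_eq_rhs) (auto simp: M_def)
  qed
  have "I N = of_real (2 * pi * M n)" if "N > n" for N
  proof -
    have "((\<lambda>t. \<Sum>i<N. f i t) has_integral (\<Sum>i<N. if i = n then of_real (2 * pi * M n) else 0)) {-pi..pi}"
      by (intro has_integral_sum fi) auto
    also have "(\<Sum>i<N. if i = n then of_real (2 * pi * M n) else 0) = complex_of_real (2 * pi * M n)"
      using that by simp
    finally show ?thesis using I[of N] has_integral_unique by blast
  qed
  hence "eventually (\<lambda>N. I N = of_real (2 * pi * M n)) sequentially"
    using eventually_gt_at_top[of n] by (rule eventually_mono[rotated])
  hence "I \<longlonglongrightarrow> of_real (2 * pi * M n)" by (rule tendsto_eventually)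
  hence "J = of_real (2 * pi * M n)" using IJ LIMSEQ_unique by blast
  thus ?thesis using J by (simp add: M_def Z_def mult_ac)
qed

section \<open>Gaussian approximation of the characteristic functions\<close>

text \<open>
The expansion \<open>- ln (1 - z) = z + z^2 / 2 + O (z^3)\<close>, written without a complex logarithm. It is
used for \<open>z = w * (cis \<theta> - 1)\<close>, because \<open>geom_char\<close> is \<open>1 / (1 - z)\<close> for \<open>w = occupation q a\<close>.
\<close>

lemma inverse_one_minus_approx_exp:
  fixes z :: complex
  assumes "norm z \<le> 1 / 2"
  shows "norm (1 / (1 - z) - exp (z + z\<^sup>2 / 2)) \<le> 5 * norm z ^ 3"
proof -
  define y where "y = z + z\<^sup>2 / 2"
  have "norm y \<le> norm z + norm z * norm z / 2"
    unfolding y_def by (rule order_trans[OF norm_triangle_ineq]) (simp add: norm_mult power2_eq_square)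
  also have "\<dots> \<le> norm z + norm z * (1 / 2) / 2"
    using assms by (intro add_left_mono divide_right_mono mult_left_mono) auto
  finally have y: "norm y \<le> 5 / 4 * norm z" by simp
  have y1: "norm y \<le> 5 / 8" using y assms by simp
  have "norm (exp y - (\<Sum>k\<le>2. y ^ k / fact k)) \<le> exp \<bar>Re y\<bar> * norm y ^ Suc 2 / fact 2"
    by (rule Taylor_exp)
  also have "(\<Sum>k\<le>2. y ^ k / fact k) = 1 + y + y\<^sup>2 / 2"
    by (simp add: eval_nat_numeral)
  also have "exp \<bar>Re y\<bar> * norm y ^ Suc 2 / fact 2 \<le> 2.1 * (5 / 4 * norm z) ^ Suc 2 / fact 2"
  proof (intro divide_right_mono mult_mono power_mono)
    have "\<bar>Re y\<bar> \<le> 5 / 8" using abs_Re_le_cmod[of y] y1 by linarith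
    hence "exp \<bar>Re y\<bar> \<le> 1 + \<bar>Re y\<bar> + \<bar>Re y\<bar>\<^sup>2" by (intro exp_bound) auto
    also have "\<dots> \<le> 1 + 5 / 8 + (5 / 8)\<^sup>2"
      using \<open>\<bar>Re y\<bar> \<le> 5 / 8\<close> by (intro add_mono power_mono) auto
    finally have "exp \<bar>Re y\<bar> \<le> 2.1" by (simp add: power2_eq_square)
    thus "exp \<bar>Re y\<bar> \<le> 2.1" .
  qed (use y in auto)
  also have "\<dots> \<le> 2.1 * norm z ^ 3" by (simp add: eval_nat_numeral mult_right_mono)
  finally have e: "norm (exp y - (1 + y + y\<^sup>2 / 2)) \<le> 2.1 * norm z ^ 3" .
  have nz: "1 - z \<noteq> 0" using assms by auto
  have "1 / (1 - z) - (1 + y + y\<^sup>2 / 2) = z ^ 3 * (1 / (1 - z) - (1 / 2 + z / 8))"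
    using nz unfolding y_def by (simp add: field_simps power2_eq_square power3_eq_cube)
  moreover have "norm (1 / (1 - z) - (1 / 2 + z / 8)) \<le> 2.9"
  proof -
    have "norm (1 - z) \<ge> 1 / 2" using norm_triangle_ineq2[of 1 z] assms by simp
    hence "norm (1 / (1 - z)) \<le> 2" using nz by (simp add: norm_divide divide_le_eq)
    moreover have "norm (1 / 2 + z / 8) \<le> 1 / 2 + 1 / 16"
      by (rule order_trans[OF norm_triangle_ineq]) (use assms in auto)
    ultimately show ?thesis using norm_triangle_ineq4[of "1 / (1 - z)" "1 / 2 + z / 8"] by linarith
  qed
  ultimately have "norm (1 / (1 - z) - (1 + y + y\<^sup>2 / 2)) \<le> norm z ^ 3 * 2.9"
    by (simp only: norm_mult norm_power) (rule mult_left_mono, auto)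
  moreover have "norm (1 / (1 - z) - exp y) \<le>
      norm (1 / (1 - z) - (1 + y + y\<^sup>2 / 2)) + norm ((1 + y + y\<^sup>2 / 2) - exp y)"
    by (rule norm_diff_triangle_le[OF order_refl order_refl])
  ultimately show ?thesis using e unfolding y_def[symmetric] by (simp add: norm_minus_commute)
qed

lemma norm_exp_diff_le:
  fixes z w :: complex
  assumes "Re z \<le> 1" "Re w \<le> 1"
  shows "norm (exp z - exp w) \<le> 3 * norm (z - w)"
proof (rule field_differentiable_bound[where S = "{z. Re z \<le> 1}" and f = exp and f' = exp])
  show "convex {z. Re z \<le> 1}" by (rule convex_halfspace_Re_le)
  show "norm (exp z) \<le> 3" if "z \<in> {z. Re z \<le> 1}" for z
  proof -
    have "exp (Re z) \<le> exp 1" using that by simp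
    also have "\<dots> \<le> 3" using exp_le by simp
    finally show ?thesis by simp
  qed
qed (use assms in \<open>auto intro!: derivative_eq_intros\<close>)

lemma cis_taylor:
  "norm (cis \<theta> - 1 - \<i> * \<theta>) \<le> \<bar>\<theta>\<bar>\<^sup>2 / 2"
  "norm (cis \<theta> - 1 - \<i> * \<theta> + \<theta>\<^sup>2 / 2) \<le> \<bar>\<theta>\<bar> ^ 3 / 6"
  using iexp_approx1[of \<theta> 1] iexp_approx1[of \<theta> 2]
  by (simp_all add: cis_conv_exp eval_nat_numeral algebra_simps)

text \<open>
The error in the central limit theorem caused by one part. The factor on the right plays the
role of the third absolute central moment.
\<close>

lemma geom_char_approx:
  assumes "0 < q" "q < 1" "a \<ge> 1" and t: "\<bar>t\<bar> * (a * occupation q a) \<le> 1 / 2"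
  shows "norm (geom_char q a t * cis (- (a * occupation q a * t)) - exp (- of_real (part_variance q a * t\<^sup>2 / 2)))
         \<le> 5 * \<bar>t\<bar> ^ 3 * (part_variance q a * a * (1 + occupation q a))"
proof -
  define p where "p = q ^ a"
  define w where "w = occupation q a"
  define \<theta> where "\<theta> = a * t"
  have p: "0 < p" "p < 1" using power_in_unit_interval assms by (auto simp: p_def)
  have w: "w > 0" unfolding w_def using occupation_pos assms by auto
  have wp: "w = p / (1 - p)" by (simp add: w_def p_def occupation_def)
  have w\<theta>: "w * \<bar>\<theta>\<bar> \<le> 1 / 2" using t by (simp add: w_def \<theta>_def abs_mult mult_ac)
  define z where "z = of_real w * (cis \<theta> - 1)"
  define A where "A = z + z\<^sup>2 / 2"
  define B where "B = \<i> * of_real (w * \<theta>) - of_real (w * (1 + w) * \<theta>\<^sup>2 / 2)"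
  have z_le: "norm z \<le> w * \<bar>\<theta>\<bar>"
    unfolding z_def using w norm_cis_minus_1_le[of \<theta>] by (simp add: norm_mult)
  have z_half: "norm z \<le> 1 / 2" using z_le w\<theta> by simp
  have gc: "geom_char q a t = 1 / (1 - z)"
  proof -
    have "1 - z = (1 - of_real p * cis \<theta>) / of_real (1 - p)"
      using p by (simp add: z_def wp) (simp add: field_simps)
    thus ?thesis by (simp add: geom_char_def \<theta>_def p_def)
  qed
  have 1: "norm (1 / (1 - z) - exp A) \<le> 5 * (w * \<bar>\<theta>\<bar>) ^ 3"
    using inverse_one_minus_approx_exp[OF z_half] power_mono[OF z_le, of 3] by (simp add: A_def)
  have 2: "norm (exp A - exp B) \<le> 3 * norm (A - B)"
  proof (rule norm_exp_diff_le)
    have "Re A \<le> norm A" by (rule complex_Re_le_cmod)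
    also have "\<dots> \<le> norm z + norm z * norm z / 2"
      unfolding A_def by (rule order_trans[OF norm_triangle_ineq]) (simp add: norm_mult power2_eq_square)
    also have "\<dots> \<le> 1 / 2 + 1 / 2 * (1 / 2) / 2"
      using z_half by (intro add_mono divide_right_mono mult_mono) auto
    finally show "Re A \<le> 1" by simp
    have "w * (1 + w) * \<theta>\<^sup>2 \<ge> 0" using w by simp
    thus "Re B \<le> 1" unfolding B_def by simp
  qed
  have "A - B = of_real w * (cis \<theta> - 1 - \<i> * \<theta> + \<theta>\<^sup>2 / 2)
      + of_real w ^ 2 / 2 * ((cis \<theta> - 1 - \<i> * \<theta>) * (cis \<theta> - 1 + \<i> * \<theta>))"
    unfolding A_def B_def z_def by (simp add: field_simps power2_eq_square)
  also have "norm \<dots> \<le> w * (\<bar>\<theta>\<bar> ^ 3 / 6) + w\<^sup>2 / 2 * (\<bar>\<theta>\<bar>\<^sup>2 / 2 * (2 * \<bar>\<theta>\<bar>))"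
  proof -
    have "norm (cis \<theta> - 1 + \<i> * \<theta>) \<le> norm (cis \<theta> - 1) + norm (\<i> * \<theta>)" by (rule norm_triangle_ineq)
    hence "norm (cis \<theta> - 1 + \<i> * \<theta>) \<le> 2 * \<bar>\<theta>\<bar>"
      using norm_cis_minus_1_le[of \<theta>] by (simp add: norm_mult)
    hence "norm ((cis \<theta> - 1 - \<i> * \<theta>) * (cis \<theta> - 1 + \<i> * \<theta>)) \<le> \<bar>\<theta>\<bar>\<^sup>2 / 2 * (2 * \<bar>\<theta>\<bar>)"
      unfolding norm_mult by (intro mult_mono cis_taylor) auto
    hence "norm (of_real w ^ 2 / 2 * ((cis \<theta> - 1 - \<i> * \<theta>) * (cis \<theta> - 1 + \<i> * \<theta>)))
        \<le> w\<^sup>2 / 2 * (\<bar>\<theta>\<bar>\<^sup>2 / 2 * (2 * \<bar>\<theta>\<bar>))"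
      by (subst norm_mult, intro mult_mono) (use w in \<open>auto simp: norm_divide norm_power\<close>)
    moreover have "norm (of_real w * (cis \<theta> - 1 - \<i> * \<theta> + \<theta>\<^sup>2 / 2)) \<le> w * (\<bar>\<theta>\<bar> ^ 3 / 6)"
      unfolding norm_mult using w cis_taylor(2)[of \<theta>] by (intro mult_mono) auto
    ultimately show ?thesis by (intro order_trans[OF norm_triangle_ineq] add_mono)
  qed
  finally have 3: "norm (A - B) \<le> w * \<bar>\<theta>\<bar> ^ 3 / 6 + w\<^sup>2 * \<bar>\<theta>\<bar> ^ 3 / 2"
    by (simp add: power2_eq_square power3_eq_cube)
  have "norm (1 / (1 - z) - exp B) \<le> norm (1 / (1 - z) - exp A) + norm (exp A - exp B)"
    by (rule norm_diff_triangle_le[OF order_refl order_refl])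
  also have "\<dots> \<le> 5 * (w * \<bar>\<theta>\<bar>) ^ 3 + 3 * (w * \<bar>\<theta>\<bar> ^ 3 / 6 + w\<^sup>2 * \<bar>\<theta>\<bar> ^ 3 / 2)"
    by (intro add_mono 1 order_trans[OF 2] mult_left_mono 3) auto
  also have "\<dots> = \<bar>\<theta>\<bar> ^ 3 * (5 * w ^ 3 + w / 2 + 3 / 2 * w\<^sup>2)"
    by (simp add: power_mult_distrib algebra_simps)
  also have "\<dots> \<le> \<bar>\<theta>\<bar> ^ 3 * (5 * (w * (1 + w)\<^sup>2))"
  proof (intro mult_left_mono)
    have "5 * (w * (1 + w)\<^sup>2) = 5 * w ^ 3 + 5 * w + 10 * w\<^sup>2" by algebra
    moreover have "w\<^sup>2 \<ge> 0" by simp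
    ultimately show "5 * w ^ 3 + w / 2 + 3 / 2 * w\<^sup>2 \<le> 5 * (w * (1 + w)\<^sup>2)"
      using w by linarith
  qed auto
  finally have main: "norm (1 / (1 - z) - exp B) \<le> \<bar>\<theta>\<bar> ^ 3 * (5 * (w * (1 + w)\<^sup>2))" .
  have "exp B * cis (- (w * \<theta>)) = exp (- of_real (w * (1 + w) * \<theta>\<^sup>2 / 2))"
    by (simp add: B_def cis_conv_exp flip: exp_add)
  hence "geom_char q a t * cis (- (w * \<theta>)) - exp (- of_real (w * (1 + w) * \<theta>\<^sup>2 / 2))
       = (1 / (1 - z) - exp B) * cis (- (w * \<theta>))"
    by (simp add: gc left_diff_distrib)
  hence "norm (geom_char q a t * cis (- (w * \<theta>)) - exp (- of_real (w * (1 + w) * \<theta>\<^sup>2 / 2)))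
       \<le> \<bar>\<theta>\<bar> ^ 3 * (5 * (w * (1 + w)\<^sup>2))"
    using main by (simp add: norm_mult)
  moreover have "w * (1 + w) * \<theta>\<^sup>2 / 2 = part_variance q a * t\<^sup>2 / 2" "w * \<theta> = a * occupation q a * t"
    by (simp_all add: part_variance_def w_def \<theta>_def power_mult_distrib)
  moreover have "\<bar>\<theta>\<bar> ^ 3 * (5 * (w * (1 + w)\<^sup>2)) = 5 * \<bar>t\<bar> ^ 3 * (part_variance q a * a * (1 + occupation q a))"
    by (simp add: part_variance_def w_def \<theta>_def power_mult_distrib abs_mult power2_eq_square power3_eq_cube)
  ultimately show ?thesis by simp
qed

text \<open>
Since \<open>exp y \<ge> 1 + y\<close>, an arc tangent bounds the integral, and the exact Gaussian integral can be
avoided.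
\<close>

lemma gaussian_integral_le:
  assumes "b > 0"
  shows "integral {-pi..pi} (\<lambda>t. exp (- b * t\<^sup>2)) \<le> pi / sqrt b"
proof -
  have "((\<lambda>t. 1 / (1 + b * t\<^sup>2)) has_integral (arctan (sqrt b * pi) / sqrt b - arctan (sqrt b * (-pi)) / sqrt b)) {-pi..pi}"
  proof (rule fundamental_theorem_of_calculus)
    fix t :: real
    have "((\<lambda>t. arctan (sqrt b * t) / sqrt b) has_real_derivative
            (inverse (1 + (sqrt b * t)\<^sup>2) * sqrt b) / sqrt b) (at t within {-pi..pi})"
      by (intro DERIV_cdivide) (rule derivative_eq_intros refl | simp)+
    moreover have "(inverse (1 + (sqrt b * t)\<^sup>2) * sqrt b) / sqrt b = 1 / (1 + b * t\<^sup>2)"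
      using assms by (simp add: power_mult_distrib inverse_eq_divide)
    ultimately show "((\<lambda>t. arctan (sqrt b * t) / sqrt b) has_vector_derivative 1 / (1 + b * t\<^sup>2)) (at t within {-pi..pi})"
      using has_real_derivative_iff_has_vector_derivative by metis
  qed auto
  hence i: "(\<lambda>t. 1 / (1 + b * t\<^sup>2)) integrable_on {-pi..pi}"
    and v: "integral {-pi..pi} (\<lambda>t. 1 / (1 + b * t\<^sup>2)) = 2 * arctan (sqrt b * pi) / sqrt b"
    by (simp_all add: has_integral_iff arctan_minus)
  have "integral {-pi..pi} (\<lambda>t. exp (- b * t\<^sup>2)) \<le> integral {-pi..pi} (\<lambda>t. 1 / (1 + b * t\<^sup>2))"
  proof (rule integral_le[OF _ i])
    show "(\<lambda>t. exp (- b * t\<^sup>2)) integrable_on {-pi..pi}"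
      by (intro integrable_continuous_interval continuous_intros)
    fix t :: real
    have "exp (b * t\<^sup>2) \<ge> 1 + b * t\<^sup>2" using exp_ge_add_one_self[of "b * t\<^sup>2"] .
    moreover have "1 + b * t\<^sup>2 > 0" using assms by (intro add_pos_nonneg) auto
    moreover have "exp (- b * t\<^sup>2) = 1 / exp (b * t\<^sup>2)" by (simp add: exp_minus inverse_eq_divide)
    ultimately show "exp (- b * t\<^sup>2) \<le> 1 / (1 + b * t\<^sup>2)"
      by (simp add: frac_le)
  qed
  also have "\<dots> \<le> 2 * (pi / 2) / sqrt b"
    unfolding v using assms arctan_ubound[of "sqrt b * pi"]
    by (intro divide_right_mono mult_left_mono) auto
  finally show ?thesis by simp
qed

lemma gaussian_integral_ge:
  assumes "\<sigma> \<ge> 1"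
  shows "integral {-pi..pi} (\<lambda>t. exp (- (\<sigma>\<^sup>2 * t\<^sup>2 / 2))) \<ge> 1 / \<sigma>"
proof -
  have sub: "{-1/\<sigma>..1/\<sigma>} \<subseteq> {-pi..pi}"
  proof -
    have "1 / \<sigma> \<le> 1" using assms by simp
    thus ?thesis using pi_gt3 by auto
  qed
  have "1 / \<sigma> = integral {-1/\<sigma>..1/\<sigma>} (\<lambda>t. 1 / 2)" using assms by simp
  also have "\<dots> \<le> integral {-1/\<sigma>..1/\<sigma>} (\<lambda>t. exp (- (\<sigma>\<^sup>2 * t\<^sup>2 / 2)))"
  proof (intro integral_le integrable_continuous_interval continuous_intros)
    fix t assume "t \<in> {-1/\<sigma>..1/\<sigma>}"
    hence "\<bar>\<sigma> * t\<bar> \<le> 1" using assms by (auto simp: abs_le_iff field_simps)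
    hence "(\<sigma> * t)\<^sup>2 \<le> 1" by (simp add: abs_square_le_1)
    hence "1 / 2 \<le> 1 + (- (\<sigma>\<^sup>2 * t\<^sup>2 / 2))" by (simp add: power_mult_distrib)
    also have "\<dots> \<le> exp (- (\<sigma>\<^sup>2 * t\<^sup>2 / 2))" by (rule exp_ge_add_one_self)
    finally show "1 / 2 \<le> exp (- (\<sigma>\<^sup>2 * t\<^sup>2 / 2))" .
  qed auto
  also have "\<dots> \<le> integral {-pi..pi} (\<lambda>t. exp (- (\<sigma>\<^sup>2 * t\<^sup>2 / 2)))"
    using sub by (intro integral_subset_le integrable_continuous_interval continuous_intros) auto
  finally show ?thesis .
qed


lemma norm_prod_geom_char_le_1:
  assumes "0 < q" "q < 1" "\<And>k. k \<in> K \<Longrightarrow> a k \<ge> (1::nat)"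
  shows "norm (\<Prod>k\<in>K. geom_char q (a k) t) \<le> 1"
  unfolding prod_norm[symmetric] using norm_geom_char_le_1[OF assms(1,2)] assms(3)
  by (intro prod_le_1) auto

lemma norm_one_minus_prod_geom_char:
  assumes "0 < q" "q < 1" "\<And>k. k \<in> K \<Longrightarrow> a k \<ge> (1::nat)"
  shows "norm (1 - (\<Prod>k\<in>K. geom_char q (a k) t)) \<le> \<bar>t\<bar> * (\<Sum>k\<in>K. real (a k) * occupation q (a k))"
proof -
  have "norm ((\<Prod>k\<in>K. 1) - (\<Prod>k\<in>K. geom_char q (a k) t)) \<le> (\<Sum>k\<in>K. norm (1 - geom_char q (a k) t))"
    by (rule norm_prod_diff) (use norm_geom_char_le_1[OF assms(1,2)] assms(3) in auto)
  also have "\<dots> \<le> (\<Sum>k\<in>K. \<bar>t\<bar> * (real (a k) * occupation q (a k)))"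
    by (intro sum_mono norm_geom_char_minus_1 assms)
  finally show ?thesis by (simp add: sum_distrib_left)
qed

text \<open>
The errors of the factors add up because all factors have modulus at most 1.
\<close>

lemma prod_geom_char_approx:
  fixes a :: "'k \<Rightarrow> nat"
  assumes q: "0 < q" "q < 1" and K: "\<And>k. k \<in> K \<Longrightarrow> a k \<ge> 1"
    and t: "\<And>k. k \<in> K \<Longrightarrow> \<bar>t\<bar> * (a k * occupation q (a k)) \<le> 1 / 2"
  shows "norm ((\<Prod>k\<in>K. geom_char q (a k) t) * cis (- ((\<Sum>k\<in>K. a k * occupation q (a k)) * t))
            - exp (- of_real ((\<Sum>k\<in>K. part_variance q (a k)) * t\<^sup>2 / 2)))
         \<le> 5 * \<bar>t\<bar> ^ 3 * (\<Sum>k\<in>K. part_variance q (a k) * a k * (1 + occupation q (a k)))"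
proof (cases "finite K")
  case False
  thus ?thesis by simp
next
  case fin: True
  have cis_sum: "cis (- ((\<Sum>k\<in>K. a k * occupation q (a k)) * t)) = (\<Prod>k\<in>K. cis (- (a k * occupation q (a k) * t)))"
    using fin by (simp add: cis_conv_exp sum_distrib_right sum_distrib_left flip: exp_sum sum_negf)
  have exp_sum': "exp (- complex_of_real ((\<Sum>k\<in>K. part_variance q (a k)) * t\<^sup>2 / 2))
       = (\<Prod>k\<in>K. exp (- of_real (part_variance q (a k) * t\<^sup>2 / 2)))"
    using fin by (simp add: sum_distrib_right sum_divide_distrib flip: exp_sum sum_negf)
  have "norm ((\<Prod>k\<in>K. geom_char q (a k) t * cis (- (a k * occupation q (a k) * t)))
          - (\<Prod>k\<in>K. exp (- of_real (part_variance q (a k) * t\<^sup>2 / 2))))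
       \<le> (\<Sum>k\<in>K. norm (geom_char q (a k) t * cis (- (a k * occupation q (a k) * t))
          - exp (- of_real (part_variance q (a k) * t\<^sup>2 / 2))))"
  proof (rule norm_prod_diff)
    fix k assume k: "k \<in> K"
    show "norm (geom_char q (a k) t * cis (- (a k * occupation q (a k) * t))) \<le> 1"
      using norm_geom_char_le_1[OF q K[OF k]] by (simp add: norm_mult)
    have "occupation q (a k) > 0" using occupation_pos[OF q K[OF k]] .
    hence "part_variance q (a k) * t\<^sup>2 / 2 \<ge> 0" by (simp add: part_variance_def)
    thus "norm (exp (- complex_of_real (part_variance q (a k) * t\<^sup>2 / 2))) \<le> 1" by simp
  qed
  also have "\<dots> \<le> (\<Sum>k\<in>K. 5 * \<bar>t\<bar> ^ 3 * (part_variance q (a k) * a k * (1 + occupation q (a k))))"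
    by (intro sum_mono geom_char_approx q K t)
  finally show ?thesis
    by (simp only: cis_sum exp_sum' prod.distrib[symmetric] sum_distrib_left[symmetric])
qed

section \<open>Removing parts from a weighted count\<close>

text \<open>
The local limit theorem in the form of a lower bound. On \<open>\<bar>t\<bar> \<le> R / \<sigma>\<close> the integrand is close to
the Gaussian, elsewhere both are small, and multiplying by \<open>exp (c * R^2 / 2 - c * \<sigma>^2 * t^2 / 2)\<close>
respectively splitting off its inverse puts both bounds under a single Gaussian. The constant \<open>\<kappa>\<close> is small
when \<open>R\<close> is large and then \<open>\<sigma>\<close> is large.
\<close>

lemma weighted_count_ge_gaussian:
  fixes a :: "'k \<Rightarrow> nat" and q :: real
  assumes fin: "finite K" and K: "\<And>k. k \<in> K \<Longrightarrow> a k \<ge> 1" and q: "0 < q" "q < 1"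
    and \<sigma>: "\<sigma> \<ge> 1" "\<sigma>\<^sup>2 = (\<Sum>k\<in>K. part_variance q (a k))"
    and mean: "\<bar>(\<Sum>k\<in>K. a k * occupation q (a k)) - real n\<bar> \<le> 1"
    and \<beta>: "\<beta> = (\<Sum>k\<in>K. part_variance q (a k) * a k * (1 + occupation q (a k)))"
    and c: "0 < c" "c \<le> 1 / 2" and \<epsilon>: "\<epsilon> \<ge> 0"
    and bound: "\<And>t. \<bar>t\<bar> \<le> pi \<Longrightarrow> norm (\<Prod>k\<in>K. geom_char q (a k) t) \<le> exp (- (c * \<sigma>\<^sup>2 * t\<^sup>2)) + \<epsilon>"
    and R: "R > 0" "\<And>k. k \<in> K \<Longrightarrow> R / \<sigma> * (a k * occupation q (a k)) \<le> 1 / 2"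
  defines "\<kappa> \<equiv> (R / \<sigma> + 5 * (R / \<sigma>) ^ 3 * \<beta>) * exp (c * R\<^sup>2 / 2) + 2 * exp (- (c * R\<^sup>2 / 2))"
  shows "2 * pi * (weighted_count K a n * q ^ n * (\<Prod>k\<in>K. 1 - q ^ a k))
         \<ge> 1 / \<sigma> - (\<kappa> * (pi / (sqrt (c / 2) * \<sigma>)) + 2 * pi * \<epsilon>)"
proof -
  define \<phi> where "\<phi> = (\<lambda>t. \<Prod>k\<in>K. geom_char q (a k) t)"
  define \<mu> where "\<mu> = (\<Sum>k\<in>K. a k * occupation q (a k))"
  define J where "J = 2 * pi * (weighted_count K a n * q ^ n * (\<Prod>k\<in>K. 1 - q ^ a k))"
  define g where "g = (\<lambda>t. exp (- (\<sigma>\<^sup>2 * t\<^sup>2 / 2)))"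
  have \<beta>0: "\<beta> \<ge> 0" unfolding \<beta> using occupation_pos[OF q K]
    by (intro sum_nonneg) (auto simp: part_variance_def less_imp_le intro!: mult_nonneg_nonneg add_nonneg_nonneg)
  have \<kappa>: "\<kappa> \<ge> 0" unfolding \<kappa>_def using R(1) \<sigma>(1) \<beta>0 by (intro add_nonneg_nonneg mult_nonneg_nonneg) auto
  have J: "((\<lambda>t. \<phi> t * cis (- (real n * t))) has_integral of_real J) {-pi..pi}"
    unfolding \<phi>_def J_def by (rule weighted_count_fourier[OF fin K q])
  have g_int: "g integrable_on {-pi..pi}" unfolding g_def
    by (intro integrable_continuous_interval continuous_intros) auto
  define b where "b = c * \<sigma>\<^sup>2 / 2"
  have b: "b > 0" using c \<sigma>(1) by (simp add: b_def)
  have h_int: "(\<lambda>t. \<kappa> * exp (- b * t\<^sup>2) + \<epsilon>) integrable_on {-pi..pi}"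
    by (intro integrable_continuous_interval continuous_intros)
  have pw: "norm (\<phi> t * cis (- (real n * t)) - of_real (g t)) \<le> \<kappa> * exp (- b * t\<^sup>2) + \<epsilon>" if t: "t \<in> {-pi..pi}" for t
  proof (cases "\<bar>t\<bar> \<le> R / \<sigma>")
    case True
    have "norm (\<phi> t * cis (- (\<mu> * t)) - of_real (g t)) \<le> 5 * \<bar>t\<bar> ^ 3 * \<beta>"
    proof -
      have "\<bar>t\<bar> * (a k * occupation q (a k)) \<le> 1 / 2" if "k \<in> K" for k
      proof -
        have "\<bar>t\<bar> * (a k * occupation q (a k)) \<le> R / \<sigma> * (a k * occupation q (a k))"
          using True occupation_pos[OF q K[OF that]] by (intro mult_right_mono) auto
        thus ?thesis using R(2)[OF that] by linarith
      qed
      from prod_geom_char_approx[OF q K this] show ?thesis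
        by (simp only: \<phi>_def \<mu>_def \<beta> g_def \<sigma>(2) exp_of_real of_real_minus[symmetric])
    qed
    moreover have "norm (\<phi> t * cis (- (real n * t)) - \<phi> t * cis (- (\<mu> * t))) \<le> \<bar>t\<bar>"
    proof -
      have "cis (- (real n * t)) = cis (- (\<mu> * t)) * cis ((\<mu> - n) * t)"
        by (simp add: cis_mult algebra_simps)
      hence "\<phi> t * cis (- (real n * t)) - \<phi> t * cis (- (\<mu> * t)) = \<phi> t * cis (- (\<mu> * t)) * (cis ((\<mu> - n) * t) - 1)"
        by (simp add: algebra_simps)
      hence "norm (\<phi> t * cis (- (real n * t)) - \<phi> t * cis (- (\<mu> * t))) = norm (\<phi> t) * norm (cis ((\<mu> - n) * t) - 1)"
        by (simp add: norm_mult)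
      also have "\<dots> \<le> 1 * norm (cis ((\<mu> - n) * t) - 1)"
        unfolding \<phi>_def by (intro mult_right_mono norm_prod_geom_char_le_1 q K) auto
      also have "\<dots> \<le> \<bar>\<mu> - n\<bar> * \<bar>t\<bar>"
        using norm_cis_minus_1_le[of "(\<mu> - n) * t"] by (simp add: abs_mult)
      also have "\<dots> \<le> 1 * \<bar>t\<bar>" using mean unfolding \<mu>_def by (intro mult_right_mono) auto
      finally show ?thesis by simp
    qed
    ultimately have "norm (\<phi> t * cis (- (real n * t)) - of_real (g t)) \<le> \<bar>t\<bar> + 5 * \<bar>t\<bar> ^ 3 * \<beta>"
      using norm_diff_triangle_le by blast
    also have "\<dots> \<le> R / \<sigma> + 5 * (R / \<sigma>) ^ 3 * \<beta>"
      using True \<beta>0 by (intro add_mono mult_right_mono mult_left_mono power_mono) auto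
    also have "\<dots> \<le> (R / \<sigma> + 5 * (R / \<sigma>) ^ 3 * \<beta>) * (exp (c * R\<^sup>2 / 2) * exp (- b * t\<^sup>2))"
    proof -
      have "(\<sigma> * \<bar>t\<bar>)\<^sup>2 \<le> R\<^sup>2" using True \<sigma> by (intro power_mono) (auto simp: field_simps)
      hence "c * (\<sigma> * \<bar>t\<bar>)\<^sup>2 \<le> c * R\<^sup>2" using c by simp
      hence "1 \<le> exp (c * R\<^sup>2 / 2 - b * t\<^sup>2)" by (simp add: b_def power_mult_distrib)
      also have "\<dots> = exp (c * R\<^sup>2 / 2) * exp (- b * t\<^sup>2)" by (simp flip: exp_add)
      finally have "1 \<le> exp (c * R\<^sup>2 / 2) * exp (- b * t\<^sup>2)" .
      moreover have "R / \<sigma> + 5 * (R / \<sigma>) ^ 3 * \<beta> \<ge> 0"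
        using R(1) \<sigma>(1) \<beta>0 by (intro add_nonneg_nonneg mult_nonneg_nonneg) auto
      ultimately show ?thesis using mult_left_mono by fastforce
    qed
    also have "\<dots> \<le> \<kappa> * exp (- b * t\<^sup>2)"
      unfolding \<kappa>_def by (simp add: algebra_simps)
    finally show ?thesis using \<epsilon> by linarith
  next
    case False
    have "(\<sigma> * \<bar>t\<bar>)\<^sup>2 \<ge> R\<^sup>2" using False \<sigma> R(1) by (intro power_mono) (auto simp: field_simps)
    hence "c * (\<sigma> * \<bar>t\<bar>)\<^sup>2 \<ge> c * R\<^sup>2" using c by simp
    hence *: "exp (- (c * \<sigma>\<^sup>2 * t\<^sup>2)) \<le> exp (- (c * R\<^sup>2 / 2)) * exp (- b * t\<^sup>2)"
      by (simp add: b_def power_mult_distrib flip: exp_add)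
    have "norm (\<phi> t * cis (- (real n * t)) - of_real (g t)) \<le> norm (\<phi> t) + g t"
      by (rule order_trans[OF norm_triangle_ineq4]) (simp add: norm_mult g_def)
    also have "g t \<le> exp (- (c * \<sigma>\<^sup>2 * t\<^sup>2))"
      using c mult_right_mono[of c "1/2" "\<sigma>\<^sup>2 * t\<^sup>2"] by (simp add: g_def)
    also have "norm (\<phi> t) \<le> exp (- (c * \<sigma>\<^sup>2 * t\<^sup>2)) + \<epsilon>"
      unfolding \<phi>_def using t by (intro bound) auto
    finally have "norm (\<phi> t * cis (- (real n * t)) - of_real (g t)) \<le> 2 * exp (- (c * R\<^sup>2 / 2)) * exp (- b * t\<^sup>2) + \<epsilon>"
      using * by linarith
    also have "2 * exp (- (c * R\<^sup>2 / 2)) \<le> \<kappa>"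
      unfolding \<kappa>_def using R(1) \<sigma>(1) \<beta>0 by simp
    finally show ?thesis by (simp add: mult_right_mono)
  qed
  have gc: "((\<lambda>t. complex_of_real (g t)) has_integral of_real (integral {-pi..pi} g)) {-pi..pi}"
    using g_int by (intro has_integral_of_real integrable_integral)
  have "norm (complex_of_real J - of_real (integral {-pi..pi} g)) \<le> integral {-pi..pi} (\<lambda>t. \<kappa> * exp (- b * t\<^sup>2) + \<epsilon>)"
    using has_integral_diff[OF J gc] pw h_int
    by (metis (no_types, lifting) has_integral_integrable_integral integral_norm_bound_integral)
  also have "\<dots> = \<kappa> * integral {-pi..pi} (\<lambda>t. exp (- b * t\<^sup>2)) + 2 * pi * \<epsilon>"
    by (subst integral_add) (auto intro!: integrable_continuous_interval continuous_intros)
  also have "\<dots> \<le> \<kappa> * (pi / sqrt b) + 2 * pi * \<epsilon>"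
    using gaussian_integral_le[OF b] \<kappa> by (intro add_mono mult_left_mono) auto
  also have "sqrt b = sqrt (c / 2) * \<sigma>" using \<sigma>(1) by (simp add: b_def real_sqrt_mult real_sqrt_divide)
  finally have "\<bar>J - integral {-pi..pi} g\<bar> \<le> \<kappa> * (pi / (sqrt (c / 2) * \<sigma>)) + 2 * pi * \<epsilon>"
    by (simp only: of_real_diff[symmetric] norm_of_real)
  moreover have "integral {-pi..pi} g \<ge> 1 / \<sigma>"
    unfolding g_def using gaussian_integral_ge[OF \<sigma>(1)] .
  ultimately show ?thesis unfolding J_def by linarith
qed

text \<open>
The integrands for \<open>K'\<close> and \<open>K\<close> differ by the factor \<open>1 - \<phi>\<close> with \<open>\<phi>\<close> the characteristic
function of the removed parts, and this is at most \<open>E * \<bar>t\<bar>\<close>. Integrating \<open>\<bar>t\<bar>\<close> against a Gaussian of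
width \<open>1 / \<sigma>\<close> gains \<open>1 / \<sigma>\<close> over the local probability itself.
\<close>

lemma thinned_count_diff:
  fixes a :: "'k \<Rightarrow> nat" and q :: real
  assumes fin: "finite K" and sub: "K' \<subseteq> K" and K: "\<And>k. k \<in> K \<Longrightarrow> a k \<ge> 1" and q: "0 < q" "q < 1"
    and b: "b > 0" and \<epsilon>: "\<epsilon> \<ge> 0"
    and bound: "\<And>t. \<bar>t\<bar> \<le> pi \<Longrightarrow> norm (\<Prod>k\<in>K'. geom_char q (a k) t) \<le> exp (- (b * t\<^sup>2)) + \<epsilon>"
    and E: "E = (\<Sum>k\<in>K - K'. a k * occupation q (a k))"
  shows "\<bar>2 * pi * (weighted_count K' a n * q ^ n * (\<Prod>k\<in>K'. 1 - q ^ a k))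
         - 2 * pi * (weighted_count K a n * q ^ n * (\<Prod>k\<in>K. 1 - q ^ a k))\<bar>
         \<le> E * (sqrt 2 * pi / b + 2 * pi\<^sup>2 * \<epsilon>)"
proof -
  define \<phi> where "\<phi> = (\<lambda>A t. \<Prod>k\<in>A. geom_char q (a k) t)"
  define J where "J = (\<lambda>A. 2 * pi * (weighted_count A a n * q ^ n * (\<Prod>k\<in>A. 1 - q ^ a k)))"
  have J: "((\<lambda>t. \<phi> A t * cis (- (real n * t))) has_integral of_real (J A)) {-pi..pi}" if "A \<subseteq> K" for A
    unfolding \<phi>_def J_def using that fin K finite_subset by (intro weighted_count_fourier q) auto
  have E0: "E \<ge> 0" unfolding E using occupation_pos[OF q K]
    by (intro sum_nonneg) (auto simp: less_imp_le)
  define h where "h = (\<lambda>t::real. E * (1 / sqrt b) * exp (- (b / 2) * t\<^sup>2) + E * \<epsilon> * pi)"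
  have h_int: "h integrable_on {-pi..pi}" unfolding h_def
    by (intro integrable_continuous_interval continuous_intros)
  have pw: "norm (\<phi> K' t * cis (- (real n * t)) - \<phi> K t * cis (- (real n * t))) \<le> h t" if t: "t \<in> {-pi..pi}" for t
  proof -
    have "\<phi> K t = \<phi> (K - K') t * \<phi> K' t"
      unfolding \<phi>_def using prod.subset_diff[OF sub fin] by blast
    hence "\<phi> K' t * cis (- (real n * t)) - \<phi> K t * cis (- (real n * t)) = \<phi> K' t * (1 - \<phi> (K - K') t) * cis (- (real n * t))"
      by (simp add: algebra_simps)
    hence "norm (\<phi> K' t * cis (- (real n * t)) - \<phi> K t * cis (- (real n * t))) = norm (\<phi> K' t) * norm (1 - \<phi> (K - K') t)"
      by (simp add: norm_mult)
    also have "\<dots> \<le> (exp (- (b * t\<^sup>2)) + \<epsilon>) * (\<bar>t\<bar> * E)"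
    proof (intro mult_mono)
      show "norm (\<phi> K' t) \<le> exp (- (b * t\<^sup>2)) + \<epsilon>" unfolding \<phi>_def using t by (intro bound) auto
      show "norm (1 - \<phi> (K - K') t) \<le> \<bar>t\<bar> * E"
        unfolding \<phi>_def E by (intro norm_one_minus_prod_geom_char q K) auto
    qed (use \<epsilon> in auto)
    also have "\<dots> = E * (\<bar>t\<bar> * exp (- (b * t\<^sup>2))) + E * \<epsilon> * \<bar>t\<bar>" by (simp add: algebra_simps)
    also have "\<dots> \<le> E * (1 / sqrt b * exp (- (b / 2) * t\<^sup>2)) + E * \<epsilon> * pi"
    proof (intro add_mono mult_left_mono)
      have "sqrt b * \<bar>t\<bar> \<le> 1 + (sqrt b * \<bar>t\<bar>)\<^sup>2 / 2"
        using zero_le_power2[of "sqrt b * \<bar>t\<bar> - 1"] by (simp add: power2_diff)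
      also have "\<dots> = 1 + b * t\<^sup>2 / 2" using b by (simp add: power_mult_distrib)
      also have "\<dots> \<le> exp (b * t\<^sup>2 / 2)" by (rule exp_ge_add_one_self)
      finally have "\<bar>t\<bar> \<le> 1 / sqrt b * exp (b * t\<^sup>2 / 2)" using b by (simp add: field_simps)
      hence "\<bar>t\<bar> * exp (- (b * t\<^sup>2)) \<le> 1 / sqrt b * exp (b * t\<^sup>2 / 2) * exp (- (b * t\<^sup>2))"
        by (intro mult_right_mono) auto
      also have "\<dots> = 1 / sqrt b * exp (- (b / 2) * t\<^sup>2)" by (simp flip: exp_add)
      finally show "\<bar>t\<bar> * exp (- (b * t\<^sup>2)) \<le> 1 / sqrt b * exp (- (b / 2) * t\<^sup>2)" .
    qed (use E0 \<epsilon> t in auto)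
    finally show ?thesis by (simp add: h_def mult_ac)
  qed
  have "norm (complex_of_real (J K') - of_real (J K)) \<le> integral {-pi..pi} h"
    using has_integral_diff[OF J[OF sub] J[OF order_refl]] pw h_int
    by (metis (no_types, lifting) has_integral_integrable_integral integral_norm_bound_integral)
  also have "\<dots> = E * (1 / sqrt b) * integral {-pi..pi} (\<lambda>t. exp (- (b / 2) * t\<^sup>2)) + 2 * pi * (E * \<epsilon> * pi)"
    unfolding h_def using b by (subst integral_add) (auto intro!: integrable_continuous_interval continuous_intros)
  also have "\<dots> \<le> E * (1 / sqrt b) * (pi / sqrt (b / 2)) + 2 * pi * (E * \<epsilon> * pi)"
    using E0 b \<epsilon> gaussian_integral_le[of "b / 2"] by (intro add_mono mult_left_mono) auto
  also have "\<dots> = E * (sqrt 2 * pi / b + 2 * pi\<^sup>2 * \<epsilon>)"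
    using b by (simp add: real_sqrt_divide power2_eq_square field_simps)
  finally have "\<bar>J K' - J K\<bar> \<le> E * (sqrt 2 * pi / b + 2 * pi\<^sup>2 * \<epsilon>)"
    by (simp only: of_real_diff[symmetric] norm_of_real)
  thus ?thesis unfolding J_def .
qed


text \<open>
Removing parts whose total mean is small against the standard deviation \<open>\<sigma>\<close> does not change the
local probability at \<open>n\<close>. Without the factors \<open>1 - q ^ a k\<close>, which cancel except for the removed parts,
the quotient is the probability that no removed part occurs in a random partition.
\<close>

theorem thinned_count_ratio_tendsto_1:
  fixes a :: "'k \<Rightarrow> nat" and q \<sigma> \<epsilon> M :: "nat \<Rightarrow> real" and K K' :: "nat \<Rightarrow> 'k set"
  assumes a: "\<And>n k. k \<in> K n \<Longrightarrow> a k \<ge> 1"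
    and K: "\<And>n. finite (K n)" "\<And>n. K' n \<subseteq> K n"
    and q: "eventually (\<lambda>n. 0 < q n \<and> q n < 1) sequentially"
    and \<sigma>: "eventually (\<lambda>n. \<sigma> n \<ge> 1 \<and> (\<sigma> n)\<^sup>2 = (\<Sum>k\<in>K n. part_variance (q n) (a k))) sequentially"
    and mean: "eventually (\<lambda>n. \<bar>(\<Sum>k\<in>K n. a k * occupation (q n) (a k)) - real n\<bar> \<le> 1) sequentially"
    and c: "0 < c" "c \<le> 1 / 2"
    and bound: "eventually (\<lambda>n. \<epsilon> n \<ge> 0 \<and> (\<forall>t. \<bar>t\<bar> \<le> pi \<longrightarrow>
        norm (\<Prod>k\<in>K' n. geom_char (q n) (a k) t) \<le> exp (- (c * (\<sigma> n)\<^sup>2 * t\<^sup>2)) + \<epsilon> n)) sequentially"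
    and M: "eventually (\<lambda>n. \<forall>k\<in>K n. a k * occupation (q n) (a k) \<le> M n) sequentially"
    and lim: "filterlim \<sigma> at_top sequentially" "(\<lambda>n. M n / \<sigma> n) \<longlonglongrightarrow> 0" "(\<lambda>n. \<epsilon> n * (\<sigma> n)\<^sup>2) \<longlonglongrightarrow> 0"
     "(\<lambda>n. (\<Sum>k\<in>K n. part_variance (q n) (a k) * a k * (1 + occupation (q n) (a k))) / \<sigma> n ^ 3) \<longlonglongrightarrow> 0"
     "(\<lambda>n. (\<Sum>k\<in>K n - K' n. a k * occupation (q n) (a k)) / \<sigma> n) \<longlonglongrightarrow> 0"
  shows "(\<lambda>n. (weighted_count (K' n) a n * (\<Prod>k\<in>K' n. 1 - q n ^ a k)) /
              (weighted_count (K n) a n * (\<Prod>k\<in>K n. 1 - q n ^ a k))) \<longlonglongrightarrow> 1"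
proof -
  define \<beta> where "\<beta> = (\<lambda>n. \<Sum>k\<in>K n. part_variance (q n) (a k) * a k * (1 + occupation (q n) (a k)))"
  define E where "E = (\<lambda>n. \<Sum>k\<in>K n - K' n. a k * occupation (q n) (a k))"
  define J where "J = (\<lambda>A n. 2 * pi * (weighted_count A a n * q n ^ n * (\<Prod>k\<in>A. 1 - q n ^ a k)))"
  have inv\<sigma>: "(\<lambda>n. 1 / \<sigma> n) \<longlonglongrightarrow> 0"
    using lim(1) by (intro tendsto_divide_0[OF tendsto_const] filterlim_at_top_imp_at_infinity)
  have \<sigma>1: "eventually (\<lambda>n. \<sigma> n \<ge> 1) sequentially" using \<sigma> by eventually_elim auto
  have \<epsilon>\<sigma>: "(\<lambda>n. \<epsilon> n * \<sigma> n) \<longlonglongrightarrow> 0"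
  proof (rule Lim_transform_eventually)
    show "(\<lambda>n. \<epsilon> n * (\<sigma> n)\<^sup>2 * (1 / \<sigma> n)) \<longlonglongrightarrow> 0" using tendsto_mult[OF lim(3) inv\<sigma>] by simp
    show "eventually (\<lambda>n. \<epsilon> n * (\<sigma> n)\<^sup>2 * (1 / \<sigma> n) = \<epsilon> n * \<sigma> n) sequentially"
      using \<sigma>1 by eventually_elim (simp add: power2_eq_square)
  qed
  \<comment> \<open>The Gaussian tail beyond \<open>R\<close> has to lose against the main term 1, with room for the other errors.\<close>
  obtain R where R: "R > 0" "2 * exp (- (c * R\<^sup>2 / 2)) * (pi / sqrt (c / 2)) \<le> 1 / 4"
  proof -
    have "filterlim (\<lambda>R::real. c / 2 * R\<^sup>2) at_top at_top"
      by (rule filterlim_tendsto_pos_mult_at_top[OF tendsto_const])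
         (use c in \<open>auto intro!: filterlim_pow_at_top filterlim_ident\<close>)
    hence "filterlim (\<lambda>R::real. - (c * R\<^sup>2 / 2)) at_bot at_top"
      by (simp add: filterlim_uminus_at_bot mult_ac)
    hence "((\<lambda>R::real. exp (- (c * R\<^sup>2 / 2))) \<longlongrightarrow> 0) at_top"
      by (rule filterlim_compose[OF exp_at_bot])
    hence "((\<lambda>R::real. 2 * exp (- (c * R\<^sup>2 / 2)) * (pi / sqrt (c / 2))) \<longlongrightarrow> 2 * 0 * (pi / sqrt (c / 2))) at_top"
      by (intro tendsto_intros)
    hence "eventually (\<lambda>R::real. 2 * exp (- (c * R\<^sup>2 / 2)) * (pi / sqrt (c / 2)) < 1 / 4) at_top"
      by (rule order_tendstoD) auto
    hence "eventually (\<lambda>R::real. 2 * exp (- (c * R\<^sup>2 / 2)) * (pi / sqrt (c / 2)) < 1 / 4 \<and> R > 0) at_top"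
      using eventually_gt_at_top[of 0] by (rule eventually_conj)
    then obtain R :: real where "2 * exp (- (c * R\<^sup>2 / 2)) * (pi / sqrt (c / 2)) < 1 / 4" "R > 0"
      using eventually_happens'[OF trivial_limit_at_top_linorder] by blast
    thus ?thesis using that[of R] by auto
  qed
  define \<delta> where "\<delta> = (\<lambda>n. (R / \<sigma> n + 5 * (R / \<sigma> n) ^ 3 * \<beta> n) * exp (c * R\<^sup>2 / 2) * (pi / sqrt (c / 2)) + 2 * pi * (\<epsilon> n * \<sigma> n))"
  have "(\<lambda>n. (R * (1 / \<sigma> n) + 5 * R ^ 3 * (\<beta> n / \<sigma> n ^ 3)) * exp (c * R\<^sup>2 / 2) * (pi / sqrt (c / 2)) + 2 * pi * (\<epsilon> n * \<sigma> n))
     \<longlonglongrightarrow> (R * 0 + 5 * R ^ 3 * 0) * exp (c * R\<^sup>2 / 2) * (pi / sqrt (c / 2)) + 2 * pi * 0"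
    using lim(4) unfolding \<beta>_def by (intro tendsto_intros inv\<sigma> \<epsilon>\<sigma>)
  hence "\<delta> \<longlonglongrightarrow> 0" by (simp add: \<delta>_def power_divide)
  hence ev\<delta>: "eventually (\<lambda>n. \<delta> n < 1 / 4) sequentially" by (rule order_tendstoD) auto
  have "(\<lambda>n. R * (M n / \<sigma> n)) \<longlonglongrightarrow> R * 0" by (intro tendsto_intros lim)
  hence evM: "eventually (\<lambda>n. R * (M n / \<sigma> n) < 1 / 2) sequentially" by (rule order_tendstoD) auto
  define \<eta> where "\<eta> = (\<lambda>n. 2 * (E n / \<sigma> n) * (sqrt 2 * pi / c + 2 * pi\<^sup>2 * (\<epsilon> n * (\<sigma> n)\<^sup>2)))"
  have "\<eta> \<longlonglongrightarrow> 2 * 0 * (sqrt 2 * pi / c + 2 * pi\<^sup>2 * 0)"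
    using lim(5) unfolding \<eta>_def E_def by (intro tendsto_intros lim(3))
  hence \<eta>: "\<eta> \<longlonglongrightarrow> 0" by simp
  have key: "eventually (\<lambda>n. \<bar>J (K' n) n / J (K n) n - 1\<bar> \<le> \<eta> n) sequentially"
    using q \<sigma> mean bound M ev\<delta> evM
  proof eventually_elim
    case (elim n)
    have a': "\<And>k. k \<in> K n \<Longrightarrow> a k \<ge> 1" using a by blast
    have q': "0 < q n" "q n < 1" and \<sigma>': "\<sigma> n \<ge> 1"
      and \<sigma>2: "(\<sigma> n)\<^sup>2 = (\<Sum>k\<in>K n. part_variance (q n) (a k))"
      and mean': "\<bar>(\<Sum>k\<in>K n. a k * occupation (q n) (a k)) - real n\<bar> \<le> 1"
      and \<epsilon>0: "\<epsilon> n \<ge> 0"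
      and bound': "\<And>t. \<bar>t\<bar> \<le> pi \<Longrightarrow> norm (\<Prod>k\<in>K' n. geom_char (q n) (a k) t) \<le> exp (- (c * (\<sigma> n)\<^sup>2 * t\<^sup>2)) + \<epsilon> n"
      and M': "\<And>k. k \<in> K n \<Longrightarrow> a k * occupation (q n) (a k) \<le> M n"
      and \<delta>': "\<delta> n < 1 / 4" and RM: "R * (M n / \<sigma> n) < 1 / 2"
      using elim by blast+
    have le1: "norm (\<Prod>k\<in>K n. geom_char (q n) (a k) t) \<le> norm (\<Prod>k\<in>K' n. geom_char (q n) (a k) t)" for t
    proof -
      have "norm (\<Prod>k\<in>K n. geom_char (q n) (a k) t) =
        norm (\<Prod>k\<in>K n - K' n. geom_char (q n) (a k) t) * norm (\<Prod>k\<in>K' n. geom_char (q n) (a k) t)"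
        using prod.subset_diff[OF K(2) K(1)] by (metis norm_mult)
      also have "\<dots> \<le> 1 * norm (\<Prod>k\<in>K' n. geom_char (q n) (a k) t)"
        by (intro mult_right_mono norm_prod_geom_char_le_1 q') (use a' in auto)
      finally show ?thesis by simp
    qed
    define \<kappa> where "\<kappa> = (R / \<sigma> n + 5 * (R / \<sigma> n) ^ 3 * \<beta> n) * exp (c * R\<^sup>2 / 2) + 2 * exp (- (c * R\<^sup>2 / 2))"
    have "J (K n) n \<ge> 1 / \<sigma> n - (\<kappa> * (pi / (sqrt (c / 2) * \<sigma> n)) + 2 * pi * \<epsilon> n)"
      unfolding J_def \<kappa>_def
    proof (rule weighted_count_ge_gaussian)
      show "\<beta> n = (\<Sum>k\<in>K n. part_variance (q n) (a k) * a k * (1 + occupation (q n) (a k)))"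
        by (simp add: \<beta>_def)
      show "norm (\<Prod>k\<in>K n. geom_char (q n) (a k) t) \<le> exp (- (c * (\<sigma> n)\<^sup>2 * t\<^sup>2)) + \<epsilon> n" if "\<bar>t\<bar> \<le> pi" for t
        using le1[of t] bound'[OF that] by linarith
      show "R / \<sigma> n * (a k * occupation (q n) (a k)) \<le> 1 / 2" if "k \<in> K n" for k
      proof -
        have "R / \<sigma> n * (a k * occupation (q n) (a k)) \<le> R / \<sigma> n * M n"
          using M'[OF that] R \<sigma>' by (intro mult_left_mono) auto
        also have "\<dots> = R * (M n / \<sigma> n)" by simp
        finally show ?thesis using RM by linarith
      qed
    qed (use K(1) a' q' \<sigma>' \<sigma>2 mean' c \<epsilon>0 R(1) in blast)+
    also have "1 / \<sigma> n - (\<kappa> * (pi / (sqrt (c / 2) * \<sigma> n)) + 2 * pi * \<epsilon> n)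
        = (1 - \<delta> n - 2 * exp (- (c * R\<^sup>2 / 2)) * (pi / sqrt (c / 2))) / \<sigma> n"
    proof -
      define P where "P = pi / sqrt (c / 2)"
      have 1: "\<kappa> * (pi / (sqrt (c / 2) * \<sigma> n)) = \<kappa> * P / \<sigma> n" by (simp add: P_def)
      have 2: "2 * pi * \<epsilon> n = 2 * pi * (\<epsilon> n * \<sigma> n) / \<sigma> n" using \<sigma>' by simp
      have "1 / \<sigma> n - (\<kappa> * P / \<sigma> n + 2 * pi * (\<epsilon> n * \<sigma> n) / \<sigma> n) = (1 - \<kappa> * P - 2 * pi * (\<epsilon> n * \<sigma> n)) / \<sigma> n"
        by (simp only: diff_divide_distrib add_divide_distrib diff_diff_eq)
      moreover have "1 - \<kappa> * P - 2 * pi * (\<epsilon> n * \<sigma> n) = 1 - \<delta> n - 2 * exp (- (c * R\<^sup>2 / 2)) * P"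
        by (simp add: \<delta>_def \<kappa>_def P_def[symmetric] distrib_right)
      ultimately show ?thesis unfolding P_def[symmetric] 1 2 by simp
    qed
    finally have "J (K n) n \<ge> (1 - \<delta> n - 2 * exp (- (c * R\<^sup>2 / 2)) * (pi / sqrt (c / 2))) / \<sigma> n" .
    moreover have "(1 / 2) / \<sigma> n \<le> (1 - \<delta> n - 2 * exp (- (c * R\<^sup>2 / 2)) * (pi / sqrt (c / 2))) / \<sigma> n"
      using R(2) \<delta>' \<sigma>' by (intro divide_right_mono) linarith+
    ultimately have J1: "J (K n) n \<ge> 1 / (2 * \<sigma> n)" by simp
    have Jpos: "J (K n) n > 0" using J1 \<sigma>' by (meson divide_pos_pos less_le_trans mult_pos_pos zero_less_numeral zero_less_one)
    have "\<bar>J (K' n) n - J (K n) n\<bar> \<le> E n * (sqrt 2 * pi / (c * (\<sigma> n)\<^sup>2) + 2 * pi\<^sup>2 * \<epsilon> n)"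
      unfolding J_def
    proof (rule thinned_count_diff)
      show "E n = (\<Sum>k\<in>K n - K' n. a k * occupation (q n) (a k))" by (simp add: E_def)
      show "0 < c * (\<sigma> n)\<^sup>2" using c(1) \<sigma>' by simp
    qed (use K a' q' \<epsilon>0 bound' in blast)+
    hence "\<bar>J (K' n) n - J (K n) n\<bar> * (1 / J (K n) n) \<le> E n * (sqrt 2 * pi / (c * (\<sigma> n)\<^sup>2) + 2 * pi\<^sup>2 * \<epsilon> n) * (2 * \<sigma> n)"
    proof (rule mult_mono)
      show "1 / J (K n) n \<le> 2 * \<sigma> n" using J1 Jpos \<sigma>' by (simp add: field_simps)
      have "E n \<ge> 0" unfolding E_def using occupation_pos[OF q' a']
        by (intro sum_nonneg) (auto simp: less_imp_le)
      thus "E n * (sqrt 2 * pi / (c * (\<sigma> n)\<^sup>2) + 2 * pi\<^sup>2 * \<epsilon> n) \<ge> 0"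
        using c(1) \<epsilon>0 by (intro mult_nonneg_nonneg add_nonneg_nonneg) auto
    qed (use Jpos in auto)
    also have "\<dots> = \<eta> n"
    proof -
      have "E n * (A / (c * (\<sigma> n)\<^sup>2) + B * \<epsilon> n) * (2 * \<sigma> n) = 2 * (E n / \<sigma> n) * (A / c + B * (\<epsilon> n * (\<sigma> n)\<^sup>2))" for A B
        using \<sigma>' c(1) by (simp add: divide_simps power2_eq_square)
      thus ?thesis by (simp add: \<eta>_def)
    qed
    finally have "\<bar>J (K' n) n - J (K n) n\<bar> * (1 / J (K n) n) \<le> \<eta> n" .
    moreover have "J (K' n) n / J (K n) n - 1 = (J (K' n) n - J (K n) n) * (1 / J (K n) n)"
      using Jpos by (simp add: diff_divide_distrib)
    ultimately show ?case using Jpos by (simp add: abs_mult)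
  qed
  have "(\<lambda>n. J (K' n) n / J (K n) n - 1) \<longlonglongrightarrow> 0"
    by (rule Lim_null_comparison[OF _ \<eta>]) (use key in simp)
  hence "(\<lambda>n. J (K' n) n / J (K n) n) \<longlonglongrightarrow> 1" by (rule LIM_zero_cancel)
  moreover have "eventually (\<lambda>n. J (K' n) n / J (K n) n = (weighted_count (K' n) a n * (\<Prod>k\<in>K' n. 1 - q n ^ a k)) /
              (weighted_count (K n) a n * (\<Prod>k\<in>K n. 1 - q n ^ a k))) sequentially"
    using q
  proof eventually_elim
    case (elim n)
    have "J A n = (2 * pi * q n ^ n) * (weighted_count A a n * (\<Prod>k\<in>A. 1 - q n ^ a k))" for A
      unfolding J_def by (simp only: mult.assoc mult.commute mult.left_commute)
    moreover have "2 * pi * q n ^ n \<noteq> 0" using elim by simp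
    ultimately show ?case using mult_divide_mult_cancel_left[of "2 * pi * q n ^ n"] by presburger
  qed
  ultimately show ?thesis by (rule Lim_transform_eventually)
qed

section \<open>Integrality of the dimension\<close>

lemma degree_forward_difference_less:
  fixes p :: "'a::{idom,ring_char_0} poly"
  assumes "degree p \<le> Suc d"
  shows "degree (pcompose p [:1, 1:] - p) \<le> d"
proof (cases "degree p = 0")
  case True
  then obtain c where "p = [:c:]" by (meson degree_eq_zeroE)
  thus ?thesis by simp
next
  case False
  have deg: "degree (pcompose p [:1, 1:]) = degree p" by (simp add: degree_pcompose)
  have "lead_coeff (pcompose p [:1, 1:]) = lead_coeff p" by (subst lead_coeff_comp) auto
  hence "coeff (pcompose p [:1, 1:] - p) (degree p) = 0" by (simp add: deg)
  moreover have "degree (pcompose p [:1, 1:] - p) \<le> degree p" using deg by (intro degree_diff_le) auto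
  ultimately have "degree (pcompose p [:1, 1:] - p) < degree p"
    using False eq_zero_or_degree_less[of "pcompose p [:1, 1:] - p" "degree p"] by auto
  thus ?thesis using assms by simp
qed

text \<open>
Induction over the degree: the forward difference satisfies the same hypothesis with degree one
less, and summing it recovers the polynomial.
\<close>

lemma poly_Ints_of_initial_segment:
  fixes p :: "real poly"
  assumes "degree p \<le> d" "\<And>i. i \<le> d \<Longrightarrow> poly p (real i) \<in> \<int>"
  shows "poly p (real n) \<in> \<int>"
  using assms
proof (induction d arbitrary: p n)
  case 0
  then obtain c where "p = [:c:]" by (metis degree_eq_zeroE le_zero_eq)
  thus ?case using 0(2)[of 0] by simp
next
  case (Suc d)
  define \<Delta> where "\<Delta> = pcompose p [:1, 1:] - p"
  have \<Delta>: "poly \<Delta> (real i) = poly p (real (Suc i)) - poly p (real i)" for i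
    by (simp add: \<Delta>_def poly_pcompose add_ac)
  have int: "poly \<Delta> (real i) \<in> \<int>" for i
  proof (rule Suc.IH)
    show "degree \<Delta> \<le> d" unfolding \<Delta>_def by (rule degree_forward_difference_less[OF Suc.prems(1)])
    show "poly \<Delta> (real i) \<in> \<int>" if "i \<le> d" for i
      unfolding \<Delta> using that by (intro Ints_diff Suc.prems) auto
  qed
  show ?case
  proof (induction n)
    case 0
    show ?case using Suc.prems(2)[of 0] by simp
  next
    case (Suc n)
    have "poly p (real (Suc n)) = poly \<Delta> (real n) + poly p (real n)" by (simp add: \<Delta>)
    thus ?case using Ints_add[OF int Suc] by metis
  qed
qed

definition increasing_pairs :: "nat \<Rightarrow> (nat \<times> nat) set" where
  "increasing_pairs r = {(i, j). i < j \<and> j \<le> r}"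

text \<open>
The Vandermonde product of \<open>x 0, \<dots>, x r\<close> divided by that of \<open>0, \<dots>, r\<close>.
\<close>

definition vandermonde_ratio :: "nat \<Rightarrow> (nat \<Rightarrow> real) \<Rightarrow> real" where
  "vandermonde_ratio r x = (\<Prod>(i, j)\<in>increasing_pairs r. (x j - x i) / (real j - real i))"

lemma finite_increasing_pairs: "finite (increasing_pairs r)"
  by (rule finite_subset[of _ "{..r} \<times> {..r}"]) (auto simp: increasing_pairs_def)

text \<open>
Points in \<open>{0..r}\<close> either coincide somewhere, and the product vanishes, or are a permutation of
\<open>{0..r}\<close>, and the product is that of \<open>0, \<dots>, r\<close> up to sign.
\<close>

lemma vandermonde_ratio_permutation:
  assumes "\<And>i. i \<le> r \<Longrightarrow> x i \<le> r"
  shows "vandermonde_ratio r (\<lambda>i. real (x i)) \<in> \<int>"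
proof (cases "inj_on x {..r}")
  case False
  then obtain i j where ij: "i \<le> r" "j \<le> r" "i < j" "x i = x j"
    by (smt (verit) atMost_iff inj_onI linorder_neqE_nat)
  hence "(i, j) \<in> increasing_pairs r" by (simp add: increasing_pairs_def)
  moreover have "(\<lambda>(i, j). (real (x j) - real (x i)) / (real j - real i)) (i, j) = 0" using ij by simp
  ultimately have "vandermonde_ratio r (\<lambda>i. real (x i)) = 0"
    unfolding vandermonde_ratio_def using finite_increasing_pairs by (intro prod_zero) blast+
  thus ?thesis by simp
next
  case inj: True
  define P where "P = increasing_pairs r"
  define g where "g = (\<lambda>(i, j). (min (x i) (x j), max (x i) (x j)))"
  have fin: "finite P" unfolding P_def by (rule finite_increasing_pairs)
  have x_eq: "x i = x j \<longleftrightarrow> i = j" if "i \<le> r" "j \<le> r" for i j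
    using inj that by (auto simp: inj_on_def)
  have "g ` P \<subseteq> P"
  proof (rule image_subsetI, clarify)
    fix i j assume "(i, j) \<in> P"
    hence "i < j" "j \<le> r" by (auto simp: P_def increasing_pairs_def)
    hence "x i \<noteq> x j" "x i \<le> r" "x j \<le> r" using x_eq assms by auto
    thus "g (i, j) \<in> P" by (auto simp: g_def P_def increasing_pairs_def)
  qed
  moreover have "inj_on g P"
  proof (rule inj_onI, clarify)
    fix i j i' j' assume "(i, j) \<in> P" "(i', j') \<in> P" and e: "g (i, j) = g (i', j')"
    hence o: "i < j" "j \<le> r" "i' < j'" "j' \<le> r" by (auto simp: P_def increasing_pairs_def)
    have "(x i = x i' \<and> x j = x j') \<or> (x i = x j' \<and> x j = x i')"
      using e by (auto simp: g_def min_def max_def split: if_splits)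
    thus "i = i' \<and> j = j'" using o x_eq by auto
  qed
  ultimately have bij: "bij_betw g P P" using endo_inj_surj[OF fin] by (simp add: bij_betw_def)
  have "\<bar>\<Prod>(i, j)\<in>P. real (x j) - real (x i)\<bar> = (\<Prod>p\<in>P. (\<lambda>(i, j). \<bar>real j - real i\<bar>) (g p))"
    unfolding abs_prod by (intro prod.cong) (auto simp: g_def)
  also have "\<dots> = (\<Prod>(i, j)\<in>P. \<bar>real j - real i\<bar>)" by (rule prod.reindex_bij_betw[OF bij])
  also have "\<dots> = \<bar>\<Prod>(i, j)\<in>P. real j - real i\<bar>"
    unfolding abs_prod by (intro prod.cong) auto
  finally have "\<bar>\<Prod>(i, j)\<in>P. real (x j) - real (x i)\<bar> = \<bar>\<Prod>(i, j)\<in>P. real j - real i\<bar>" .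
  moreover have "(\<Prod>(i, j)\<in>P. real j - real i) \<noteq> 0"
    using fin by (auto simp: P_def increasing_pairs_def)
  moreover have "vandermonde_ratio r (\<lambda>i. real (x i)) =
    (\<Prod>(i, j)\<in>P. real (x j) - real (x i)) / (\<Prod>(i, j)\<in>P. real j - real i)"
    unfolding vandermonde_ratio_def P_def by (simp add: case_prod_unfold prod_dividef)
  ultimately have "vandermonde_ratio r (\<lambda>i. real (x i)) = 1 \<or> vandermonde_ratio r (\<lambda>i. real (x i)) = -1"
    by (auto simp: abs_eq_iff)
  thus ?thesis by auto
qed

lemma vandermonde_ratio_poly:
  assumes "m \<le> r"
  obtains p where "degree p \<le> r" "\<And>t. poly p t = vandermonde_ratio r (x(m := t))"
proof
  define P where "P = increasing_pairs r"
  define c where "c = (\<lambda>(i, j). 1 / (real j - real i))"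
  define f :: "nat \<times> nat \<Rightarrow> real poly" where "f = (\<lambda>(i, j).
     if i = m then [:x j * c (i, j), - c (i, j):] else
     if j = m then [:- x i * c (i, j), c (i, j):] else [:(x j - x i) * c (i, j):])"
  have fin: "finite P" unfolding P_def by (rule finite_increasing_pairs)
  have "degree (prod f P) \<le> sum (degree \<circ> f) P" by (rule degree_prod_sum_le[OF fin])
  also have "\<dots> \<le> (\<Sum>(i, j)\<in>P. if i = m \<or> j = m then 1 else 0)"
    by (intro sum_mono) (auto simp: f_def)
  also have "\<dots> = card {(i, j)\<in>P. i = m \<or> j = m}"
    using fin by (simp add: case_prod_unfold flip: sum.inter_filter)
  also have "\<dots> \<le> card ({..r} - {m})"
  proof (rule card_inj_on_le[where f = "\<lambda>(i, j). if i = m then j else i"])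
    show "inj_on (\<lambda>(i, j). if i = m then j else i) {(i, j) \<in> P. i = m \<or> j = m}"
      by (auto simp: inj_on_def P_def increasing_pairs_def split: if_splits)
    show "(\<lambda>(i, j). if i = m then j else i) ` {(i, j) \<in> P. i = m \<or> j = m} \<subseteq> {..r} - {m}"
      by (auto simp: P_def increasing_pairs_def split: if_splits)
  qed auto
  also have "\<dots> = r" using assms by simp
  finally show "degree (prod f P) \<le> r" .
  show "poly (prod f P) t = vandermonde_ratio r (x(m := t))" for t
    unfolding poly_prod vandermonde_ratio_def P_def[symmetric]
    by (intro prod.cong) (auto simp: f_def c_def P_def increasing_pairs_def diff_divide_distrib)
qed

text \<open>
As a function of any one of its \<open>r + 1\<close> variables the ratio is a polynomial of degree at most \<open>r\<close>, so
its integrality on \<open>{0..r}\<close> in that variable carries over to all values. Doing this for one variable after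
the other reduces the claim to points in \<open>{0..r}\<close>.
\<close>

lemma vandermonde_ratio_Ints:
  "vandermonde_ratio r (\<lambda>i. real (x i)) \<in> \<int>"
proof -
  have "vandermonde_ratio r (\<lambda>i. real (x i)) \<in> \<int>"
    if "m \<le> Suc r" "\<And>i. m \<le> i \<Longrightarrow> i \<le> r \<Longrightarrow> x i \<le> r" for m x
    using that
  proof (induction m arbitrary: x)
    case 0
    thus ?case by (intro vandermonde_ratio_permutation) auto
  next
    case (Suc m)
    obtain p where p: "degree p \<le> r" "\<And>t. poly p t = vandermonde_ratio r ((\<lambda>i. real (x i))(m := t))"
      using vandermonde_ratio_poly[of m r] Suc.prems by (metis Suc_le_mono)
    have upd: "(\<lambda>i. real (x i))(m := real t) = (\<lambda>i. real ((x(m := t)) i))" for t by auto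
    have "poly p (real (x m)) \<in> \<int>"
    proof (rule poly_Ints_of_initial_segment[OF p(1)])
      fix t assume "t \<le> r"
      show "poly p (real t) \<in> \<int>" unfolding p(2) upd
      proof (rule Suc.IH)
        fix i assume "m \<le> i" "i \<le> r"
        thus "(x(m := t)) i \<le> r" using Suc.prems(2)[of i] \<open>t \<le> r\<close> by (cases "i = m") auto
      qed (use Suc.prems in auto)
    qed
    moreover have "(\<lambda>i. real (x i))(m := real (x m)) = (\<lambda>i. real (x i))" by auto
    ultimately show ?case by (simp only: p(2))
  qed
  from this[of "Suc r" x] show ?thesis by auto
qed

text \<open>
In terms of the partial sums \<open>k 1 + \<dots> + k i\<close> Weyl's formula is a Vandermonde ratio.
\<close>

lemma irrep_dim_Ints: "irrep_dim r k \<in> \<int>"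
proof -
  define x where "x = (\<lambda>i. \<Sum>m=1..i. k m)"
  have "irrep_dim r k = vandermonde_ratio r (\<lambda>i. real (x i))"
    unfolding irrep_dim_def weyl_dim_eq vandermonde_ratio_def
  proof (rule prod.reindex_bij_witness[of _ "\<lambda>(i, j). (Suc i, j)" "\<lambda>(l, j). (l - 1, j)"])
    fix p assume "p \<in> pos_root_pairs r"
    then obtain l j where p: "p = (l, j)" "1 \<le> l" "l \<le> j" "j \<le> r" by (auto simp: pos_root_pairs_def)
    have "(\<Sum>m=1..j. k m) = (\<Sum>m=1..l-1. k m) + (\<Sum>m=l..j. k m)"
      using sum.ub_add_nat[of 1 "l - 1" k "j - (l - 1)"] p by simp
    thus "(case (case p of (l, j) \<Rightarrow> (l - 1, j)) of (i, j) \<Rightarrow> (real (x j) - real (x i)) / (real j - real i)) =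
         (case p of (l, j) \<Rightarrow> (\<Sum>i=l..j. real (k i)) / real (j + 1 - l))"
      using p by (simp add: x_def of_nat_diff algebra_simps flip: of_nat_sum)
  qed (auto simp: pos_root_pairs_def increasing_pairs_def)
  thus ?thesis using vandermonde_ratio_Ints by simp
qed

section \<open>Bounds for the dimension and the height\<close>

definition label_dim :: "nat \<Rightarrow> (nat \<Rightarrow> nat) \<Rightarrow> nat" where
  "label_dim r k = nat \<lfloor>irrep_dim r k\<rfloor>"

lemma irrep_dim_nonneg: "irrep_dim r k \<ge> 0"
  unfolding irrep_dim_def weyl_dim_eq by (intro prod_nonneg) (auto intro!: divide_nonneg_nonneg sum_nonneg)

lemma real_label_dim: "real (label_dim r k) = irrep_dim r k"
  using irrep_dim_Ints[of r k] irrep_dim_nonneg[of r k] by (auto simp: label_dim_def elim!: Ints_cases)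

lemma label_ge_1: "k \<in> irrep_labels r \<Longrightarrow> i \<in> {1..r} \<Longrightarrow> k i \<ge> 1"
  by (force simp: irrep_labels_def PiE_iff)

lemma average_label_ge_1:
  assumes "k \<in> irrep_labels r" "(l, j) \<in> pos_root_pairs r"
  shows "(\<Sum>i=l..j. real (k i)) / real (j + 1 - l) \<ge> 1"
proof -
  have lj: "1 \<le> l" "l \<le> j" "j \<le> r" using assms by (auto simp: pos_root_pairs_def)
  have "(\<Sum>i=l..j. real 1) \<le> (\<Sum>i=l..j. real (k i))"
    using label_ge_1[OF assms(1)] lj by (intro sum_mono) (auto simp: Suc_le_eq)
  thus ?thesis using lj by (simp add: of_nat_diff)
qed

text \<open>
Each factor of Weyl's formula is the average of some entries, hence at least 1, and any set of
factors gives a lower bound.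
\<close>

lemma irrep_dim_ge_subproduct:
  assumes "k \<in> irrep_labels r" "Q \<subseteq> pos_root_pairs r"
  shows "(\<Prod>(l, j)\<in>Q. (\<Sum>i=l..j. real (k i)) / real (j + 1 - l)) \<le> irrep_dim r k"
proof -
  let ?g = "\<lambda>(l, j). (\<Sum>i=l..j. real (k i)) / real (j + 1 - l)"
  have g: "?g p \<ge> 1" if "p \<in> pos_root_pairs r" for p
    using average_label_ge_1[OF assms(1)] that by (cases p) simp
  have "prod ?g Q = prod ?g Q * 1" by simp
  also have "\<dots> \<le> prod ?g Q * prod ?g (pos_root_pairs r - Q)"
    using g assms(2) by (intro mult_left_mono prod_ge_1 prod_nonneg) (force intro: order_trans[of 0 1])+
  also have "\<dots> = prod ?g (pos_root_pairs r)"
    using prod.subset_diff[OF assms(2) finite_pos_root_pairs, of ?g] by (simp add: mult.commute)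
  finally show ?thesis by (simp add: irrep_dim_def weyl_dim_eq)
qed

text \<open>
The positive roots in which the simple root \<open>i\<close> occurs. Their number \<open>i * (r + 1 - i)\<close> is the order
of growth of the dimension in \<open>k i\<close>. It is smallest, namely \<open>r\<close>, at the two ends.
\<close>

lemma root_pairs_through: 
  assumes "i \<in> {1..r}"
  shows "{(l, j) \<in> pos_root_pairs r. l \<le> i \<and> i \<le> j} = {1..i} \<times> {i..r}"
  using assms by (auto simp: pos_root_pairs_def)

lemma irrep_dim_ge_through:
  assumes k: "k \<in> irrep_labels r" and i: "i \<in> {1..r}"
  shows "(\<Prod>(l, j)\<in>{1..i} \<times> {i..r}. real (k i) / real (j + 1 - l)) \<le> irrep_dim r k"
proof -
  have "(\<Prod>(l, j)\<in>{1..i} \<times> {i..r}. real (k i) / real (j + 1 - l))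
      \<le> (\<Prod>(l, j)\<in>{1..i} \<times> {i..r}. (\<Sum>i=l..j. real (k i)) / real (j + 1 - l))"
    using i by (intro prod_mono) (auto intro!: divide_right_mono member_le_sum)
  also have "\<dots> \<le> irrep_dim r k"
    using i by (intro irrep_dim_ge_subproduct k) (auto simp: pos_root_pairs_def)
  finally show ?thesis .
qed

lemma irrep_dim_ge_power:
  assumes k: "k \<in> irrep_labels r" and i: "i \<in> {1..r}" and N: "N \<le> i * (r + 1 - i)" and big: "k i \<ge> r"
  shows "(real (k i) / real r) ^ N \<le> irrep_dim r k"
proof -
  have r: "r > 0" using i by auto
  have ge1: "real (k i) / real r \<ge> 1" using big r by simp
  have "(real (k i) / real r) ^ N \<le> (real (k i) / real r) ^ card ({1..i} \<times> {i..r})"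
    using N i by (intro power_increasing ge1) (auto simp: Suc_diff_le)
  also have "\<dots> = (\<Prod>(l, j)\<in>{1..i} \<times> {i..r}. real (k i) / real r)"
    by (simp add: case_prod_unfold)
  also have "\<dots> \<le> (\<Prod>(l, j)\<in>{1..i} \<times> {i..r}. real (k i) / real (j + 1 - l))"
    using i by (intro prod_mono) (auto intro!: divide_left_mono)
  also have "\<dots> \<le> irrep_dim r k" by (rule irrep_dim_ge_through[OF k i])
  finally show ?thesis .
qed

text \<open>
At an end of the diagram the roots through \<open>i\<close> have the lengths \<open>1, \<dots>, r\<close>, once each.
\<close>

lemma corner_hook_product:
  fixes i r :: nat and f :: "nat \<Rightarrow> real"
  assumes "r \<ge> 1" "i \<in> {1, r}"
  shows "(\<Prod>(l, j)\<in>{1..i} \<times> {i..r}. f (j + 1 - l)) = (\<Prod>d=1..r. f d)"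
proof -
  have "bij_betw (\<lambda>(l, j). j + 1 - l) ({1..i} \<times> {i..r}) {1..r}"
  proof (rule bij_betwI[where g = "if i = 1 then (\<lambda>d. (1, d)) else (\<lambda>d. (r + 1 - d, r))"])
    show "(\<lambda>(l, j). j + 1 - l) \<in> {1..i} \<times> {i..r} \<rightarrow> {1..r}" by auto
  qed (use assms in \<open>auto split: if_splits\<close>)
  from prod.reindex_bij_betw[OF this, of f] show ?thesis by (simp add: case_prod_unfold)
qed

text \<open>
The roots through the end \<open>i\<close> contribute \<open>k i ^ r / r!\<close>, and the simple root \<open>m\<close> contributes a further
factor. A second entry different from 1 therefore at least doubles the dimension.
\<close>

lemma irrep_dim_ge_corner:
  assumes r: "r \<ge> 1" and k: "k \<in> irrep_labels r" and i: "i \<in> {1, r}" and m: "m \<in> {1..r}" "m \<noteq> i"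
  shows "real (k i) ^ r / fact r * real (k m) \<le> irrep_dim r k"
proof -
  have i': "i \<in> {1..r}" using i r by auto
  define Q where "Q = {1..i} \<times> {i..r}"
  define g where "g = (\<lambda>(l, j). (\<Sum>i=l..j. real (k i)) / real (j + 1 - l))"
  have mQ: "(m, m) \<notin> Q" using m by (auto simp: Q_def)
  have "real (k i) ^ r / fact r = (\<Prod>d=1..r. real (k i) / real d)"
    by (simp add: prod_dividef fact_prod)
  also have "\<dots> = (\<Prod>(l, j)\<in>Q. real (k i) / real (j + 1 - l))"
    unfolding Q_def by (rule corner_hook_product[OF r i, symmetric])
  also have "\<dots> \<le> prod g Q"
    unfolding g_def Q_def using i' by (intro prod_mono) (auto intro!: divide_right_mono member_le_sum)
  finally have "real (k i) ^ r / fact r * real (k m) \<le> prod g Q * g (m, m)"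
    by (intro mult_mono) (auto simp: g_def intro!: prod_nonneg sum_nonneg divide_nonneg_nonneg)
  also have "\<dots> = prod g (insert (m, m) Q)" using mQ by (simp add: Q_def mult.commute)
  also have "\<dots> \<le> irrep_dim r k"
    unfolding g_def Q_def using i' m by (intro irrep_dim_ge_subproduct k) (auto simp: pos_root_pairs_def)
  finally show ?thesis .
qed

lemma card_pos_root_pairs: "2 * card (pos_root_pairs r) = r * (r + 1)"
proof -
  have "pos_root_pairs r = (\<lambda>(j, l). (l, j)) ` Sigma {1..r} (\<lambda>j. {1..j})"
    by (auto simp: pos_root_pairs_def image_iff)
  hence "card (pos_root_pairs r) = card (Sigma {1..r} (\<lambda>j. {1..j}))"
    by (simp only:) (rule card_image, auto simp: inj_on_def)
  also have "\<dots> = \<Sum>{1..r}" by simp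
  finally show ?thesis using gauss_sum_from_Suc_0[of r, where 'a = nat] 
    by (simp add: atLeastAtMost_def dvd_mult_div_cancel even_mult_iff)
qed

lemma irrep_dim_le_power:
  assumes "k \<in> irrep_labels r" "\<And>i. i \<in> {1..r} \<Longrightarrow> real (k i) \<le> y"
  shows "irrep_dim r k \<le> y ^ card (pos_root_pairs r)"
proof -
  have "irrep_dim r k \<le> (\<Prod>p\<in>pos_root_pairs r. y)"
    unfolding irrep_dim_def weyl_dim_eq
  proof (intro prod_mono, clarify)
    fix l j assume "(l, j) \<in> pos_root_pairs r"
    hence lj: "1 \<le> l" "l \<le> j" "j \<le> r" by (auto simp: pos_root_pairs_def)
    have "(\<Sum>i=l..j. real (k i)) \<le> (\<Sum>i=l..j. y)" using assms(2) lj by (intro sum_mono) auto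
    also have "\<dots> = real (j + 1 - l) * y" by (simp add: Suc_diff_le lj)
    finally show "0 \<le> (\<Sum>i=l..j. real (k i)) / real (j + 1 - l) \<and> (\<Sum>i=l..j. real (k i)) / real (j + 1 - l) \<le> y"
      using lj by (auto intro!: divide_nonneg_nonneg sum_nonneg simp: divide_le_eq mult.commute)
  qed
  thus ?thesis by simp
qed

text \<open>
The product is the one that Weyl's formula gives for \<open>Sym^m\<close>.
\<close>

lemma binomial_eq_prod: "real ((m + n) choose n) = (\<Prod>d=1..n. (real m + real d) / real d)"
proof (induction n)
  case (Suc n)
  have "real (Suc n) * real ((m + Suc n) choose Suc n) = real (m + Suc n) * real ((m + n) choose n)"
    using Suc_times_binomial_eq[of "m + n" n] by (metis add_Suc_right mult.commute of_nat_mult)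
  hence "real ((m + Suc n) choose Suc n) = real ((m + n) choose n) * (real (m + Suc n) / real (Suc n))"
    by (metis mult.commute nonzero_mult_div_cancel_left of_nat_0_eq_iff nat.distinct(2) times_divide_eq_right)
  thus ?case unfolding Suc by (simp add: add_ac)
qed simp

text \<open>
For \<open>i = 1\<close> the label of the symmetric power \<open>Sym^m\<close> of the standard representation, for \<open>i = r\<close> that of its
dual. The entry is \<open>m + 1\<close> because entries start at 1.
\<close>

definition corner_label :: "nat \<Rightarrow> nat \<Rightarrow> nat \<Rightarrow> nat \<Rightarrow> nat" where
  "corner_label r i m = (\<lambda>j\<in>{1..r}. if j = i then m + 1 else 1)"

lemma corner_label_in_labels: "corner_label r i m \<in> irrep_labels r"
  by (auto simp: corner_label_def irrep_labels_def)

lemma label_dim_corner: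
  assumes r: "r \<ge> 1" and i: "i \<in> {1, r}"
  shows "label_dim r (corner_label r i m) = (m + r) choose r"
proof -
  have i': "i \<in> {1..r}" using i r by auto
  let ?k = "corner_label r i m"
  define f where "f = (\<lambda>d. (real m + real d) / real d)"
  have "irrep_dim r ?k = (\<Prod>p\<in>pos_root_pairs r. if p \<in> {1..i} \<times> {i..r} then (\<lambda>(l, j). f (j + 1 - l)) p else 1)"
    unfolding irrep_dim_def weyl_dim_eq
  proof (intro prod.cong[OF refl])
    fix p assume p: "p \<in> pos_root_pairs r"
    obtain l j where lj: "p = (l, j)" by fastforce
    hence lj': "1 \<le> l" "l \<le> j" "j \<le> r" using p by (auto simp: pos_root_pairs_def)
    have "(\<Sum>i=l..j. real (?k i)) = (\<Sum>n=l..j. 1 + (if n = i then real m else 0))"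
      using lj' by (intro sum.cong) (auto simp: corner_label_def)
    also have "\<dots> = real (j + 1 - l) + (if i \<in> {l..j} then real m else 0)"
      by (simp add: sum.distrib)
    finally show "(case p of (l, j) \<Rightarrow> (\<Sum>i=l..j. real (?k i)) / real (j + 1 - l)) =
       (if p \<in> {1..i} \<times> {i..r} then case p of (l, j) \<Rightarrow> f (j + 1 - l) else 1)"
      using lj' i' by (auto simp: f_def lj)
  qed
  also have "\<dots> = (\<Prod>(l, j)\<in>{1..i} \<times> {i..r}. f (j + 1 - l))"
    by (subst prod.inter_restrict[OF finite_pos_root_pairs, symmetric], rule prod.cong)
       (use i' in \<open>auto simp: pos_root_pairs_def\<close>)
  also have "\<dots> = (\<Prod>d=1..r. f d)" by (rule corner_hook_product[OF r i])
  also have "\<dots> = real ((m + r) choose r)" by (simp add: f_def binomial_eq_prod)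
  finally show ?thesis using real_label_dim[of r ?k] by simp
qed

lemma weight_height_eq: "weight_height r y = 1 / 2 * (\<Sum>i=1..r. real (i * (r + 1 - i)) * y i)"
proof -
  have "(\<Sum>(l, j)\<in>pos_root_pairs r. \<Sum>i=l..j. y i) = (\<Sum>p\<in>pos_root_pairs r. \<Sum>i=1..r. if fst p \<le> i \<and> i \<le> snd p then y i else 0)"
  proof (intro sum.cong[OF refl], clarify)
    fix l j assume "(l, j) \<in> pos_root_pairs r"
    hence "{l..j} = {i \<in> {1..r}. l \<le> i \<and> i \<le> j}" by (auto simp: pos_root_pairs_def)
    thus "(\<Sum>i=l..j. y i) = (\<Sum>i=1..r. if fst (l, j) \<le> i \<and> i \<le> snd (l, j) then y i else 0)"
      by (simp only: sum.inter_filter finite_atLeastAtMost fst_conv snd_conv)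
  qed
  also have "\<dots> = (\<Sum>i=1..r. \<Sum>p\<in>pos_root_pairs r. if fst p \<le> i \<and> i \<le> snd p then y i else 0)" by (rule sum.swap)
  also have "\<dots> = (\<Sum>i=1..r. real (i * (r + 1 - i)) * y i)"
  proof (intro sum.cong[OF refl])
    fix i assume i: "i \<in> {1..r}"
    have "(\<Sum>p\<in>pos_root_pairs r. if fst p \<le> i \<and> i \<le> snd p then y i else 0)
        = real (card {p \<in> pos_root_pairs r. fst p \<le> i \<and> i \<le> snd p}) * y i"
      using finite_pos_root_pairs by (simp flip: sum.inter_filter)
    also have "{p \<in> pos_root_pairs r. fst p \<le> i \<and> i \<le> snd p} = {1..i} \<times> {i..r}"
      using root_pairs_through[OF i] by (auto simp: case_prod_unfold)
    finally show "(\<Sum>p\<in>pos_root_pairs r. if fst p \<le> i \<and> i \<le> snd p then y i else 0) = real (i * (r + 1 - i)) * y i"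
      using i by (simp add: Suc_diff_le algebra_simps)
  qed
  finally show ?thesis by (simp add: weight_height_def)
qed

section \<open>Sums over all labels\<close>

lemma label_dim_ge_label: "k \<in> irrep_labels r \<Longrightarrow> i \<in> {1..r} \<Longrightarrow> k i \<le> label_dim r k"
  using irrep_dim_ge_label[of k r i] by (simp flip: real_label_dim)

lemma label_dim_ge_1: "r \<ge> 1 \<Longrightarrow> k \<in> irrep_labels r \<Longrightarrow> label_dim r k \<ge> 1"
  using label_dim_ge_label[of k r 1] label_ge_1[of k r 1] by simp

lemma geometric_exp_sum_le:
  assumes "c > 0"
  shows "(\<Sum>m=1..N. exp (- c * real m)) \<le> 1 / c"
proof -
  define x where "x = exp (- c)"
  have x: "0 < x" "x < 1" using assms by (auto simp: x_def)
  have "(\<Sum>m=1..N. exp (- c * real m)) = (\<Sum>m=1..N. x ^ m)"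
    by (intro sum.cong) (simp_all add: x_def mult.commute flip: exp_of_nat_mult)
  also have "\<dots> \<le> x / (1 - x)"
  proof -
    have "(1 - x) * (\<Sum>m=1..N. x ^ m) = x - x ^ Suc N"
    proof (induction N)
      case (Suc N)
      have "(1 - x) * (\<Sum>m=1..Suc N. x ^ m) = (1 - x) * (\<Sum>m=1..N. x ^ m) + (1 - x) * x ^ Suc N"
        by (simp add: distrib_left)
      also have "\<dots> = x - x ^ Suc (Suc N)" unfolding Suc by (simp add: algebra_simps)
      finally show ?case .
    qed simp
    hence "(\<Sum>m=1..N. x ^ m) = (x - x ^ Suc N) / (1 - x)"
      using x by (simp add: field_simps)
    thus ?thesis using x by (simp add: divide_right_mono)
  qed
  also have "\<dots> \<le> 1 / c"
  proof -
    have "x * (1 + c) \<le> x * exp c" using x exp_ge_add_one_self[of c] by (intro mult_left_mono) auto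
    also have "\<dots> = 1" by (simp add: x_def flip: exp_add)
    finally show ?thesis using x assms by (simp add: field_simps)
  qed
  finally show ?thesis .
qed

text \<open>
A crude bound that is sufficient for all tails: the dimension is at least the average of the
entries, which makes the sum a product of geometric series.
\<close>

lemma sum_exp_label_dim_le:
  fixes \<theta> :: real
  assumes r: "r \<ge> 1" and F: "finite F" "F \<subseteq> irrep_labels r" and \<theta>: "\<theta> > 0"
  shows "(\<Sum>k\<in>F. exp (- \<theta> * label_dim r k)) \<le> (real r / \<theta>) ^ r"
proof -
  define N where "N = Max (insert 1 ((\<lambda>k. label_dim r k) ` F))"
  have "F \<subseteq> {1..r} \<rightarrow>\<^sub>E {1..N}"
  proof
    fix k assume k: "k \<in> F"
    hence kU: "k \<in> irrep_labels r" using F by auto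
    have "label_dim r k \<le> N" unfolding N_def using k F by (intro Max_ge) auto
    hence "k i \<in> {1..N}" if "i \<in> {1..r}" for i
      using label_dim_ge_label[OF kU that] label_ge_1[OF kU that] by simp
    thus "k \<in> {1..r} \<rightarrow>\<^sub>E {1..N}"
      using kU by (simp add: irrep_labels_def PiE_iff)
  qed
  have "(\<Sum>k\<in>F. exp (- \<theta> * label_dim r k)) \<le> (\<Sum>k\<in>F. \<Prod>i=1..r. exp (- (\<theta> / r) * k i))"
  proof (intro sum_mono)
    fix k assume "k \<in> F"
    hence "(\<Sum>i=1..r. real (k i)) \<le> (\<Sum>i=1..r. real (label_dim r k))"
      using F label_dim_ge_label[of k r] by (intro sum_mono) auto
    hence "\<theta> / r * (\<Sum>i=1..r. real (k i)) \<le> \<theta> / r * (r * real (label_dim r k))"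
      using \<theta> by (intro mult_left_mono) auto
    hence "exp (- \<theta> * label_dim r k) \<le> exp (- (\<theta> / r) * (\<Sum>i=1..r. real (k i)))"
      using r by simp
    also have "\<dots> = (\<Prod>i=1..r. exp (- (\<theta> / r) * k i))"
      by (subst exp_sum[symmetric]) (auto simp: sum_distrib_left)
    finally show "exp (- \<theta> * label_dim r k) \<le> (\<Prod>i=1..r. exp (- (\<theta> / r) * k i))" .
  qed
  also have "\<dots> \<le> (\<Sum>k\<in>{1..r} \<rightarrow>\<^sub>E {1..N}. \<Prod>i=1..r. exp (- (\<theta> / r) * k i))"
    using \<open>F \<subseteq> {1..r} \<rightarrow>\<^sub>E {1..N}\<close> by (intro sum_mono2 finite_PiE prod_nonneg) auto
  also have "\<dots> = (\<Prod>i=1..r. \<Sum>m=1..N. exp (- (\<theta> / r) * m))"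
    by (rule prod_sum_PiE[symmetric]) auto
  also have "\<dots> \<le> (\<Prod>i=1..r. r / \<theta>)"
    using geometric_exp_sum_le[of "\<theta> / r" N] r \<theta> by (intro prod_mono conjI sum_nonneg) auto
  finally show ?thesis by simp
qed

text \<open>
One constant for all moments up to the third: \<open>1 + x \<le> 6 * exp (x / 6)\<close>, and \<open>216 = 6^3\<close>.
\<close>

lemma add_one_power_exp_le:
  fixes x :: real
  assumes "x \<ge> 0" "j \<le> 3"
  shows "(1 + x) ^ j * exp (- x) \<le> 216 * exp (- x / 2)"
proof -
  have "1 + x \<le> 6 * exp (x / 6)" using exp_ge_add_one_self[of "x / 6"] assms by linarith
  hence "(1 + x) ^ 3 \<le> (6 * exp (x / 6)) ^ 3" using assms by (intro power_mono) auto
  also have "\<dots> = 216 * exp (x / 2)" by (simp add: power_mult_distrib flip: exp_of_nat_mult)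
  finally have "(1 + x) ^ 3 \<le> 216 * exp (x / 2)" .
  moreover have "(1 + x) ^ j \<le> (1 + x) ^ 3" using assms by (intro power_increasing) auto
  ultimately have "(1 + x) ^ j * exp (- x) \<le> 216 * exp (x / 2) * exp (- x)"
    by (intro mult_right_mono) auto
  also have "\<dots> = 216 * exp (- x / 2)" by (simp flip: exp_add)
  finally show ?thesis .
qed

section \<open>Estimates for a single part\<close>

context
  fixes S :: real and a :: nat
  assumes S: "S > 0" and a: "a \<ge> 1"
begin

lemma exp_power_in_unit_interval: "0 < exp (- S)" "exp (- S) < 1" using S by auto

lemma exp_power_eq: "exp (- S) ^ a = exp (- (S * a))"
  by (simp flip: exp_of_nat_mult add: mult.commute)

lemma exponent_pos: "S * a > 0" using S a by simp

lemma occupation_eq: "occupation (exp (- S)) a = 1 / (exp (S * a) - 1)"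
proof -
  define p where "p = exp (- (S * a))"
  have "0 < p" "p < 1" using exponent_pos by (auto simp: p_def)
  moreover have "exp (S * a) = 1 / p" by (simp add: p_def exp_minus inverse_eq_divide)
  ultimately show ?thesis by (simp add: occupation_def exp_power_eq flip: p_def) (simp add: field_simps)
qed

lemma one_plus_occupation_eq: "1 + occupation (exp (- S)) a = 1 / (1 - exp (- (S * a)))"
proof -
  define p where "p = exp (- (S * a))"
  have "0 < p" "p < 1" using exponent_pos by (auto simp: p_def)
  thus ?thesis by (simp add: occupation_def exp_power_eq flip: p_def) (simp add: field_simps)
qed

lemma mean_part_le: "a * occupation (exp (- S)) a \<le> 1 / S"
proof -
  have "S * a \<le> exp (S * a) - 1" using exp_ge_add_one_self[of "S * a"] by linarith
  thus ?thesis using exponent_pos S a by (simp add: occupation_eq field_simps)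
qed

lemma one_plus_occupation: "a * (1 + occupation (exp (- S)) a) \<le> (1 + S * a) / S"
proof -
  have "exp (- (S * a)) \<le> 1 / (1 + S * a)"
    using exp_ge_add_one_self[of "S * a"] exponent_pos by (simp add: exp_minus divide_simps)
  hence "S * a / (1 + S * a) \<le> 1 - exp (- (S * a))" using exponent_pos by (simp add: field_simps)
  moreover note one_plus_occupation_eq
  moreover have "1 - exp (- (S * a)) > 0" using exponent_pos by simp
  moreover have "S * a / (1 + S * a) > 0" using exponent_pos by simp
  ultimately have "1 + occupation (exp (- S)) a \<le> 1 / (S * a / (1 + S * a))"
    by (metis frac_le order_refl zero_le_one)
  hence "a * (1 + occupation (exp (- S)) a) \<le> a * (1 / (S * a / (1 + S * a)))"
    by (intro mult_left_mono) auto
  also have "\<dots> = (1 + S * a) / S" using a by simp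
  finally show ?thesis .
qed

lemma occupation_le: "a * occupation (exp (- S)) a \<le> exp (- (S * a)) * (1 + S * a) / S"
proof -
  have "occupation (exp (- S)) a = exp (- (S * a)) * (1 + occupation (exp (- S)) a)"
    unfolding one_plus_occupation_eq by (simp add: occupation_def exp_power_eq)
  hence "a * occupation (exp (- S)) a = exp (- (S * a)) * (a * (1 + occupation (exp (- S)) a))"
    by (metis mult.left_commute)
  also have "\<dots> \<le> exp (- (S * a)) * ((1 + S * a) / S)"
    by (intro mult_left_mono one_plus_occupation) auto
  finally show ?thesis by simp
qed

lemma mean_part_le_exp: "a * occupation (exp (- S)) a \<le> 216 / S * exp (- (S / 2) * a)"
proof -
  have "a * occupation (exp (- S)) a \<le> ((1 + S * a) ^ 1 * exp (- (S * a))) / S"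
    using occupation_le by (simp add: mult.commute)
  also have "\<dots> \<le> 216 * exp (- (S * a) / 2) / S"
    using exponent_pos S by (intro divide_right_mono add_one_power_exp_le) auto
  finally show ?thesis by simp
qed

lemma one_plus_occupation_nonneg: "a * (1 + occupation (exp (- S)) a) \<ge> 0" "a * occupation (exp (- S)) a \<ge> 0"
  using occupation_pos[OF exp_power_in_unit_interval a] by auto

lemma part_variance_le: "part_variance (exp (- S)) a \<le> (1 + S * a)\<^sup>2 * exp (- (S * a)) / S\<^sup>2"
proof -
  have "part_variance (exp (- S)) a = (a * occupation (exp (- S)) a) * (a * (1 + occupation (exp (- S)) a))"
    by (simp add: part_variance_def power2_eq_square)
  also have "\<dots> \<le> (exp (- (S * a)) * (1 + S * a) / S) * ((1 + S * a) / S)"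
    using exponent_pos S by (intro mult_mono occupation_le one_plus_occupation one_plus_occupation_nonneg) auto
  also have "\<dots> = (1 + S * a)\<^sup>2 * exp (- (S * a)) / S\<^sup>2"
    by (simp add: power2_eq_square)
  finally show ?thesis .
qed

lemma part_variance_le_exp: "part_variance (exp (- S)) a \<le> 216 / S\<^sup>2 * exp (- (S / 2) * a)"
proof -
  have "part_variance (exp (- S)) a \<le> ((1 + S * a) ^ 2 * exp (- (S * a))) / S\<^sup>2" by (rule part_variance_le)
  also have "\<dots> \<le> 216 * exp (- (S * a) / 2) / S\<^sup>2"
    using exponent_pos S by (intro divide_right_mono add_one_power_exp_le) auto
  finally show ?thesis by simp
qed

lemma part_variance_nonneg: "part_variance (exp (- S)) a \<ge> 0"
  using occupation_pos[OF exp_power_in_unit_interval a] by (simp add: part_variance_def)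

lemma third_moment_le: "part_variance (exp (- S)) a * a * (1 + occupation (exp (- S)) a)
    \<le> part_variance (exp (- S)) a * ((1 + S * a) / S)"
  using mult_left_mono[OF one_plus_occupation part_variance_nonneg] by (simp add: mult.assoc)

lemma third_moment_le_exp: "part_variance (exp (- S)) a * a * (1 + occupation (exp (- S)) a)
    \<le> 216 / S ^ 3 * exp (- (S / 2) * a)"
proof -
  have "part_variance (exp (- S)) a * a * (1 + occupation (exp (- S)) a)
     = (a * occupation (exp (- S)) a) * (a * (1 + occupation (exp (- S)) a)) * (a * (1 + occupation (exp (- S)) a))"
    by (simp add: part_variance_def power2_eq_square)
  also have "\<dots> \<le> (exp (- (S * a)) * (1 + S * a) / S) * ((1 + S * a) / S) * ((1 + S * a) / S)"
    using exponent_pos S by (intro mult_mono occupation_le one_plus_occupation one_plus_occupation_nonneg mult_nonneg_nonneg) auto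
  also have "\<dots> = ((1 + S * a) ^ 3 * exp (- (S * a))) / S ^ 3"
    by (simp add: power3_eq_cube)
  also have "\<dots> \<le> 216 * exp (- (S * a) / 2) / S ^ 3"
    using exponent_pos S by (intro divide_right_mono add_one_power_exp_le) auto
  finally show ?thesis by simp
qed

text \<open>
For parts that are small on the scale \<open>1 / S\<close>, the coefficient of \<open>sin^2\<close> in \<open>norm_geom_char_sq\<close> is at
least \<open>(S * a)^-2\<close>.
\<close>

lemma occupation_product_ge:
  assumes "S * a \<le> 1"
  shows "4 * occupation (exp (- S)) a * (1 + occupation (exp (- S)) a) \<ge> 1 / (S * a)\<^sup>2"
proof -
  define x where "x = S * a"
  have x: "0 < x" "x \<le> 1" using exponent_pos assms by (auto simp: x_def)
  have e: "exp x - 1 > 0" using x by simp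
  have "4 * occupation (exp (- S)) a * (1 + occupation (exp (- S)) a) = 4 * exp x / (exp x - 1)\<^sup>2"
    using e by (simp add: occupation_eq flip: x_def) (simp add: field_simps power2_eq_square)
  moreover have "exp x - 1 \<le> 2 * x"
  proof -
    have "exp x \<le> 1 + x + x\<^sup>2" using x by (intro exp_bound) auto
    also have "x\<^sup>2 \<le> x" using x by (simp add: power2_eq_square mult_left_le)
    finally show ?thesis by simp
  qed
  hence "(exp x - 1)\<^sup>2 \<le> (2 * x)\<^sup>2" using e by (intro power_mono) auto
  hence "4 * exp x / (exp x - 1)\<^sup>2 \<ge> 4 * 1 / (2 * x)\<^sup>2"
    using e x by (intro frac_le) auto
  ultimately show ?thesis by (simp add: x_def power_mult_distrib)
qed

lemma part_variance_ge:
  assumes "S * a \<le> 1"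
  shows "part_variance (exp (- S)) a \<ge> 1 / (4 * S\<^sup>2)"
proof -
  have "part_variance (exp (- S)) a = (real a)\<^sup>2 / 4 * (4 * occupation (exp (- S)) a * (1 + occupation (exp (- S)) a))"
    by (simp add: part_variance_def)
  also have "\<dots> \<ge> (real a)\<^sup>2 / 4 * (1 / (S * a)\<^sup>2)"
    by (intro mult_left_mono occupation_product_ge assms) auto
  also have "(real a)\<^sup>2 / 4 * (1 / (S * a)\<^sup>2) = 1 / (4 * S\<^sup>2)" using a S by (simp add: power_mult_distrib)
  finally show ?thesis .
qed

end

section \<open>The saddle point\<close>

text \<open>
The mean total dimension in the independent model with \<open>q = exp (- S)\<close>, as a function of \<open>S\<close>.
\<close>

definition mean_dim :: "nat \<Rightarrow> real \<Rightarrow> real" where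
  "mean_dim r S = (\<Sum>\<^sub>\<infinity>k\<in>irrep_labels r. label_dim r k * occupation (exp (- S)) (label_dim r k))"

lemma summable_mean_dim:
  assumes r: "r \<ge> 1" and S: "S > 0"
  shows "(\<lambda>k. label_dim r k * occupation (exp (- S)) (label_dim r k)) summable_on irrep_labels r"
proof (rule nonneg_bdd_above_summable_on)
  show "label_dim r k * occupation (exp (- S)) (label_dim r k) \<ge> 0" if "k \<in> irrep_labels r" for k
    using one_plus_occupation_nonneg(2)[OF S label_dim_ge_1[OF r that]] .
  show "bdd_above (sum (\<lambda>k. label_dim r k * occupation (exp (- S)) (label_dim r k)) ` {F. F \<subseteq> irrep_labels r \<and> finite F})"
  proof (rule bdd_aboveI2)
    fix F assume F: "F \<in> {F. F \<subseteq> irrep_labels r \<and> finite F}"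
    have "(\<Sum>k\<in>F. label_dim r k * occupation (exp (- S)) (label_dim r k))
        \<le> (\<Sum>k\<in>F. 216 / S * exp (- (S / 2) * label_dim r k))"
      using F label_dim_ge_1[OF r] by (intro sum_mono mean_part_le_exp S) auto
    also have "\<dots> = 216 / S * (\<Sum>k\<in>F. exp (- (S / 2) * label_dim r k))" by (rule sum_distrib_left[symmetric])
    also have "\<dots> \<le> 216 / S * (real r / (S / 2)) ^ r"
    proof (rule mult_left_mono)
      show "(\<Sum>k\<in>F. exp (- (S / 2) * label_dim r k)) \<le> (real r / (S / 2)) ^ r"
        using F S by (intro sum_exp_label_dim_le r) auto
    qed (use S in simp)
    finally show "(\<Sum>k\<in>F. label_dim r k * occupation (exp (- S)) (label_dim r k)) \<le> 216 / S * (real r / (S / 2)) ^ r" .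
  qed
qed

lemma has_sum_mean_dim:
  "r \<ge> 1 \<Longrightarrow> S > 0 \<Longrightarrow>
    ((\<lambda>k. label_dim r k * occupation (exp (- S)) (label_dim r k)) has_sum mean_dim r S) (irrep_labels r)"
  unfolding mean_dim_def by (rule has_sum_infsum[OF summable_mean_dim])

lemma occupation_antimono:
  assumes "0 < S" "S < T" "a \<ge> 1"
  shows "occupation (exp (- T)) a < occupation (exp (- S)) a"
proof -
  have "exp (S * a) < exp (T * a)" "exp (S * a) > 1" using assms by auto
  thus ?thesis using assms by (simp add: occupation_eq frac_less2)
qed

lemma ones_label: "corner_label r 1 0 \<in> irrep_labels r" "r \<ge> 1 \<Longrightarrow> label_dim r (corner_label r 1 0) = 1"
  by (auto simp: corner_label_in_labels label_dim_corner)

lemma mean_dim_strict_antimono: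
  assumes r: "r \<ge> 1" and ST: "0 < S" "S < T"
  shows "mean_dim r T < mean_dim r S"
proof (rule has_sum_strict_mono[OF has_sum_mean_dim has_sum_mean_dim])
  show "corner_label r 1 0 \<in> irrep_labels r" by (rule ones_label)
  show "label_dim r (corner_label r 1 0) * occupation (exp (- T)) (label_dim r (corner_label r 1 0))
      < label_dim r (corner_label r 1 0) * occupation (exp (- S)) (label_dim r (corner_label r 1 0))"
    using occupation_antimono[OF ST, of 1] ones_label(2)[OF r] by simp
  show "label_dim r k * occupation (exp (- T)) (label_dim r k) \<le> label_dim r k * occupation (exp (- S)) (label_dim r k)"
    if "k \<in> irrep_labels r" for k
    using occupation_antimono[OF ST label_dim_ge_1[OF r that]] by (intro mult_left_mono) auto
qed (use r ST in auto)

text \<open>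
The trivial representation alone makes the mean unbounded as \<open>S\<close> tends to 0.
\<close>

lemma mean_dim_ge:
  assumes r: "r \<ge> 1" and S: "S > 0"
  shows "mean_dim r S \<ge> 1 / (exp S - 1)"
proof -
  have "(\<Sum>k\<in>{corner_label r 1 0}. label_dim r k * occupation (exp (- S)) (label_dim r k)) \<le> mean_dim r S"
    unfolding mean_dim_def
  proof (rule finite_sum_le_infsum[OF summable_mean_dim[OF r S]])
    show "label_dim r k * occupation (exp (- S)) (label_dim r k) \<ge> 0" if "k \<in> irrep_labels r - {corner_label r 1 0}" for k
      using one_plus_occupation_nonneg(2)[OF S label_dim_ge_1[OF r]] that by blast
  qed (auto simp: corner_label_in_labels)
  thus ?thesis using ones_label(2)[OF r] occupation_eq[OF S, of 1] by simp
qed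

lemma continuous_on_mean_dim:
  assumes r: "r \<ge> 1" and S: "0 < S0"
  shows "continuous_on {S0..S1} (mean_dim r)"
proof -
  have "uniform_limit {S0..S1} (\<lambda>X S. \<Sum>k\<in>X. label_dim r k * occupation (exp (- S)) (label_dim r k))
          (mean_dim r) (finite_subsets_at_top (irrep_labels r))"
    unfolding mean_dim_def
  proof (rule Weierstrass_m_test_general[OF _ summable_mean_dim[OF r S]])
    fix k S assume k: "k \<in> irrep_labels r" and S': "S \<in> {S0..S1}"
    have d: "label_dim r k \<ge> 1" using label_dim_ge_1[OF r k] .
    have "occupation (exp (- S)) (label_dim r k) \<le> occupation (exp (- S0)) (label_dim r k)"
      using occupation_antimono[OF S _ d, of S] S' by (cases "S = S0") auto
    hence "label_dim r k * occupation (exp (- S)) (label_dim r k) \<le> label_dim r k * occupation (exp (- S0)) (label_dim r k)"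
      by (intro mult_left_mono) auto
    moreover have "label_dim r k * occupation (exp (- S)) (label_dim r k) \<ge> 0"
      using S' S by (intro one_plus_occupation_nonneg(2) d) auto
    ultimately show "norm (label_dim r k * occupation (exp (- S)) (label_dim r k)) \<le> label_dim r k * occupation (exp (- S0)) (label_dim r k)"
      by simp
  qed
  moreover have "eventually (\<lambda>X. continuous_on {S0..S1} (\<lambda>S. \<Sum>k\<in>X. label_dim r k * occupation (exp (- S)) (label_dim r k)))
      (finite_subsets_at_top (irrep_labels r))"
  proof (rule eventually_finite_subsets_at_top_weakI)
    fix X assume X: "X \<subseteq> irrep_labels r"
    show "continuous_on {S0..S1} (\<lambda>S. \<Sum>k\<in>X. label_dim r k * occupation (exp (- S)) (label_dim r k))"
    proof (intro continuous_on_sum continuous_on_mult continuous_on_const)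
      fix k assume "k \<in> X"
      hence d: "label_dim r k \<ge> 1" using label_dim_ge_1[OF r] X by auto
      have "exp (- S) ^ label_dim r k < 1" if "S \<in> {S0..S1}" for S
        using exp_power_in_unit_interval[of S] that S d by (simp add: power_less_one_iff)
      thus "continuous_on {S0..S1} (\<lambda>S. occupation (exp (- S)) (label_dim r k))"
        unfolding occupation_def by (intro continuous_intros) force
    qed
  qed
  ultimately show ?thesis
    by (intro uniform_limit_theorem[where F = "finite_subsets_at_top (irrep_labels r)"]) auto
qed

lemma saddle_exists:
  assumes r: "r \<ge> 1" and S1: "S1 > 0" and n: "real n \<ge> mean_dim r S1"
  shows "\<exists>S. 0 < S \<and> S \<le> S1 \<and> mean_dim r S = real n"
proof -
  \<comment> \<open>Chosen such that the trivial representation alone has mean multiplicity at least \<open>n + 1\<close>.\<close>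
  define S0 where "S0 = min S1 (ln (1 + 1 / (real n + 1)))"
  have "ln (1 + 1 / (real n + 1)) > 0" by (intro ln_gt_zero) (simp add: field_simps)
  hence S0: "0 < S0" "S0 \<le> S1" using S1 by (auto simp: S0_def)
  have "exp S0 \<le> 1 + 1 / (real n + 1)"
    by (metis S0_def add_pos_nonneg exp_le_cancel_iff exp_ln min.cobounded2 of_nat_0_le_iff zero_le_divide_1_iff zero_less_one add_nonneg_nonneg zero_le_one)
  moreover have "exp S0 > 1" using S0 by simp
  ultimately have "1 / (exp S0 - 1) \<ge> real n + 1" by (simp add: field_simps)
  hence "mean_dim r S0 \<ge> real n" using mean_dim_ge[OF r S0(1)] by linarith
  hence "\<exists>S\<ge>S0. S \<le> S1 \<and> mean_dim r S = real n"
    using continuous_on_mean_dim[OF r S0(1)] S0 n by (intro IVT2') auto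
  thus ?thesis using S0 by (metis less_le_trans)
qed

lemma saddle_q_eq:
  assumes r: "r \<ge> 1" and S: "S > 0" "mean_dim r S = real n"
  shows "saddle_q r n = exp (- S)"
  unfolding saddle_q_def
proof (rule the_equality)
  have eq: "irrep_dim r k * q powr irrep_dim r k / (1 - q powr irrep_dim r k) = label_dim r k * occupation q (label_dim r k)"
    if "q > 0" for k and q :: real
    using that by (simp add: occupation_def powr_realpow flip: real_label_dim)
  show "0 < exp (- S) \<and> exp (- S) < 1 \<and> ((\<lambda>k. irrep_dim r k * exp (- S) powr irrep_dim r k / (1 - exp (- S) powr irrep_dim r k)) has_sum real n) (irrep_labels r)"
    using has_sum_mean_dim[OF r S(1)] S by (simp add: eq del: powr_def exp_ge_zero) 
  fix q assume q: "0 < q \<and> q < 1 \<and> ((\<lambda>k. irrep_dim r k * q powr irrep_dim r k / (1 - q powr irrep_dim r k)) has_sum real n) (irrep_labels r)"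
  define T where "T = - ln q"
  have T: "T > 0" "q = exp (- T)" using q by (auto simp: T_def)
  have "((\<lambda>k. label_dim r k * occupation (exp (- T)) (label_dim r k)) has_sum real n) (irrep_labels r)"
  proof -
    from q have "0 < q" and hs: "((\<lambda>k. irrep_dim r k * q powr irrep_dim r k / (1 - q powr irrep_dim r k)) has_sum real n) (irrep_labels r)"
      by auto
    from hs show ?thesis unfolding eq[OF \<open>0 < q\<close>] unfolding T(2) .
  qed
  hence "mean_dim r T = real n" using has_sum_mean_dim[OF r T(1)] has_sum_unique by blast
  hence "T = S" using mean_dim_strict_antimono[OF r, of T S] mean_dim_strict_antimono[OF r, of S T] S T
    by (cases T S rule: linorder_cases) auto
  thus "q = exp (- S)" using T by simp
qed

lemma saddle_s_eq:
  assumes r: "r \<ge> 1" and S: "S > 0" "saddle_q r n = exp (- S)"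
  shows "saddle_s r n = S powr (2 / (real r * (real r + 1)))"
  unfolding saddle_s_def
proof (rule the_equality)
  define e where "e = real r * (real r + 1)"
  have e: "e > 0" using r by (simp add: e_def)
  show "0 < S powr (2 / (real r * (real r + 1))) \<and> saddle_q r n = exp (- ((S powr (2 / (real r * (real r + 1)))) powr (real r * (real r + 1) / 2)))"
    using S e by (simp add: powr_powr flip: e_def)
  fix s assume s: "0 < s \<and> saddle_q r n = exp (- (s powr (real r * (real r + 1) / 2)))"
  hence "S = s powr (e / 2)" using S by (simp add: e_def)
  thus "s = S powr (2 / (real r * (real r + 1)))" using s e by (simp add: powr_powr flip: e_def)
qed

text \<open>
The solutions tend to 0 because the mean is finite at every fixed positive \<open>S\<close>.
\<close>

lemma saddle_point_exists:
  assumes r: "r \<ge> 1"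
  obtains S :: "nat \<Rightarrow> real" where "S \<longlonglongrightarrow> 0"
    "eventually (\<lambda>n. S n > 0 \<and> mean_dim r (S n) = real n \<and> saddle_q r n = exp (- S n) \<and>
       saddle_s r n = S n powr (2 / (real r * (real r + 1)))) sequentially"
proof -
  define S where "S = (\<lambda>n. SOME S. 0 < S \<and> mean_dim r S = real n)"
  have S: "0 < S n \<and> mean_dim r (S n) = real n" if "real n \<ge> mean_dim r 1" for n
  proof -
    from saddle_exists[OF r _ that] have "\<exists>S. 0 < S \<and> mean_dim r S = real n" by auto
    from someI_ex[OF this] show ?thesis unfolding S_def .
  qed
  have ev: "eventually (\<lambda>n. real n \<ge> B) sequentially" for B
    using filterlim_real_sequentially by (simp add: filterlim_at_top)
  have "S \<longlonglongrightarrow> 0"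
  proof (rule order_tendstoI)
    fix \<delta> :: real assume "\<delta> < 0"
    show "eventually (\<lambda>n. S n > \<delta>) sequentially"
      using ev[of "mean_dim r 1"] by eventually_elim (use S \<open>\<delta> < 0\<close> in force)
  next
    fix \<delta> :: real assume \<delta>: "0 < \<delta>"
    show "eventually (\<lambda>n. S n < \<delta>) sequentially"
      using ev[of "mean_dim r 1"] ev[of "mean_dim r \<delta> + 1"]
    proof eventually_elim
      case (elim n)
      show ?case
      proof (rule ccontr)
        assume "\<not> S n < \<delta>"
        hence "mean_dim r (S n) \<le> mean_dim r \<delta>"
          using mean_dim_strict_antimono[OF r \<delta>, of "S n"] by (cases "S n = \<delta>") auto
        thus False using S[OF elim(1)] elim by simp
      qed
    qed
  qed
  moreover have "eventually (\<lambda>n. S n > 0 \<and> mean_dim r (S n) = real n \<and> saddle_q r n = exp (- S n) \<and>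
       saddle_s r n = S n powr (2 / (real r * (real r + 1)))) sequentially"
    using ev[of "mean_dim r 1"] by eventually_elim (use S saddle_q_eq saddle_s_eq r in blast)
  ultimately show ?thesis by (rule that)
qed

section \<open>Labels of large height\<close>

text \<open>
The threshold is written as \<open>r / 2 * M\<close> so that a corner label of size \<open>m\<close> is high if and only if
\<open>m > M\<close>.
\<close>

definition high_labels :: "nat \<Rightarrow> real \<Rightarrow> (nat \<Rightarrow> nat) set" where
  "high_labels r M = {k \<in> irrep_labels r. weight_height r (\<lambda>i. real (k i) - 1) > real r / 2 * M}"

lemma root_pair_count_le:
  fixes i r :: nat
  assumes "i \<in> {1..r}"
  shows "i * (r + 1 - i) \<le> r\<^sup>2" "r \<le> i * (r + 1 - i)"
proof -
  show "i * (r + 1 - i) \<le> r\<^sup>2" unfolding power2_eq_square using assms by (intro mult_mono) auto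
  obtain a b where "i = Suc a" "r = i + b" using assms by (metis atLeastAtMost_iff le_add_diff_inverse not0_implies_Suc not_one_le_zero)
  thus "r \<le> i * (r + 1 - i)" by simp
qed

lemma root_pair_count_interior:
  fixes i r :: nat
  assumes "i \<in> {1..r}" "i \<notin> {1, r}"
  shows "r + 1 \<le> i * (r + 1 - i)"
proof -
  have "2 \<le> i" "i < r" using assms by auto
  then obtain a b where "i = Suc (Suc a)" "r = i + Suc b"
    by (metis add_2_eq_Suc le_Suc_ex less_imp_Suc_add add_Suc_right)
  thus ?thesis by simp
qed

lemma high_label_large_entry:
  assumes k: "k \<in> high_labels r M" and M: "M > 0" and r: "r \<ge> 1"
  obtains i where "i \<in> {1..r}" "real (k i) \<ge> M / (real r)\<^sup>2"
proof -
  have kU: "k \<in> irrep_labels r" using k by (simp add: high_labels_def)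
  have "\<exists>i\<in>{1..r}. real (k i) \<ge> M / (real r)\<^sup>2"
  proof (rule ccontr)
    assume "\<not> ?thesis"
    hence small: "real (k i) < M / (real r)\<^sup>2" if "i \<in> {1..r}" for i using that by force
    have "(\<Sum>i=1..r. real (i * (r + 1 - i)) * (real (k i) - 1)) \<le> (\<Sum>i=1..r. M)"
    proof (rule sum_mono)
      fix i assume i: "i \<in> {1..r}"
      have "real (i * (r + 1 - i)) * (real (k i) - 1) \<le> real (r\<^sup>2) * (M / (real r)\<^sup>2)"
        using root_pair_count_le(1)[OF i] small[OF i] label_ge_1[OF kU i] M
        by (intro mult_mono) (auto simp: of_nat_le_iff simp del: of_nat_mult of_nat_power)
      thus "real (i * (r + 1 - i)) * (real (k i) - 1) \<le> M" using r by simp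
    qed
    hence "weight_height r (\<lambda>i. real (k i) - 1) \<le> real r / 2 * M" by (simp add: weight_height_eq)
    thus False using k by (simp add: high_labels_def)
  qed
  thus ?thesis using that by blast
qed

text \<open>
All scales are powers of one parameter \<open>u\<close> tending to infinity: \<open>h\<close>, which is \<open>s\<close> to the power
\<open>(r + 1) / 2\<close>, and \<open>S = h ^ r\<close>. The parameter \<open>u\<close> itself separates scales. Labels with
\<open>S * dim k > u\<close> are negligible, while \<open>u\<close> is small against \<open>1 / h\<close>.
\<close>

definition scaled_h :: "nat \<Rightarrow> real \<Rightarrow> real" where "scaled_h r u = 1 / u ^ (2 * r)"

definition scaled_S :: "nat \<Rightarrow> real \<Rightarrow> real" where "scaled_S r u = scaled_h r u ^ r"

text \<open>
The entries of a high label with \<open>S * dim k \<le> u\<close> are at most \<open>side_bound r * u\<close>, except for one of the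
two end entries.
\<close>

definition side_bound :: "nat \<Rightarrow> real" where "side_bound r = fact r * real r ^ (2 * r)"

text \<open>
A bound for the sum of \<open>exp (- S * dim k / 2)\<close> over the labels with \<open>S * dim k \<ge> u\<close>.
\<close>

definition label_tail :: "nat \<Rightarrow> real \<Rightarrow> real" where
  "label_tail r u = exp (- u / 4) * (4 * real r / scaled_S r u) ^ r"

definition corner_labels :: "nat \<Rightarrow> (nat \<Rightarrow> nat) set" where
  "corner_labels r = {corner_label r i m | i m. i \<in> {1, r}}"

locale scaling =
  fixes r :: nat and u :: real
  assumes r: "r \<ge> 2" and u: "u \<ge> 1"
begin

abbreviation h :: real where "h \<equiv> scaled_h r u"
abbreviation S :: real where "S \<equiv> scaled_S r u"

lemma h_pos: "h > 0" and h_le_1: "h \<le> 1"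
  using u by (auto simp: scaled_h_def)

lemma S_pos: "S > 0" and S_le_1: "S \<le> 1"
  using h_pos h_le_1 by (auto simp: scaled_S_def power_le_one)

lemma S_eq: "S = 1 / u ^ (2 * r\<^sup>2)"
  by (simp add: scaled_S_def scaled_h_def power_divide power2_eq_square mult.assoc flip: power_mult)

lemma dim_ge_1: "k \<in> irrep_labels r \<Longrightarrow> label_dim r k \<ge> 1"
  using label_dim_ge_1[of r k] r by simp

text \<open>
Some entry is at least a constant times \<open>M\<close>, and the dimension grows at least like its \<open>r\<close>-th power.
\<close>

lemma high_label_dim_ge:
  assumes k: "k \<in> high_labels r M" and M: "M \<ge> real r ^ 3"
  shows "S * label_dim r k \<ge> (h * M / real r ^ 3) ^ r"
proof -
  have kU: "k \<in> irrep_labels r" using k by (simp add: high_labels_def)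
  have r0: "real r > 0" using r by simp
  have M0: "M > 0" using M r0 by (meson less_le_trans zero_less_power)
  obtain i where i: "i \<in> {1..r}" "real (k i) \<ge> M / (real r)\<^sup>2"
    using high_label_large_entry[OF k M0] r by (metis one_le_numeral order_trans)
  have "real (k i) \<ge> real r ^ 3 / (real r)\<^sup>2" using i(2) divide_right_mono[OF M, of "(real r)\<^sup>2"] by simp
  hence kr: "k i \<ge> r" using r0 by (simp add: power3_eq_cube power2_eq_square)
  have "(h * M / real r ^ 3) ^ r = S * (M / real r ^ 3) ^ r"
    by (simp add: scaled_S_def power_mult_distrib power_divide)
  also have "\<dots> \<le> S * (real (k i) / real r) ^ r"
  proof (intro mult_left_mono power_mono)
    have "M / real r ^ 3 = M / (real r)\<^sup>2 / real r" by (simp add: power3_eq_cube power2_eq_square)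
    also have "\<dots> \<le> real (k i) / real r" using i(2) by (intro divide_right_mono) auto
    finally show "M / real r ^ 3 \<le> real (k i) / real r" .
  qed (use S_pos M0 in auto)
  also have "\<dots> \<le> S * irrep_dim r k"
    using S_pos root_pair_count_le(2)[OF i(1)] by (intro mult_left_mono irrep_dim_ge_power[OF kU i(1) _ kr]) auto
  finally show ?thesis by (simp add: real_label_dim)
qed

text \<open>
Let \<open>k i\<close> be an entry of order at least \<open>1 / h\<close>. In the interior of the diagram it would force
\<open>S * dim k\<close> to be of order \<open>1 / h\<close>, which exceeds \<open>u\<close>. So \<open>i\<close> is an end, and \<open>irrep_dim_ge_corner\<close> bounds the
other entries by a multiple of \<open>u\<close>. The height is then determined by \<open>k i\<close> up to a multiple of \<open>u\<close>.
\<close>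

lemma high_label_near_corner:
  assumes k: "k \<in> high_labels r M" and Sd: "S * label_dim r k \<le> u"
    and M: "h * M \<ge> 1" "M \<ge> real r ^ 3" and u_big: "u ^ (2 * r) > u * real r ^ (3 * (r + 1))"
  obtains i where "i \<in> {1, r}" "real (k i) \<ge> M - (real r)\<^sup>2 * side_bound r * u" "real (k i) \<le> fact r * u / h"
    "\<And>j. j \<in> {1..r} \<Longrightarrow> j \<noteq> i \<Longrightarrow> real (k j) \<le> side_bound r * u"
proof -
  have kU: "k \<in> irrep_labels r" using k by (simp add: high_labels_def)
  have r0: "real r > 0" using r by simp
  have M0: "M > 0" using M r0 by (meson less_le_trans zero_less_power)
  obtain i where i: "i \<in> {1..r}" "real (k i) \<ge> M / (real r)\<^sup>2"
    using high_label_large_entry[OF k M0] r by (metis one_le_numeral order_trans)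
  have "real (k i) \<ge> real r ^ 3 / (real r)\<^sup>2" using i(2) divide_right_mono[OF M(2), of "(real r)\<^sup>2"] by simp
  hence kr: "k i \<ge> r" using r0 by (simp add: power3_eq_cube power2_eq_square)
  have hk: "h * real (k i) \<ge> 1 / (real r)\<^sup>2"
  proof -
    have "1 / (real r)\<^sup>2 \<le> h * M / (real r)\<^sup>2" using M(1) by (intro divide_right_mono) auto
    also have "\<dots> = h * (M / (real r)\<^sup>2)" by simp
    also have "\<dots> \<le> h * real (k i)" using i(2) h_pos by (intro mult_left_mono) auto
    finally show ?thesis .
  qed
  have corner: "i \<in> {1, r}"
  proof (rule ccontr)
    assume "i \<notin> {1, r}"
    hence N: "r + 1 \<le> i * (r + 1 - i)" by (rule root_pair_count_interior[OF i(1)])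
    have "1 / (h * real r ^ (3 * (r + 1))) = S * (1 / (h * real r ^ 3)) ^ (r + 1)"
      using h_pos by (simp add: scaled_S_def power_divide power_mult_distrib field_simps)
        (simp add: power_add mult.commute flip: power_mult)
    also have "\<dots> \<le> S * (real (k i) / real r) ^ (r + 1)"
    proof (intro mult_left_mono power_mono)
      have "1 / (h * real r ^ 3) = (1 / (real r)\<^sup>2) / (h * real r)" by (simp add: power3_eq_cube power2_eq_square)
      also have "\<dots> \<le> (h * real (k i)) / (h * real r)" using hk h_pos by (intro divide_right_mono) auto
      finally show "1 / (h * real r ^ 3) \<le> real (k i) / real r" using h_pos by simp
    qed (use S_pos h_pos in auto)
    also have "\<dots> \<le> S * irrep_dim r k"
      using S_pos by (intro mult_left_mono irrep_dim_ge_power[OF kU i(1) N kr]) auto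
    also have "\<dots> \<le> u" using Sd by (simp add: real_label_dim)
    finally have "1 / (h * real r ^ (3 * (r + 1))) \<le> u" .
    hence "u ^ (2 * r) \<le> u * real r ^ (3 * (r + 1))"
      using r0 by (simp add: scaled_h_def field_simps)
    thus False using u_big by simp
  qed
  have prod_le: "(h * real (k i)) ^ r / fact r * real (k j) \<le> u" if "j \<in> {1..r}" "j \<noteq> i" for j
  proof -
    have "(h * real (k i)) ^ r / fact r * real (k j) = S * (real (k i) ^ r / fact r * real (k j))"
      by (simp add: scaled_S_def power_mult_distrib)
    also have "\<dots> \<le> S * irrep_dim r k"
      using S_pos r that corner by (intro mult_left_mono irrep_dim_ge_corner kU) auto
    finally show ?thesis using Sd by (simp add: real_label_dim)
  qed
  have side: "real (k j) \<le> side_bound r * u" if j: "j \<in> {1..r}" "j \<noteq> i" for j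
  proof -
    have "(1 / (real r)\<^sup>2) ^ r / fact r * real (k j) \<le> (h * real (k i)) ^ r / fact r * real (k j)"
      using hk by (intro mult_right_mono divide_right_mono power_mono) auto
    also have "\<dots> \<le> u" by (rule prod_le[OF j])
    finally show ?thesis using r0 by (simp add: side_bound_def power_divide field_simps flip: power_mult)
  qed
  have upper: "real (k i) \<le> fact r * u / h"
  proof -
    obtain j where j: "j \<in> {1..r}" "j \<noteq> i" using r by (metis atLeastAtMost_iff numeral_le_one_iff one_le_numeral order_refl order_trans semiring_norm(69))
    have "(h * real (k i)) ^ r / fact r * 1 \<le> (h * real (k i)) ^ r / fact r * real (k j)"
      using label_ge_1[OF kU j(1)] h_pos by (intro mult_left_mono) auto
    hence "(h * real (k i)) ^ r \<le> fact r * u" using prod_le[OF j] by (simp add: field_simps)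
    also have "\<dots> \<le> (fact r * u) ^ r"
      using u r fact_ge_1[of r] by (intro self_le_power) (auto intro: order_trans[OF _ mult_mono[of 1 _ 1]])
    finally have "h * real (k i) \<le> fact r * u"
      using u r by (subst (asm) power_mono_iff) (auto intro!: mult_nonneg_nonneg less_imp_le[OF h_pos])
    thus ?thesis using h_pos by (simp add: field_simps)
  qed
  have lower: "real (k i) \<ge> M - (real r)\<^sup>2 * side_bound r * u"
  proof -
    have cnt: "i * (r + 1 - i) = r" using corner r by auto
    have "real r * M < (\<Sum>j=1..r. real (j * (r + 1 - j)) * (real (k j) - 1))"
      using k by (simp add: high_labels_def weight_height_eq)
    also have "\<dots> = real r * (real (k i) - 1) + (\<Sum>j\<in>{1..r} - {i}. real (j * (r + 1 - j)) * (real (k j) - 1))"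
      by (subst sum.remove[of _ i]) (use i(1) cnt in auto)
    also have "(\<Sum>j\<in>{1..r} - {i}. real (j * (r + 1 - j)) * (real (k j) - 1)) \<le> (\<Sum>j\<in>{1..r} - {i}. real (r\<^sup>2) * (side_bound r * u))"
    proof (intro sum_mono mult_mono)
      fix j assume j: "j \<in> {1..r} - {i}"
      show "real (j * (r + 1 - j)) \<le> real (r\<^sup>2)" using root_pair_count_le(1)[of j r] j by (simp only: of_nat_le_iff) auto
      show "real (k j) - 1 \<le> side_bound r * u" using side[of j] j by auto
      show "0 \<le> real (k j) - 1" using label_ge_1[OF kU, of j] j by auto
    qed auto
    also have "\<dots> \<le> real r * (real (r\<^sup>2) * (side_bound r * u))"
      using i(1) u by (simp add: side_bound_def mult_right_mono)
    also have "real r * (real (k i) - 1) \<le> real r * real (k i)" by (intro mult_left_mono) auto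
    finally have "real r * M < real r * (real (k i) + real (r\<^sup>2) * (side_bound r * u))" by (simp add: distrib_left)
    hence "M < real (k i) + real (r\<^sup>2) * (side_bound r * u)" using r0 by (simp only: mult_less_cancel_left_pos)
    thus ?thesis by (simp add: mult.assoc)
  qed
  show ?thesis by (rule that[OF corner lower upper side])
qed

lemma tail_nonneg: "label_tail r u \<ge> 0"
  using S_pos by (simp add: label_tail_def)

lemma tail_sum_le:
  assumes F: "finite F" "F \<subseteq> irrep_labels r" and big: "\<And>k. k \<in> F \<Longrightarrow> S * label_dim r k \<ge> u"
  shows "(\<Sum>k\<in>F. exp (- (S / 2) * label_dim r k)) \<le> label_tail r u"
proof -
  have "(\<Sum>k\<in>F. exp (- (S / 2) * label_dim r k)) \<le> (\<Sum>k\<in>F. exp (- u / 4) * exp (- (S / 4) * label_dim r k))"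
  proof (rule sum_mono)
    fix k assume "k \<in> F"
    thus "exp (- (S / 2) * label_dim r k) \<le> exp (- u / 4) * exp (- (S / 4) * label_dim r k)"
      using big[of k] by (simp flip: exp_add)
  qed
  also have "\<dots> = exp (- u / 4) * (\<Sum>k\<in>F. exp (- (S / 4) * label_dim r k))" by (simp add: sum_distrib_left)
  also have "\<dots> \<le> exp (- u / 4) * (real r / (S / 4)) ^ r"
    using r S_pos F by (intro mult_left_mono sum_exp_label_dim_le) auto
  finally show ?thesis by (simp add: label_tail_def mult.commute)
qed

lemma card_near_corner_le:
  assumes "i \<in> {1..r}" "A \<ge> 0" "B \<ge> 0"
  shows "finite {k \<in> irrep_labels r. real (k i) \<le> A \<and> (\<forall>j\<in>{1..r}. j \<noteq> i \<longrightarrow> real (k j) \<le> B)}" (is "finite ?X")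
    and "real (card {k \<in> irrep_labels r. real (k i) \<le> A \<and> (\<forall>j\<in>{1..r}. j \<noteq> i \<longrightarrow> real (k j) \<le> B)}) \<le> A * B ^ (r - 1)"
proof -
  define P where "P = (\<Pi>\<^sub>E j\<in>{1..r}. if j = i then {1..nat \<lfloor>A\<rfloor>} else {1..nat \<lfloor>B\<rfloor>})"
  have sub: "?X \<subseteq> P"
  proof
    fix k assume k: "k \<in> ?X"
    hence kU: "k \<in> irrep_labels r" by simp
    have "k j \<in> (if j = i then {1..nat \<lfloor>A\<rfloor>} else {1..nat \<lfloor>B\<rfloor>})" if j: "j \<in> {1..r}" for j
      using k j label_ge_1[OF kU j] by (auto simp: le_nat_floor)
    thus "k \<in> P" using kU by (simp add: P_def irrep_labels_def PiE_iff)
  qed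
  have fin: "finite P" unfolding P_def by (intro finite_PiE) auto
  show "finite ?X" using sub fin finite_subset by blast
  have "real (card ?X) \<le> real (card P)" using card_mono[OF fin sub] by simp
  also have "card P = (\<Prod>j\<in>{1..r}. if j = i then nat \<lfloor>A\<rfloor> else nat \<lfloor>B\<rfloor>)"
    unfolding P_def by (subst card_PiE) (auto intro!: prod.cong)
  also have "\<dots> = nat \<lfloor>A\<rfloor> * nat \<lfloor>B\<rfloor> ^ (r - 1)"
    by (subst prod.remove[of _ i]) (use assms in \<open>auto simp: prod_constant\<close>)
  also have "real \<dots> \<le> A * B ^ (r - 1)"
    unfolding of_nat_mult of_nat_power using assms by (intro mult_mono power_mono) (auto simp: of_nat_floor)
  finally show "real (card ?X) \<le> A * B ^ (r - 1)" .
qed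

text \<open>
Near a corner but not on it the dimension is at least \<open>2 * k i ^ r / r!\<close>, and the number of labels is
at most that of a box of sides \<open>r! * u / h\<close> (one) and \<open>side_bound r * u\<close> (the others).
\<close>

lemma noncorner_sum_le:
  assumes F: "finite F" "F \<subseteq> high_labels r M - corner_labels r" and Sd: "\<And>k. k \<in> F \<Longrightarrow> S * label_dim r k \<le> u"
    and M: "h * M \<ge> 1" "M \<ge> real r ^ 3" "M \<ge> (real r)\<^sup>2 * side_bound r * u" and u_big: "u ^ (2 * r) > u * real r ^ (3 * (r + 1))"
  shows "(\<Sum>k\<in>F. exp (- S * label_dim r k)) \<le>
     2 * (fact r * u / h * (side_bound r * u) ^ (r - 1)) * exp (- 2 * (h * (M - (real r)\<^sup>2 * side_bound r * u)) ^ r / fact r)"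
proof -
  define X where "X = (\<lambda>i. {k \<in> irrep_labels r. real (k i) \<le> fact r * u / h \<and> (\<forall>j\<in>{1..r}. j \<noteq> i \<longrightarrow> real (k j) \<le> side_bound r * u)})"
  define e where "e = exp (- 2 * (h * (M - (real r)\<^sup>2 * side_bound r * u)) ^ r / fact r)"
  have sb: "side_bound r \<ge> 0" by (simp add: side_bound_def)
  have main: "k \<in> X 1 \<union> X r \<and> exp (- S * label_dim r k) \<le> e" if k: "k \<in> F" for k
  proof -
    have kH: "k \<in> high_labels r M" and nc: "k \<notin> corner_labels r" using F k by auto
    hence kU: "k \<in> irrep_labels r" by (simp add: high_labels_def)
    obtain i where i: "i \<in> {1, r}" "real (k i) \<ge> M - (real r)\<^sup>2 * side_bound r * u" "real (k i) \<le> fact r * u / h"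
      "\<And>j. j \<in> {1..r} \<Longrightarrow> j \<noteq> i \<Longrightarrow> real (k j) \<le> side_bound r * u"
      using high_label_near_corner[OF kH Sd[OF k] M(1,2) u_big] by blast
    have i': "i \<in> {1..r}" using i(1) r by auto
    obtain j where j: "j \<in> {1..r}" "j \<noteq> i" "k j \<noteq> 1"
    proof -
      have "\<exists>j\<in>{1..r}. j \<noteq> i \<and> k j \<noteq> 1"
      proof (rule ccontr)
        assume "\<not> ?thesis"
        hence "k = corner_label r i (k i - 1)"
          using kU label_ge_1[OF kU i'] by (auto simp: fun_eq_iff corner_label_def irrep_labels_def PiE_iff extensional_def)
        thus False using nc i(1) unfolding corner_labels_def by blast
      qed
      thus ?thesis using that by blast
    qed
    have "k j \<ge> 2" using j label_ge_1[OF kU j(1)] by linarith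
    have "2 * (h * (M - (real r)\<^sup>2 * side_bound r * u)) ^ r / fact r \<le> 2 * (h * real (k i)) ^ r / fact r"
      using i(2) M(3) h_pos by (intro divide_right_mono mult_left_mono power_mono) auto
    also have "\<dots> = S * (real (k i) ^ r / fact r * 2)" by (simp add: scaled_S_def power_mult_distrib)
    also have "\<dots> \<le> S * (real (k i) ^ r / fact r * real (k j))"
      using S_pos \<open>k j \<ge> 2\<close> by (intro mult_left_mono) auto
    also have "\<dots> \<le> S * irrep_dim r k"
      using S_pos r j i(1) by (intro mult_left_mono irrep_dim_ge_corner kU) auto
    finally have "exp (- S * label_dim r k) \<le> e" by (simp add: e_def real_label_dim)
    thus ?thesis using i kU by (auto simp: X_def)
  qed
  have card: "finite (X i)" "real (card (X i)) \<le> fact r * u / h * (side_bound r * u) ^ (r - 1)" if "i \<in> {1, r}" for i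
    unfolding X_def using that r u h_pos sb by (intro card_near_corner_le; auto)+
  have "(\<Sum>k\<in>F. exp (- S * label_dim r k)) \<le> (\<Sum>k\<in>F. e)" using main by (intro sum_mono) auto
  also have "\<dots> = real (card F) * e" by simp
  also have "\<dots> \<le> (2 * (fact r * u / h * (side_bound r * u) ^ (r - 1))) * e"
  proof (rule mult_right_mono)
    have "card F \<le> card (X 1 \<union> X r)" using main card by (intro card_mono) auto
    also have "\<dots> \<le> card (X 1) + card (X r)" by (rule card_Un_le)
    finally have "real (card F) \<le> real (card (X 1)) + real (card (X r))" by linarith
    thus "real (card F) \<le> 2 * (fact r * u / h * (side_bound r * u) ^ (r - 1))"
      using card(2)[of 1] card(2)[of r] by simp
  qed (simp add: e_def)
  finally show ?thesis by (simp add: e_def)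
qed

end

section \<open>Comparison of the corner sums with an integral\<close>

lemma binomial_power_bounds:
  "real m ^ r / fact r \<le> real ((m + r) choose r)"
  "real ((m + r) choose r) \<le> real (m + r) ^ r / fact r"
proof -
  have e: "real ((m + r) choose r) = (\<Prod>d=1..r. real (m + d)) / fact r"
    by (simp add: binomial_eq_prod prod_dividef fact_prod)
  have "real m ^ r \<le> (\<Prod>d=1..r. real (m + d))"
    using prod_mono[of "{1..r}" "\<lambda>_. real m" "\<lambda>d. real (m + d)"] by simp
  moreover have "(\<Prod>d=1..r. real (m + d)) \<le> real (m + r) ^ r"
    using prod_mono[of "{1..r}" "\<lambda>d. real (m + d)" "\<lambda>_. real (m + r)"] by simp
  ultimately show "real m ^ r / fact r \<le> real ((m + r) choose r)"
    "real ((m + r) choose r) \<le> real (m + r) ^ r / fact r"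
    unfolding e by (auto intro: divide_right_mono)
qed

text \<open>
For a corner label of size \<open>m\<close> the weight \<open>exp (- S * dim)\<close> lies between the values of this function
at \<open>m + r\<close> and at \<open>m\<close>.
\<close>

definition power_exp :: "nat \<Rightarrow> real \<Rightarrow> real \<Rightarrow> real" where
  "power_exp r h y = exp (- ((h * y) ^ r / fact r))"

text \<open>
The leading term of the integral of \<open>power_exp r h\<close> over \<open>{y..}\<close>: its negative derivative is
\<open>power_exp r h\<close> up to a factor that tends to 1.
\<close>

definition power_exp_tail :: "nat \<Rightarrow> real \<Rightarrow> real \<Rightarrow> real" where
  "power_exp_tail r h y = power_exp r h y * fact (r - 1) / (h * (h * y) ^ (r - 1))"

lemma power_exp_tail_deriv:
  assumes r: "r \<ge> 2" and h: "h > 0" and y: "y > 0"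
  shows "(power_exp_tail r h has_real_derivative
     - (power_exp r h y * (1 + real (r - 1) * fact (r - 1) / (h * y) ^ r))) (at y)"
proof -
  obtain s where s: "r = Suc (Suc s)" using r by (metis add_2_eq_Suc le_Suc_ex)
  have hy: "h * y > 0" using h y by simp
  have hy': "((\<lambda>y. h * y) has_real_derivative h) (at y)" by (auto intro!: derivative_eq_intros)
  have 1: "(power_exp r h has_real_derivative - (power_exp r h y * (h * (h * y) ^ Suc s / fact (Suc s)))) (at y)"
  proof -
    have "((\<lambda>y. (h * y) ^ Suc (Suc s) / fact (Suc (Suc s))) has_real_derivative
        (real (Suc (Suc s)) * (h * (h * y) ^ Suc s)) / fact (Suc (Suc s))) (at y)"
      using DERIV_power[OF hy', of "Suc (Suc s)"] by (intro DERIV_cdivide) (simp only: diff_Suc_Suc diff_zero)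
    also have "(real (Suc (Suc s)) * (h * (h * y) ^ Suc s)) / fact (Suc (Suc s)) = h * (h * y) ^ Suc s / fact (Suc s)"
      unfolding fact_Suc[of "Suc s"] by (rule mult_divide_mult_cancel_left) simp
    finally have "((\<lambda>y. - ((h * y) ^ Suc (Suc s) / fact (Suc (Suc s)))) has_real_derivative
        - (h * (h * y) ^ Suc s / fact (Suc s))) (at y)"
      by (rule DERIV_minus)
    from DERIV_chain2[OF DERIV_exp this] show ?thesis
      unfolding power_exp_def[abs_def] s by (simp only: mult_minus_right)
  qed
  have 2: "((\<lambda>y. fact (Suc s) / (h * (h * y) ^ Suc s)) has_real_derivative - (real (Suc s) * fact (Suc s) / (h * y) ^ Suc (Suc s))) (at y)"
  proof -
    have "((\<lambda>y. (h * y) ^ Suc s) has_real_derivative real (Suc s) * (h * (h * y) ^ s)) (at y)"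
      using DERIV_power[OF hy', of "Suc s"] by (simp only: diff_Suc_Suc diff_zero)
    from this have d: "((\<lambda>y. inverse ((h * y) ^ Suc s)) has_real_derivative
        - (inverse ((h * y) ^ Suc s) * (real (Suc s) * (h * (h * y) ^ s)) * inverse ((h * y) ^ Suc s))) (at y)"
      by (rule DERIV_inverse') (use h y in simp)
    have "((\<lambda>y. fact (Suc s) / h * inverse ((h * y) ^ Suc s)) has_real_derivative
       fact (Suc s) / h * - (inverse ((h * y) ^ Suc s) * (real (Suc s) * (h * (h * y) ^ s)) * inverse ((h * y) ^ Suc s))) (at y)"
      by (rule DERIV_cmult[OF d])
    moreover have "fact (Suc s) / h * - (inverse (X * p) * (real (Suc s) * (h * p)) * inverse (X * p))
        = - (real (Suc s) * fact (Suc s) / (X * (X * p)))" if "X > 0" "p > 0" for X p :: real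
      using that h by (simp add: divide_simps)
    hence "fact (Suc s) / h * - (inverse ((h * y) ^ Suc s) * (real (Suc s) * (h * (h * y) ^ s)) * inverse ((h * y) ^ Suc s))
        = - (real (Suc s) * fact (Suc s) / (h * y) ^ Suc (Suc s))"
      using hy unfolding power_Suc by (meson zero_less_power)
    moreover have "(\<lambda>y. fact (Suc s) / h * inverse ((h * y) ^ Suc s)) = (\<lambda>y. fact (Suc s) / (h * (h * y) ^ Suc s))"
      by (simp only: divide_inverse inverse_mult_distrib mult.assoc)
    ultimately show ?thesis by metis
  qed
  have "((\<lambda>y. power_exp r h y * (fact (Suc s) / (h * (h * y) ^ Suc s))) has_real_derivative
     - (power_exp r h y * (h * (h * y) ^ Suc s / fact (Suc s))) * (fact (Suc s) / (h * (h * y) ^ Suc s))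
     + - (real (Suc s) * fact (Suc s) / (h * y) ^ Suc (Suc s)) * power_exp r h y) (at y)"
    by (rule DERIV_mult[OF 1 2])
  moreover have "- (power_exp r h y * (h * (h * y) ^ Suc s / fact (Suc s))) * (fact (Suc s) / (h * (h * y) ^ Suc s))
     + - (real (Suc s) * fact (Suc s) / (h * y) ^ Suc (Suc s)) * power_exp r h y
     = - (power_exp r h y * (1 + real (r - 1) * fact (r - 1) / (h * y) ^ r))"
  proof -
    have c: "h * (h * y) ^ Suc s / fact (Suc s) * (fact (Suc s) / (h * (h * y) ^ Suc s)) = 1"
      using h hy y by simp
    have "- (power_exp r h y * (h * (h * y) ^ Suc s / fact (Suc s))) * (fact (Suc s) / (h * (h * y) ^ Suc s))
      = - (power_exp r h y * (h * (h * y) ^ Suc s / fact (Suc s) * (fact (Suc s) / (h * (h * y) ^ Suc s))))"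
      by (simp only: mult.assoc mult_minus_left)
    thus ?thesis unfolding c by (simp add: s distrib_left mult.commute)
  qed
  moreover have "(\<lambda>y. power_exp r h y * (fact (Suc s) / (h * (h * y) ^ Suc s))) = power_exp_tail r h"
    by (simp add: power_exp_tail_def fun_eq_iff s)
  ultimately show ?thesis by simp
qed

lemma power_exp_antimono:
  assumes "h > 0" "0 \<le> y" "y \<le> z"
  shows "power_exp r h z \<le> power_exp r h y"
  unfolding power_exp_def using assms by (auto intro!: divide_right_mono power_mono)

lemma power_exp_tail_nonneg: "h > 0 \<Longrightarrow> y \<ge> 0 \<Longrightarrow> power_exp_tail r h y \<ge> 0"
  by (simp add: power_exp_tail_def power_exp_def)

lemma power_exp_tail_antimono:
  assumes r: "r \<ge> 2" and h: "h > 0" and y: "0 < y" "y \<le> z"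
  shows "power_exp_tail r h z \<le> power_exp_tail r h y"
proof (rule DERIV_nonpos_imp_nonincreasing[OF y(2)])
  fix x assume "y \<le> x" "x \<le> z"
  hence "x > 0" using y by simp
  moreover have "power_exp r h x * (1 + real (r - 1) * fact (r - 1) / (h * x) ^ r) \<ge> 0"
    using h \<open>x > 0\<close> by (intro mult_nonneg_nonneg add_nonneg_nonneg) (auto simp: power_exp_def)
  ultimately show "\<exists>D. (power_exp_tail r h has_real_derivative D) (at x) \<and> D \<le> 0"
    using power_exp_tail_deriv[OF r h] by (intro exI conjI) auto
qed

text \<open>
By the mean value theorem the decrease over a unit step is sandwiched by values of \<open>power_exp\<close>. Sums
of \<open>power_exp\<close> are then estimated by telescoping, without integrals.
\<close>

lemma power_exp_tail_step:
  assumes r: "r \<ge> 2" and h: "h > 0" and y: "y > 0"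
  shows "power_exp r h (y + 1) \<le> power_exp_tail r h y - power_exp_tail r h (y + 1)"
    and "power_exp_tail r h y - power_exp_tail r h (y + 1) \<le> (1 + real (r - 1) * fact (r - 1) / (h * y) ^ r) * power_exp r h y"
proof -
  obtain z where z: "y < z" "z < y + 1" and
    eq: "power_exp_tail r h (y + 1) - power_exp_tail r h y =
      (y + 1 - y) * - (power_exp r h z * (1 + real (r - 1) * fact (r - 1) / (h * z) ^ r))"
    using MVT2[of y "y + 1" "power_exp_tail r h" "\<lambda>y. - (power_exp r h y * (1 + real (r - 1) * fact (r - 1) / (h * y) ^ r))"]
      power_exp_tail_deriv[OF r h] y by force
  let ?c = "\<lambda>z. real (r - 1) * fact (r - 1) / (h * z) ^ r"
  have eq': "power_exp_tail r h y - power_exp_tail r h (y + 1) = power_exp r h z * (1 + ?c z)"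
    using eq by simp
  have c: "?c z \<ge> 0" using h y z by simp
  have pz: "power_exp r h z \<ge> 0" by (simp add: power_exp_def)
  have "power_exp r h (y + 1) \<le> power_exp r h z * 1"
    using power_exp_antimono[OF h, of z "y + 1" r] y z by simp
  also have "\<dots> \<le> power_exp r h z * (1 + ?c z)" using c pz by (intro mult_left_mono) auto
  finally show "power_exp r h (y + 1) \<le> power_exp_tail r h y - power_exp_tail r h (y + 1)" by (simp add: eq')
  have "power_exp r h z * (1 + ?c z) \<le> power_exp r h y * (1 + ?c y)"
  proof (intro mult_mono add_mono divide_left_mono power_mono)
    show "power_exp r h z \<le> power_exp r h y" using power_exp_antimono[OF h, of y z r] y z by simp
  qed (use h y z c in \<open>auto simp: power_exp_def\<close>)
  thus "power_exp_tail r h y - power_exp_tail r h (y + 1) \<le> (1 + ?c y) * power_exp r h y"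
    by (simp add: eq' mult.commute)
qed

lemma sum_power_exp_le:
  assumes r: "r \<ge> 2" and h: "h > 0" and M: "M > 1" and F: "finite F" "\<And>m. m \<in> F \<Longrightarrow> real m > M"
  shows "(\<Sum>m\<in>F. power_exp r h (real m)) \<le> power_exp_tail r h (M - 1)"
proof -
  define m0 where "m0 = nat \<lfloor>M\<rfloor>"
  have m0: "real m0 \<le> M" "real m0 > M - 1" "m0 \<ge> 1" unfolding m0_def using M by linarith+
  define N where "N = Suc (Max (insert m0 F))"
  have sub: "F \<subseteq> Suc ` {m0..<N}"
  proof
    fix m assume m: "m \<in> F"
    have "m \<le> Max (insert m0 F)" using F m by (intro Max_ge) auto
    moreover have "m > m0" using F(2)[OF m] m0 by linarith
    ultimately show "m \<in> Suc ` {m0..<N}" unfolding image_Suc_atLeastLessThan N_def by auto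
  qed
  have "m0 \<le> N" unfolding N_def using F by (meson Max_ge finite.insertI insertI1 le_SucI)
  have "(\<Sum>m\<in>F. power_exp r h (real m)) \<le> (\<Sum>m\<in>Suc ` {m0..<N}. power_exp r h (real m))"
    using sub by (intro sum_mono2) (auto simp: power_exp_def)
  also have "\<dots> = (\<Sum>m=m0..<N. power_exp r h (real m + 1))"
    by (subst sum.reindex) (auto simp: add.commute)
  also have "\<dots> \<le> (\<Sum>m=m0..<N. power_exp_tail r h (real m) - power_exp_tail r h (real m + 1))"
    using m0 by (intro sum_mono power_exp_tail_step r h) auto
  also have "\<dots> = (\<Sum>m=m0..<N. - (power_exp_tail r h (real (Suc m)) - power_exp_tail r h (real m)))"
    by (simp add: add.commute)
  also have "\<dots> = power_exp_tail r h (real m0) - power_exp_tail r h (real N)"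
    unfolding sum_negf by (subst sum_Suc_diff'[OF \<open>m0 \<le> N\<close>]) simp
  also have "\<dots> \<le> power_exp_tail r h (real m0)" using power_exp_tail_nonneg[OF h] by simp
  also have "\<dots> \<le> power_exp_tail r h (M - 1)" using m0 M by (intro power_exp_tail_antimono r h) auto
  finally show ?thesis .
qed

lemma sum_power_exp_ge:
  assumes r: "r \<ge> 2" and h: "h > 0" and m0: "m0 \<ge> 1" "m0 \<le> N"
  shows "(1 + real (r - 1) * fact (r - 1) / (h * real m0) ^ r) * (\<Sum>m=m0..<N. power_exp r h (real m))
    \<ge> power_exp_tail r h (real m0) - power_exp_tail r h (real N)"
proof -
  let ?c = "\<lambda>m. 1 + real (r - 1) * fact (r - 1) / (h * m) ^ r"
  have "power_exp_tail r h (real m0) - power_exp_tail r h (real N) =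
      (\<Sum>m=m0..<N. - (power_exp_tail r h (real (Suc m)) - power_exp_tail r h (real m)))"
    unfolding sum_negf by (subst sum_Suc_diff'[OF m0(2)]) simp
  also have "\<dots> = (\<Sum>m=m0..<N. power_exp_tail r h (real m) - power_exp_tail r h (real m + 1))"
    by (simp add: add.commute)
  also have "\<dots> \<le> (\<Sum>m=m0..<N. ?c (real m0) * power_exp r h (real m))"
  proof (rule sum_mono)
    fix m assume m: "m \<in> {m0..<N}"
    have "power_exp_tail r h (real m) - power_exp_tail r h (real m + 1) \<le> ?c (real m) * power_exp r h (real m)"
      using m m0 by (intro power_exp_tail_step(2) r h) auto
    also have "\<dots> \<le> ?c (real m0) * power_exp r h (real m)"
      using m m0 h by (intro mult_right_mono add_mono divide_left_mono power_mono mult_left_mono) (auto simp: power_exp_def)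
    finally show "power_exp_tail r h (real m) - power_exp_tail r h (real m + 1) \<le> ?c (real m0) * power_exp r h (real m)" .
  qed
  finally show ?thesis by (simp add: sum_distrib_left)
qed

lemma power_exp_tail_tendsto_0:
  assumes r: "r \<ge> 2" and h: "h > 0"
  shows "(\<lambda>N. power_exp_tail r h (real N)) \<longlonglongrightarrow> 0"
proof (rule tendsto_sandwich[OF _ _ tendsto_const])
  show "eventually (\<lambda>N. power_exp_tail r h (real N) \<ge> 0) sequentially"
    using power_exp_tail_nonneg[OF h] by simp
  have hN: "filterlim (\<lambda>N. h * real N) at_top sequentially"
    by (rule filterlim_tendsto_pos_mult_at_top[OF tendsto_const h filterlim_real_sequentially])
  show "eventually (\<lambda>N. power_exp_tail r h (real N) \<le> fact (r - 1) / h * (1 / (h * real N))) sequentially"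
    using filterlim_at_top[THEN iffD1, rule_format, OF hN, of 1]
  proof eventually_elim
    case (elim N)
    have "power_exp_tail r h (real N) \<le> 1 * fact (r - 1) / (h * (h * real N))"
      unfolding power_exp_tail_def
    proof (intro frac_le mult_right_mono mult_left_mono)
      show "power_exp r h (real N) \<le> 1" using h by (simp add: power_exp_def)
      show "h * real N \<le> (h * real N) ^ (r - 1)" using elim r by (intro self_le_power) auto
    qed (use elim h in auto)
    thus ?case by simp
  qed
  have "(\<lambda>N. fact (r - 1) / h * (1 / (h * real N))) \<longlonglongrightarrow> fact (r - 1) / h * 0"
    using hN by (intro tendsto_intros tendsto_divide_0[OF tendsto_const] filterlim_at_top_imp_at_infinity)
  thus "(\<lambda>N. fact (r - 1) / h * (1 / (h * real N))) \<longlonglongrightarrow> 0" by simp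
qed

section \<open>The Gumbel normalisation\<close>

lemma one_plus_power_approx:
  fixes \<delta> :: real
  assumes "\<bar>\<delta>\<bar> \<le> 1"
  shows "\<bar>(1 + \<delta>) ^ n - 1 - real n * \<delta>\<bar> \<le> 4 ^ n * \<delta>\<^sup>2"
proof (induction n)
  case (Suc n)
  have "(1 + \<delta>) ^ Suc n - 1 - real (Suc n) * \<delta> = (1 + \<delta>) * ((1 + \<delta>) ^ n - 1 - real n * \<delta>) + real n * \<delta>\<^sup>2"
    by (simp add: algebra_simps power2_eq_square)
  also have "\<bar>\<dots>\<bar> \<le> \<bar>1 + \<delta>\<bar> * \<bar>(1 + \<delta>) ^ n - 1 - real n * \<delta>\<bar> + real n * \<delta>\<^sup>2"
    by (rule order_trans[OF abs_triangle_ineq]) (simp add: abs_mult)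
  also have "\<dots> \<le> 2 * (4 ^ n * \<delta>\<^sup>2) + 2 * 4 ^ n * \<delta>\<^sup>2"
  proof (intro add_mono mult_mono Suc)
    have "real n < 2 ^ n" by (rule of_nat_less_two_power)
    moreover have "(2::real) ^ n \<le> 4 ^ n" by (intro power_mono) auto
    moreover have "(0::real) \<le> 4 ^ n" by simp
    ultimately show "real n \<le> 2 * 4 ^ n" by linarith
  qed (use assms in auto)
  finally show ?case by (simp add: mult_ac)
qed simp

text \<open>
Here \<open>v\<close> stands for the scaled cutoff and \<open>w\<close> for a perturbation of \<open>x\<close>. Since \<open>\<delta>\<close> is of
order \<open>ln \<alpha> / \<alpha>\<close>, only the linear term of \<open>(1 + \<delta>) ^ r\<close> matters in \<open>v ^ r = \<alpha> * (1 + \<delta>) ^ r\<close>. It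
produces \<open>x\<close>, and a multiple of \<open>ln \<alpha>\<close> that compensates the denominator \<open>v ^ (r - 1)\<close>.
\<close>

lemma gumbel_scaling:
  fixes \<alpha> w :: "'a \<Rightarrow> real" and x :: real
  assumes r: "r \<ge> 2" and \<alpha>: "filterlim \<alpha> at_top F" and w: "(w \<longlongrightarrow> 0) F"
  defines "\<delta> \<equiv> \<lambda>u. fact (r - 1) * (x + w u - (real r - 1) / real r * ln (\<alpha> u)) / \<alpha> u"
  defines "v \<equiv> \<lambda>u. \<alpha> u powr (1 / real r) * (1 + \<delta> u)"
  shows "((\<lambda>u. v u ^ r / \<alpha> u) \<longlongrightarrow> 1) F" "eventually (\<lambda>u. v u > 0) F"
    "filterlim v at_top F"
    "((\<lambda>u. exp (\<alpha> u / fact r - v u ^ r / fact r) / v u ^ (r - 1)) \<longlongrightarrow> exp (- x)) F"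
proof -
  define \<kappa> where "\<kappa> = (real r - 1) / real r"
  have ln_sqrt: "((\<lambda>u. ln (\<alpha> u) / sqrt (\<alpha> u)) \<longlongrightarrow> 0) F"
    by (rule filterlim_compose[OF _ \<alpha>]) real_asymp
  have inv_sqrt: "((\<lambda>u. 1 / sqrt (\<alpha> u)) \<longlongrightarrow> 0) F"
    by (rule filterlim_compose[OF _ \<alpha>]) real_asymp
  have pos: "eventually (\<lambda>u. \<alpha> u > 0) F" using \<alpha> by (simp add: filterlim_at_top_dense)
  have "((\<lambda>u. fact (r - 1) * ((x + w u) * (1 / sqrt (\<alpha> u)) - \<kappa> * (ln (\<alpha> u) / sqrt (\<alpha> u)))) \<longlongrightarrow> fact (r - 1) * ((x + 0) * 0 - \<kappa> * 0)) F"
    by (intro tendsto_intros w ln_sqrt inv_sqrt)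
  hence d': "((\<lambda>u. fact (r - 1) * ((x + w u) * (1 / sqrt (\<alpha> u)) - \<kappa> * (ln (\<alpha> u) / sqrt (\<alpha> u)))) \<longlongrightarrow> 0) F" by simp
  have \<delta>s: "((\<lambda>u. sqrt (\<alpha> u) * \<delta> u) \<longlongrightarrow> 0) F"
  proof (rule Lim_transform_eventually[OF d'])
    show "eventually (\<lambda>u. fact (r - 1) * ((x + w u) * (1 / sqrt (\<alpha> u)) - \<kappa> * (ln (\<alpha> u) / sqrt (\<alpha> u))) = sqrt (\<alpha> u) * \<delta> u) F"
      using pos
    proof eventually_elim
      case (elim u)
      have "\<delta> u = fact (r - 1) * (x + w u - \<kappa> * ln (\<alpha> u)) / (sqrt (\<alpha> u) * sqrt (\<alpha> u))"
        using elim by (simp add: \<delta>_def \<kappa>_def)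
      thus ?case using elim by (simp add: divide_simps) (simp add: algebra_simps)
    qed
  qed
  have "((\<lambda>u. 1 / sqrt (\<alpha> u) * (sqrt (\<alpha> u) * \<delta> u)) \<longlongrightarrow> 0 * 0) F" by (intro tendsto_mult inv_sqrt \<delta>s)
  hence "((\<lambda>u. 1 / sqrt (\<alpha> u) * (sqrt (\<alpha> u) * \<delta> u)) \<longlongrightarrow> 0) F" by (simp only: mult_zero_left)
  hence \<delta>0: "(\<delta> \<longlongrightarrow> 0) F"
    by (rule Lim_transform_eventually) (use pos in eventually_elim, simp)
  have "((\<lambda>u. (sqrt (\<alpha> u) * \<delta> u) ^ 2) \<longlongrightarrow> 0 ^ 2) F" by (intro tendsto_intros \<delta>s)
  hence "((\<lambda>u. (sqrt (\<alpha> u) * \<delta> u) ^ 2) \<longlongrightarrow> 0) F" by (simp only: zero_power2)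
  hence \<alpha>\<delta>2: "((\<lambda>u. \<alpha> u * (\<delta> u)\<^sup>2) \<longlongrightarrow> 0) F"
    by (rule Lim_transform_eventually) (use pos in eventually_elim, simp add: power_mult_distrib)
  have vr: "eventually (\<lambda>u. v u ^ r = \<alpha> u * (1 + \<delta> u) ^ r) F"
    using pos
  proof eventually_elim
    case (elim u)
    have "(\<alpha> u powr (1 / real r)) ^ r = \<alpha> u" using elim r by (simp add: powr_power)
    thus ?case by (simp add: v_def power_mult_distrib)
  qed
  have d1: "((\<lambda>u. (1 + \<delta> u) ^ n) \<longlongrightarrow> 1) F" for n
  proof -
    have "((\<lambda>u. (1 + \<delta> u) ^ n) \<longlongrightarrow> (1 + 0) ^ n) F" by (intro tendsto_intros \<delta>0)
    thus ?thesis by simp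
  qed
  show 1: "((\<lambda>u. v u ^ r / \<alpha> u) \<longlongrightarrow> 1) F"
    by (rule Lim_transform_eventually[OF d1[of r]]) (use pos vr in eventually_elim, simp)
  have \<delta>1: "eventually (\<lambda>u. \<bar>\<delta> u\<bar> < 1 / 2) F"
    using tendsto_rabs_zero[OF \<delta>0] by (rule order_tendstoD) auto
  show vpos: "eventually (\<lambda>u. v u > 0) F" using pos \<delta>1 by eventually_elim (auto simp: v_def)
  have "filterlim (\<lambda>u. \<alpha> u powr (1 / real r)) at_top F"
    by (rule filterlim_compose[OF real_powr_at_top \<alpha>]) (use r in auto)
  moreover have "((\<lambda>u. 1 + \<delta> u) \<longlongrightarrow> 1) F" using d1[of 1] by simp
  ultimately show "filterlim v at_top F" unfolding v_def
    by (subst mult.commute) (rule filterlim_tendsto_pos_mult_at_top, auto)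
  define \<rho> where "\<rho> = (\<lambda>u. (1 + \<delta> u) ^ r - 1 - real r * \<delta> u)"
  have "((\<lambda>u. \<alpha> u * \<rho> u) \<longlongrightarrow> 0) F"
  proof (rule Lim_null_comparison)
    show "eventually (\<lambda>u. norm (\<alpha> u * \<rho> u) \<le> 4 ^ r * (\<alpha> u * (\<delta> u)\<^sup>2)) F"
      using pos \<delta>1
    proof eventually_elim
      case (elim u)
      have "\<bar>\<rho> u\<bar> \<le> 4 ^ r * (\<delta> u)\<^sup>2" unfolding \<rho>_def using elim by (intro one_plus_power_approx) auto
      hence "\<alpha> u * \<bar>\<rho> u\<bar> \<le> \<alpha> u * (4 ^ r * (\<delta> u)\<^sup>2)" using elim by (intro mult_left_mono) auto
      thus ?case using elim by (simp add: abs_mult mult_ac)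
    qed
    have "((\<lambda>u. 4 ^ r * (\<alpha> u * (\<delta> u)\<^sup>2)) \<longlongrightarrow> 4 ^ r * 0) F" by (intro tendsto_intros \<alpha>\<delta>2)
    thus "((\<lambda>u. 4 ^ r * (\<alpha> u * (\<delta> u)\<^sup>2)) \<longlongrightarrow> 0) F" by simp
  qed
  hence "((\<lambda>u. exp (- w u - \<alpha> u * \<rho> u / fact r - x) / (1 + \<delta> u) ^ (r - 1)) \<longlongrightarrow> exp (- 0 - 0 / fact r - x) / 1) F"
    by (intro tendsto_intros w d1) auto
  hence lim: "((\<lambda>u. exp (- w u - \<alpha> u * \<rho> u / fact r - x) / (1 + \<delta> u) ^ (r - 1)) \<longlongrightarrow> exp (- x)) F" by simp
  show "((\<lambda>u. exp (\<alpha> u / fact r - v u ^ r / fact r) / v u ^ (r - 1)) \<longlongrightarrow> exp (- x)) F"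
  proof (rule Lim_transform_eventually[OF lim])
    show "eventually (\<lambda>u. exp (- w u - \<alpha> u * \<rho> u / fact r - x) / (1 + \<delta> u) ^ (r - 1)
        = exp (\<alpha> u / fact r - v u ^ r / fact r) / v u ^ (r - 1)) F"
      using pos vr
    proof eventually_elim
      case (elim u)
      have fr: "fact r = real r * fact (r - 1)" using r by (simp add: fact_reduce)
      have "\<alpha> u * (real r * \<delta> u) / fact r = x + w u - \<kappa> * ln (\<alpha> u)"
        using elim r unfolding fr \<delta>_def \<kappa>_def[symmetric] by simp
      moreover have "v u ^ r / fact r = \<alpha> u / fact r + \<alpha> u * (real r * \<delta> u) / fact r + \<alpha> u * \<rho> u / fact r"
        unfolding elim(2) \<rho>_def by (simp add: algebra_simps add_divide_distrib diff_divide_distrib)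
      ultimately have "\<alpha> u / fact r - v u ^ r / fact r = (- w u - \<alpha> u * \<rho> u / fact r - x) + \<kappa> * ln (\<alpha> u)" by simp
      moreover have "exp (\<kappa> * ln (\<alpha> u)) = \<alpha> u powr \<kappa>" using elim by (simp add: powr_def)
      moreover have "v u ^ (r - 1) = \<alpha> u powr \<kappa> * (1 + \<delta> u) ^ (r - 1)"
        using elim r by (simp add: v_def power_mult_distrib powr_power \<kappa>_def of_nat_diff)
      ultimately show ?case using elim by (simp add: exp_add)
    qed
  qed
qed

text \<open>
The bound for \<open>2 * H / r\<close> that is equivalent to the event of the theorem.
\<close>

definition height_cutoff :: "nat \<Rightarrow> real \<Rightarrow> real \<Rightarrow> real \<Rightarrow> real" where
  "height_cutoff r x h \<alpha> = fact (r - 1) * (x + \<alpha> / fact (r - 1) - (real r - 1) / real r * ln \<alpha>)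
     / (h * \<alpha> powr ((real r - 1) / real r))"

definition scaled_alpha :: "nat \<Rightarrow> real \<Rightarrow> real" where
  "scaled_alpha r u = fact r * ln (2 * fact (r - 1) / scaled_h r u)"

definition scaled_cutoff :: "nat \<Rightarrow> real \<Rightarrow> real \<Rightarrow> real" where
  "scaled_cutoff r x u = height_cutoff r x (scaled_h r u) (scaled_alpha r u)"

lemma scaled_alpha_eq:
  assumes "u > 0"
  shows "scaled_alpha r u = fact r * (ln (2 * fact (r - 1)) + 2 * real r * ln u)"
  using assms by (simp add: scaled_alpha_def scaled_h_def ln_mult ln_realpow)

lemma scaled_alpha_at_top:
  assumes "r \<ge> 1"
  shows "filterlim (scaled_alpha r) at_top at_top"
proof -
  have "filterlim (\<lambda>u::real. fact r * (ln (2 * fact (r - 1)) + 2 * real r * ln u)) at_top at_top"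
    using assms by (intro filterlim_tendsto_pos_mult_at_top[OF tendsto_const] filterlim_tendsto_add_at_top[OF tendsto_const] ln_at_top) auto
  thus ?thesis
    by (rule filterlim_mono_eventually) (auto intro: eventually_mono[OF eventually_gt_at_top[of 0]] simp: scaled_alpha_eq)
qed

lemma scaled_h_alpha_tendsto_0:
  assumes r: "r \<ge> 2"
  shows "((\<lambda>u. scaled_h r u * scaled_alpha r u * u) \<longlongrightarrow> 0) at_top"
proof (rule tendsto_sandwich[OF _ _ tendsto_const])
  have 1: "eventually (\<lambda>u. scaled_alpha r u \<ge> 0) at_top"
    using scaled_alpha_at_top[of r] r by (auto simp: filterlim_at_top)
  show "eventually (\<lambda>u. scaled_h r u * scaled_alpha r u * u \<ge> 0) at_top"
    using 1 eventually_gt_at_top[of 0] by eventually_elim (simp add: scaled_h_def)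
  show "eventually (\<lambda>u. scaled_h r u * scaled_alpha r u * u \<le> fact r * (ln (2 * fact (r - 1)) + 2 * real r * ln u) / u) at_top"
    using 1 eventually_ge_at_top[of 1]
  proof eventually_elim
    case (elim u)
    have "u ^ 2 \<le> u ^ (2 * r)" using elim r by (intro power_increasing) auto
    hence "scaled_h r u * u \<le> 1 / u" using elim
      by (simp add: scaled_h_def divide_simps power2_eq_square)
    hence "scaled_h r u * u * scaled_alpha r u \<le> 1 / u * scaled_alpha r u"
      using elim by (intro mult_right_mono) auto
    thus ?case using elim by (simp add: scaled_alpha_eq mult_ac)
  qed
  have "((\<lambda>u::real. fact r * (C + 2 * real r * ln u) / u) \<longlongrightarrow> 0) at_top" for C :: real
    by real_asymp
  thus "((\<lambda>u::real. fact r * (ln (2 * fact (r - 1)) + 2 * real r * ln u) / u) \<longlongrightarrow> 0) at_top" .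
qed

text \<open>
Shifting the cutoff by a linear function of \<open>u\<close> does not change the asymptotics, because \<open>h * u\<close> times
any power of \<open>\<alpha>\<close> tends to 0. Constant shifts come from the comparison of sums with \<open>power_exp_tail\<close>,
the linear one from \<open>high_label_near_corner\<close>.
\<close>

lemma scaled_cutoff_asymptotics:
  fixes x c0 c1 :: real
  assumes r: "r \<ge> 2"
  defines "v \<equiv> \<lambda>u. scaled_h r u * (scaled_cutoff r x u + (c1 * u + c0))"
  shows "((\<lambda>u. v u ^ r / scaled_alpha r u) \<longlongrightarrow> 1) at_top" "eventually (\<lambda>u. v u > 0) at_top"
    "filterlim v at_top at_top"
    "((\<lambda>u. power_exp_tail r (scaled_h r u) (scaled_cutoff r x u + (c1 * u + c0))) \<longlongrightarrow> exp (- x) / 2) at_top"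
proof -
  define \<kappa> where "\<kappa> = (real r - 1) / real r"
  define h where "h = scaled_h r"
  define \<alpha> where "\<alpha> = scaled_alpha r"
  define w where "w = (\<lambda>u. (c1 * u + c0) * h u * \<alpha> u powr \<kappa> / fact (r - 1))"
  have \<kappa>: "0 \<le> \<kappa>" "\<kappa> \<le> 1" using r by (auto simp: \<kappa>_def)
  have \<alpha>_top: "filterlim \<alpha> at_top at_top" unfolding \<alpha>_def using scaled_alpha_at_top[of r] r by simp
  have \<alpha>1: "eventually (\<lambda>u. \<alpha> u \<ge> 1) at_top" using \<alpha>_top by (auto simp: filterlim_at_top)
  have w0: "(w \<longlongrightarrow> 0) at_top"
  proof (rule Lim_null_comparison)
    show "eventually (\<lambda>u. norm (w u) \<le> (\<bar>c1\<bar> + \<bar>c0\<bar>) * (h u * \<alpha> u * u)) at_top"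
      using \<alpha>1 eventually_ge_at_top[of 1]
    proof eventually_elim
      case (elim u)
      have h0: "h u > 0" using elim by (simp add: h_def scaled_h_def)
      have "\<alpha> u powr \<kappa> \<le> \<alpha> u powr 1" using \<kappa> elim by (intro powr_mono) auto
      hence p: "\<alpha> u powr \<kappa> \<le> \<alpha> u" using elim by simp
      have c: "\<bar>c1 * u + c0\<bar> \<le> (\<bar>c1\<bar> + \<bar>c0\<bar>) * u"
      proof -
        have "\<bar>c1 * u + c0\<bar> \<le> \<bar>c1\<bar> * u + \<bar>c0\<bar> * 1" using elim abs_triangle_ineq[of "c1 * u" c0] by (simp add: abs_mult)
        also have "\<dots> \<le> \<bar>c1\<bar> * u + \<bar>c0\<bar> * u" using elim by (intro add_left_mono mult_left_mono) auto
        finally show ?thesis by (simp add: distrib_right)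
      qed
      have "norm (w u) = \<bar>c1 * u + c0\<bar> * h u * \<alpha> u powr \<kappa> / fact (r - 1)" using h0 by (simp add: w_def abs_mult)
      also have "\<dots> \<le> \<bar>c1 * u + c0\<bar> * h u * \<alpha> u powr \<kappa> / 1"
        using h0 by (intro divide_left_mono) (auto simp: fact_ge_1)
      also have "\<dots> \<le> ((\<bar>c1\<bar> + \<bar>c0\<bar>) * u) * h u * \<alpha> u / 1"
        using c p h0 elim by (intro divide_right_mono mult_mono) auto
      finally show ?case by (simp add: mult_ac)
    qed
    have "((\<lambda>u. (\<bar>c1\<bar> + \<bar>c0\<bar>) * (h u * \<alpha> u * u)) \<longlongrightarrow> (\<bar>c1\<bar> + \<bar>c0\<bar>) * 0) at_top"
      unfolding h_def \<alpha>_def by (intro tendsto_intros scaled_h_alpha_tendsto_0[OF r])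
    thus "((\<lambda>u. (\<bar>c1\<bar> + \<bar>c0\<bar>) * (h u * \<alpha> u * u)) \<longlongrightarrow> 0) at_top" by simp
  qed
  define v' where "v' = (\<lambda>u. \<alpha> u powr (1 / real r) * (1 + fact (r - 1) * (x + w u - (real r - 1) / real r * ln (\<alpha> u)) / \<alpha> u))"
  have v'_app: "v' u = \<alpha> u powr (1 / real r) * (1 + fact (r - 1) * (x + w u - (real r - 1) / real r * ln (\<alpha> u)) / \<alpha> u)" for u
    by (simp add: v'_def)
  note gs = gumbel_scaling[OF r \<alpha>_top w0, of x, folded v'_app]
  have veq: "eventually (\<lambda>u. v u = v' u) at_top"
    using \<alpha>1 eventually_ge_at_top[of 1]
  proof eventually_elim
    case (elim u)
    have h0: "h u > 0" using elim by (simp add: h_def scaled_h_def)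
    have a0: "\<alpha> u > 0" using elim by simp
    define P where "P = \<alpha> u powr \<kappa>"
    have P0: "P > 0" using a0 by (simp add: P_def)
    have "1 / real r = 1 - \<kappa>" using r by (simp add: \<kappa>_def field_simps)
    hence "\<alpha> u powr (1 / real r) = \<alpha> u / P" using a0 by (simp add: P_def powr_diff)
    hence "v' u = \<alpha> u / P * (1 + fact (r - 1) * (x + w u - \<kappa> * ln (\<alpha> u)) / \<alpha> u)" by (simp add: v'_def \<kappa>_def)
    also have "\<dots> = (\<alpha> u + fact (r - 1) * (x + w u - \<kappa> * ln (\<alpha> u))) / P"
      using a0 P0 by (simp add: divide_simps)
    also have "\<dots> = (\<alpha> u + fact (r - 1) * (x - \<kappa> * ln (\<alpha> u))) / P + fact (r - 1) * w u / P"
      by (simp add: algebra_simps add_divide_distrib diff_divide_distrib)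
    also have "fact (r - 1) * w u / P = h u * (c1 * u + c0)" using P0 by (simp add: w_def P_def)
    also have "(\<alpha> u + fact (r - 1) * (x - \<kappa> * ln (\<alpha> u))) / P = h u * scaled_cutoff r x u"
      using h0 P0 unfolding scaled_cutoff_def height_cutoff_def h_def[symmetric] \<alpha>_def[symmetric] \<kappa>_def[symmetric] P_def[symmetric]
      by (simp add: divide_simps) (simp add: algebra_simps)
    finally show ?case by (simp add: v_def h_def distrib_left)
  qed
  show "((\<lambda>u. v u ^ r / scaled_alpha r u) \<longlongrightarrow> 1) at_top"
    by (rule Lim_transform_eventually[OF gs(1)]) (use veq in eventually_elim, simp flip: \<alpha>_def)
  show "eventually (\<lambda>u. v u > 0) at_top" using veq gs(2) by eventually_elim simp
  have lim: "((\<lambda>u. exp (\<alpha> u / fact r - v u ^ r / fact r) / v u ^ (r - 1)) \<longlongrightarrow> exp (- x)) at_top"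
    by (rule Lim_transform_eventually[OF gs(4)]) (use veq in eventually_elim, simp)
  show "filterlim v at_top at_top"
    by (rule filterlim_mono_eventually[OF gs(3)]) (use veq in \<open>auto elim: eventually_mono\<close>)
  show "((\<lambda>u. power_exp_tail r (scaled_h r u) (scaled_cutoff r x u + (c1 * u + c0))) \<longlongrightarrow> exp (- x) / 2) at_top"
  proof (rule Lim_transform_eventually[OF tendsto_divide[OF lim tendsto_const]])
    show "eventually (\<lambda>u. exp (\<alpha> u / fact r - v u ^ r / fact r) / v u ^ (r - 1) / 2 =
      power_exp_tail r (scaled_h r u) (scaled_cutoff r x u + (c1 * u + c0))) at_top"
      using eventually_ge_at_top[of 1]
    proof eventually_elim
      case (elim u)
      have h0: "h u > 0" using elim by (simp add: h_def scaled_h_def)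
      have "\<alpha> u / fact r = ln (2 * fact (r - 1) / h u)" by (simp add: \<alpha>_def scaled_alpha_def h_def)
      hence "exp (\<alpha> u / fact r) = 2 * fact (r - 1) / h u" using h0 by simp
      hence "exp (\<alpha> u / fact r - v u ^ r / fact r) = exp (- (v u ^ r / fact r)) * (2 * fact (r - 1) / h u)"
        by (simp add: exp_diff exp_minus divide_inverse)
      thus ?case unfolding power_exp_tail_def power_exp_def h_def[symmetric] v_def by (simp add: h_def mult_ac)
    qed
  qed simp
qed

section \<open>The weight of the labels above the cutoff\<close>

lemma summable_exp_label_dim:
  fixes \<theta> :: real
  assumes "r \<ge> 1" "\<theta> > 0"
  shows "(\<lambda>k. exp (- \<theta> * label_dim r k)) summable_on irrep_labels r"
proof (rule nonneg_bdd_above_summable_on)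
  show "bdd_above (sum (\<lambda>k. exp (- \<theta> * label_dim r k)) ` {F. F \<subseteq> irrep_labels r \<and> finite F})"
    using sum_exp_label_dim_le[OF assms(1) _ _ assms(2)] by (intro bdd_aboveI2[where M = "(real r / \<theta>) ^ r"]) auto
qed auto

lemma label_tail_tendsto_0:
  "((\<lambda>u. label_tail r u * u ^ n) \<longlongrightarrow> 0) at_top"
proof -
  have "((\<lambda>u::real. u ^ m / exp (u / 4)) \<longlongrightarrow> 0) at_top" for m :: nat
  proof -
    have "filterlim (\<lambda>u::real. u / 4) at_top at_top"
      using filterlim_tendsto_pos_mult_at_top[OF tendsto_const[of "1/4::real"] _ filterlim_ident] by simp
    from filterlim_compose[OF tendsto_power_div_exp_0[of m] this]
    have "((\<lambda>u::real. 4 ^ m * ((u / 4) ^ m / exp (u / 4))) \<longlongrightarrow> 4 ^ m * 0) at_top" by (intro tendsto_intros)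
    thus ?thesis by (simp add: power_divide)
  qed
  hence "((\<lambda>u::real. (4 * real r) ^ r * (u ^ (2 * r * r * r + n) / exp (u / 4))) \<longlongrightarrow> (4 * real r) ^ r * 0) at_top"
    by (intro tendsto_intros)
  hence "((\<lambda>u::real. (4 * real r) ^ r * (u ^ (2 * r * r * r + n) / exp (u / 4))) \<longlongrightarrow> 0) at_top" by simp
  thus ?thesis
  proof (rule Lim_transform_eventually)
    show "eventually (\<lambda>u. (4 * real r) ^ r * (u ^ (2 * r * r * r + n) / exp (u / 4)) = label_tail r u * u ^ n) at_top"
      using eventually_gt_at_top[of 0]
    proof eventually_elim
      case (elim u)
      have "4 * real r / scaled_S r u = 4 * real r * u ^ (2 * r * r)"
        by (simp add: scaled_S_def scaled_h_def power_one_over power_mult)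
      moreover have "exp (- u / 4) = 1 / exp (u / 4)" by (simp add: exp_minus inverse_eq_divide)
      ultimately show ?case by (simp add: label_tail_def power_mult_distrib power_add power_mult)
    qed
  qed
qed

lemma corner_label_high_iff:
  assumes "r \<ge> 2" "i \<in> {1, r}"
  shows "corner_label r i m \<in> high_labels r M \<longleftrightarrow> real m > M"
proof -
  have i: "i \<in> {1..r}" and c: "i * (r + 1 - i) = r" using assms by auto
  have "(\<Sum>j=1..r. real (j * (r + 1 - j)) * (real (corner_label r i m j) - 1)) =
      (\<Sum>j=1..r. if j = i then real (i * (r + 1 - i)) * real m else 0)"
    by (intro sum.cong) (auto simp: corner_label_def)
  also have "\<dots> = real r * real m" using i c by (simp del: of_nat_mult)
  finally have "weight_height r (\<lambda>j. real (corner_label r i m j) - 1) = real r / 2 * real m"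
    by (simp add: weight_height_eq)
  thus ?thesis using assms by (simp add: high_labels_def corner_label_in_labels)
qed

lemma corner_label_inj:
  assumes "r \<ge> 2" "i \<in> {1, r}" "j \<in> {1, r}" "m > 0" "corner_label r i m = corner_label r j n"
  shows "i = j \<and> m = n"
proof -
  have "corner_label r i m i = corner_label r j n i" using assms by simp
  thus ?thesis using assms by (auto simp: corner_label_def split: if_splits)
qed

context scaling
begin

lemma corner_exp_bounds:
  assumes "i \<in> {1, r}"
  shows "exp (- S * label_dim r (corner_label r i m)) \<le> power_exp r h (real m)"
    "power_exp r h (real (m + r)) \<le> exp (- S * label_dim r (corner_label r i m))"
proof -
  have d: "label_dim r (corner_label r i m) = (m + r) choose r" using label_dim_corner[of r i m] r assms by simp
  have "S * (real m ^ r / fact r) \<le> S * real ((m + r) choose r)"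
    using S_pos by (intro mult_left_mono binomial_power_bounds) auto
  thus "exp (- S * label_dim r (corner_label r i m)) \<le> power_exp r h (real m)"
    unfolding d power_exp_def by (simp add: scaled_S_def power_mult_distrib)
  have "S * real ((m + r) choose r) \<le> S * (real (m + r) ^ r / fact r)"
    using S_pos by (intro mult_left_mono binomial_power_bounds) auto
  thus "power_exp r h (real (m + r)) \<le> exp (- S * label_dim r (corner_label r i m))"
    unfolding d power_exp_def by (simp add: scaled_S_def power_mult_distrib del: of_nat_add)
qed

definition noncorner_bound :: "real \<Rightarrow> real" where
  "noncorner_bound M = 2 * (fact r * u / h * (side_bound r * u) ^ (r - 1)) *
     exp (- 2 * (h * (M - (real r)\<^sup>2 * side_bound r * u)) ^ r / fact r)"

text \<open>
The high labels are split into the corner labels, the other labels with \<open>S * dim k \<le> u\<close>, and the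
rest.
\<close>

lemma high_sum_upper:
  assumes F: "finite F" "F \<subseteq> high_labels r M"
    and M: "h * M \<ge> 1" "M \<ge> real r ^ 3" "M \<ge> (real r)\<^sup>2 * side_bound r * u" and u_big: "u ^ (2 * r) > u * real r ^ (3 * (r + 1))"
  shows "(\<Sum>k\<in>F. exp (- S * label_dim r k)) \<le> 2 * power_exp_tail r h (M - 1) + noncorner_bound M + label_tail r u"
proof -
  let ?f = "\<lambda>k. exp (- S * label_dim r k)"
  have FU: "F \<subseteq> irrep_labels r" using F by (auto simp: high_labels_def)
  have "real r ^ 3 \<ge> 2 ^ 3" using r by (intro power_mono) auto
  hence M1: "M > 1" using M(2) by simp
  define A where "A = F \<inter> corner_labels r"
  define B where "B = {k \<in> F - corner_labels r. S * label_dim r k \<le> u}"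
  define C where "C = {k \<in> F - corner_labels r. S * label_dim r k > u}"
  have split: "F = A \<union> B \<union> C" "A \<inter> B = {}" "(A \<union> B) \<inter> C = {}" by (auto simp: A_def B_def C_def)
  have fin: "finite A" "finite B" "finite C" using F by (auto simp: A_def B_def C_def)
  define N where "N = (\<lambda>i. {m. corner_label r i m \<in> F})"
  have N: "finite (N i)" "\<And>m. m \<in> N i \<Longrightarrow> real m > M" if "i \<in> {1, r}" for i
  proof -
    show m: "real m > M" if "m \<in> N i" for m
      using that F corner_label_high_iff[OF r \<open>i \<in> {1, r}\<close>] by (auto simp: N_def)
    have "inj_on (corner_label r i) (N i)"
      using corner_label_inj[OF r \<open>i \<in> {1, r}\<close> \<open>i \<in> {1, r}\<close>] m M1 by (intro inj_onI) force
    moreover have "corner_label r i ` N i \<subseteq> F" by (auto simp: N_def)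
    ultimately show "finite (N i)" using F(1) by (meson finite_imageD finite_subset)
  qed
  have corner: "(\<Sum>k\<in>corner_label r i ` N i. ?f k) \<le> power_exp_tail r h (M - 1)" if i: "i \<in> {1, r}" for i
  proof -
    have "(\<Sum>k\<in>corner_label r i ` N i. ?f k) \<le> (\<Sum>m\<in>N i. ?f (corner_label r i m))"
      using sum_image_le[OF N(1)[OF i], of ?f "corner_label r i"] by (simp add: o_def)
    also have "\<dots> \<le> (\<Sum>m\<in>N i. power_exp r h (real m))" by (intro sum_mono corner_exp_bounds i)
    also have "\<dots> \<le> power_exp_tail r h (M - 1)" using N[OF i] by (intro sum_power_exp_le r h_pos M1) auto
    finally show ?thesis .
  qed
  have "A \<subseteq> corner_label r 1 ` N 1 \<union> corner_label r r ` N r" by (auto simp: A_def corner_labels_def N_def)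
  hence "sum ?f A \<le> sum ?f (corner_label r 1 ` N 1 \<union> corner_label r r ` N r)"
    using N(1)[of 1] N(1)[of r] by (intro sum_mono2) auto
  also have "\<dots> \<le> sum ?f (corner_label r 1 ` N 1) + sum ?f (corner_label r r ` N r)"
    using N(1)[of 1] N(1)[of r] by (subst sum_Un) (auto intro!: sum_nonneg)
  also have "\<dots> \<le> 2 * power_exp_tail r h (M - 1)" using corner[of 1] corner[of r] by simp
  finally have A: "sum ?f A \<le> 2 * power_exp_tail r h (M - 1)" .
  have B: "sum ?f B \<le> noncorner_bound M"
    unfolding noncorner_bound_def using F by (intro noncorner_sum_le fin M u_big) (auto simp: B_def)
  have "sum ?f C \<le> (\<Sum>k\<in>C. exp (- (S / 2) * label_dim r k))" using S_pos by (intro sum_mono) auto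
  also have "\<dots> \<le> label_tail r u" using FU by (intro tail_sum_le fin) (auto simp: C_def)
  finally have C: "sum ?f C \<le> label_tail r u" .
  have "sum ?f F = sum ?f A + sum ?f B + sum ?f C"
    using fin split by (simp add: sum.union_disjoint)
  thus ?thesis using A B C by linarith
qed

definition high_sum :: "real \<Rightarrow> real" where
  "high_sum M = (\<Sum>\<^sub>\<infinity>k\<in>high_labels r M. exp (- S * label_dim r k))"

lemma summable_high: "(\<lambda>k. exp (- S * label_dim r k)) summable_on high_labels r M"
  by (rule summable_on_subset_banach[OF summable_exp_label_dim[of r S]])
     (use r S_pos in \<open>auto simp: high_labels_def\<close>)

lemma high_sum_le:
  assumes M: "h * M \<ge> 1" "M \<ge> real r ^ 3" "M \<ge> (real r)\<^sup>2 * side_bound r * u" and u_big: "u ^ (2 * r) > u * real r ^ (3 * (r + 1))"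
  shows "high_sum M \<le> 2 * power_exp_tail r h (M - 1) + noncorner_bound M + label_tail r u"
  unfolding high_sum_def
  by (rule infsum_le_finite_sums[OF summable_high]) (rule high_sum_upper[OF _ _ assms], auto)

text \<open>
Only the corner labels are needed. The two families are disjoint as \<open>r \<ge> 2\<close> and \<open>m > 0\<close>.
\<close>

lemma high_sum_ge:
  assumes M: "M > 0"
  shows "high_sum M \<ge> 2 * power_exp_tail r h (M + real r + 1) / (1 + real (r - 1) * fact (r - 1) / (h * M) ^ r)"
proof -
  define m1 where "m1 = nat \<lfloor>M\<rfloor> + 1"
  define c where "c = 1 + real (r - 1) * fact (r - 1) / (h * M) ^ r"
  have c: "c > 0" unfolding c_def using h_pos M by (intro add_pos_nonneg) auto
  have m1: "real m1 > M" "real m1 \<le> M + 1" "m1 \<ge> 1" unfolding m1_def using M by linarith+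
  have bound: "2 * (power_exp_tail r h (M + real r + 1) - power_exp_tail r h (real N)) / c \<le> high_sum M" if N: "N \<ge> m1 + r" for N
  proof -
    define I where "I = {1, r} \<times> {m1..<N - r}"
    have inj: "inj_on (\<lambda>(i, m). corner_label r i m) I"
    proof (rule inj_onI, clarify)
      fix i m j n assume ij: "(i, m) \<in> I" "(j, n) \<in> I" and e: "corner_label r i m = corner_label r j n"
      show "i = j \<and> m = n" by (rule corner_label_inj[OF r _ _ _ e]) (use ij m1 in \<open>auto simp: I_def\<close>)
    qed
    have r1: "(1::nat) \<noteq> r" using r by simp
    have "power_exp_tail r h (M + real r + 1) - power_exp_tail r h (real N) \<le> power_exp_tail r h (real (m1 + r)) - power_exp_tail r h (real N)"
      using m1 M r by (intro diff_right_mono power_exp_tail_antimono h_pos) auto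
    also have "\<dots> \<le> (1 + real (r - 1) * fact (r - 1) / (h * real (m1 + r)) ^ r) * (\<Sum>m=m1 + r..<N. power_exp r h (real m))"
      using m1 N by (intro sum_power_exp_ge r h_pos) auto
    also have "\<dots> \<le> c * (\<Sum>m=m1 + r..<N. power_exp r h (real m))"
      unfolding c_def using m1 M h_pos
      by (intro mult_right_mono add_mono divide_left_mono power_mono mult_left_mono sum_nonneg) (auto simp: power_exp_def)
    also have "(\<Sum>m=m1 + r..<N. power_exp r h (real m)) = (\<Sum>m=m1..<N - r. power_exp r h (real (m + r)))"
      using sum.shift_bounds_nat_ivl[of "\<lambda>m. power_exp r h (real m)" m1 r "N - r"] N by simp
    finally have 1: "power_exp_tail r h (M + real r + 1) - power_exp_tail r h (real N) \<le> c * (\<Sum>m=m1..<N - r. power_exp r h (real (m + r)))" .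
    have "2 * (\<Sum>m=m1..<N - r. power_exp r h (real (m + r))) = (\<Sum>i\<in>{1, r}. \<Sum>m=m1..<N - r. power_exp r h (real (m + r)))"
      using r1 by simp
    also have "\<dots> \<le> (\<Sum>i\<in>{1, r}. \<Sum>m=m1..<N - r. exp (- S * label_dim r (corner_label r i m)))"
      by (intro sum_mono corner_exp_bounds) auto
    also have "\<dots> = (\<Sum>(i, m)\<in>I. exp (- S * label_dim r (corner_label r i m)))"
      unfolding I_def by (rule sum.cartesian_product)
    also have "\<dots> = (\<Sum>k\<in>(\<lambda>(i, m). corner_label r i m) ` I. exp (- S * label_dim r k))"
      by (subst sum.reindex[OF inj]) (simp add: case_prod_unfold o_def)
    also have "\<dots> \<le> high_sum M" unfolding high_sum_def
    proof (rule finite_sum_le_infsum[OF summable_high])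
      have "real m > M" if "m \<ge> m1" for m using that m1 by linarith
      thus "(\<lambda>(i, m). corner_label r i m) ` I \<subseteq> high_labels r M"
        using corner_label_high_iff[OF r] by (auto simp: I_def)
    qed (auto simp: I_def)
    finally have 2: "2 * (\<Sum>m=m1..<N - r. power_exp r h (real (m + r))) \<le> high_sum M" .
    have "2 * (power_exp_tail r h (M + real r + 1) - power_exp_tail r h (real N)) \<le> c * (2 * (\<Sum>m=m1..<N - r. power_exp r h (real (m + r))))"
      using 1 by simp
    also have "\<dots> \<le> c * high_sum M" using 2 c by (intro mult_left_mono) auto
    finally show ?thesis using c by (simp add: divide_le_eq mult.commute)
  qed
  have "(\<lambda>N. 2 * (power_exp_tail r h (M + real r + 1) - power_exp_tail r h (real N)) / c) \<longlonglongrightarrow> 2 * (power_exp_tail r h (M + real r + 1) - 0) / c"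
    using c by (intro tendsto_intros power_exp_tail_tendsto_0 r h_pos) auto
  from tendsto_upperbound[OF this _ trivial_limit_sequentially, of "high_sum M"]
  have "2 * (power_exp_tail r h (M + real r + 1) - 0) / c \<le> high_sum M"
    using bound by (auto simp: eventually_sequentially)
  thus ?thesis by (simp add: c_def)
qed

end

text \<open>
In the scaled variable the cutoff satisfies \<open>v ^ r / r! \<ge> (7 / 8) * ln (1 / h)\<close> eventually. The bound
is thus at most a constant times \<open>u ^ r / h * h powr (7 / 4)\<close>, and \<open>h = u ^ (- 2 * r)\<close>.
\<close>

lemma noncorner_bound_tendsto_0:
  assumes r: "r \<ge> 2"
  shows "((\<lambda>u. scaling.noncorner_bound r u (scaled_cutoff r x u)) \<longlongrightarrow> 0) at_top"
proof (rule Lim_null_comparison)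
  define C where "C = 2 * (fact r * side_bound r ^ (r - 1))"
  define c1 where "c1 = - ((real r)\<^sup>2 * side_bound r)"
  have C: "C \<ge> 0" by (simp add: C_def side_bound_def)
  note asy = scaled_cutoff_asymptotics[OF r, of x c1 0]
  have ratio: "eventually (\<lambda>u. (scaled_h r u * (scaled_cutoff r x u + (c1 * u + 0))) ^ r / scaled_alpha r u > 7 / 8) at_top"
    using asy(1) by (rule order_tendstoD) auto
  show "eventually (\<lambda>u. norm (scaling.noncorner_bound r u (scaled_cutoff r x u)) \<le> C * u powr (- real r / 2)) at_top"
    using ratio eventually_gt_at_top[of 1]
  proof eventually_elim
    case (elim u)
    interpret scaling r u using r elim by unfold_locales auto
    define v where "v = h * (scaled_cutoff r x u - (real r)\<^sup>2 * side_bound r * u)"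
    have veq: "v = h * (scaled_cutoff r x u + (c1 * u + 0))" by (simp add: v_def c1_def)
    have l2: "ln (2 * fact (r - 1) :: real) \<ge> 0" using fact_ge_1[of "r - 1", where 'a = real] by (intro ln_ge_zero) linarith
    have \<alpha>: "scaled_alpha r u \<ge> fact r * (2 * real r * ln u)"
      using elim l2 by (simp add: scaled_alpha_eq)
    moreover have "fact r * (2 * real r * ln u) > 0" using elim r by simp
    ultimately have \<alpha>0: "scaled_alpha r u > 0" by linarith
    have "v ^ r \<ge> 7 / 8 * scaled_alpha r u" using elim(1) \<alpha>0 unfolding veq[symmetric] by (simp add: field_simps)
    hence "v ^ r \<ge> 7 / 8 * (fact r * (2 * real r * ln u))" using \<alpha> by linarith
    hence "v ^ r / fact r \<ge> 7 / 8 * (fact r * (2 * real r * ln u)) / fact r" by (intro divide_right_mono) auto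
    moreover have "7 / 8 * (fact r * (2 * real r * ln u)) / fact r = 7 / 4 * (real r * ln u)" by simp
    moreover have "- 2 * v ^ r / fact r = - 2 * (v ^ r / fact r)" by simp
    ultimately have "- 2 * v ^ r / fact r \<le> - 7 / 2 * (real r * ln u)" by linarith
    hence e: "exp (- 2 * v ^ r / fact r) \<le> u powr (- 7 / 2 * real r)" using elim by (simp add: powr_def)
    have nn: "C * u ^ (3 * r) \<ge> 0" using C elim by simp
    have eq: "noncorner_bound (scaled_cutoff r x u) = C * u ^ (3 * r) * exp (- 2 * v ^ r / fact r)"
    proof -
      have "u * u ^ (2 * r) * u ^ (r - 1) = u ^ (3 * r)" using r by (simp flip: power_Suc power_add)
      thus ?thesis unfolding noncorner_bound_def v_def C_def
        by (simp add: scaled_h_def power_mult_distrib mult_ac)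
    qed
    have "noncorner_bound (scaled_cutoff r x u) \<ge> 0" unfolding eq using nn by (rule mult_nonneg_nonneg) simp
    hence "norm (noncorner_bound (scaled_cutoff r x u)) = C * u ^ (3 * r) * exp (- 2 * v ^ r / fact r)"
      by (simp only: real_norm_def abs_of_nonneg eq)
    also have "\<dots> \<le> C * u ^ (3 * r) * u powr (- 7 / 2 * real r)"
      using e nn by (rule mult_left_mono)
    also have "\<dots> = C * (u ^ (3 * r) * u powr (- 7 / 2 * real r))" by simp
    also have "u ^ (3 * r) * u powr (- 7 / 2 * real r) = u powr (- real r / 2)"
    proof -
      have "u ^ (3 * r) = u powr (3 * real r)" using elim by (simp flip: powr_realpow)
      thus ?thesis by (simp flip: powr_add add: field_simps)
    qed
    finally show ?case .
  qed
  have "((\<lambda>u. C * u powr (- real r / 2)) \<longlongrightarrow> C * 0) at_top"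
    using r by (intro tendsto_intros tendsto_neg_powr filterlim_ident) auto
  thus "((\<lambda>u. C * u powr (- real r / 2)) \<longlongrightarrow> 0) at_top" by simp
qed

lemma eventually_u_big:
  assumes r: "r \<ge> 2"
  shows "eventually (\<lambda>u::real. u ^ (2 * r) > u * C) at_top"
  using eventually_gt_at_top[of 1] eventually_gt_at_top[of C]
proof eventually_elim
  case (elim u)
  have "u * C < u * u" using elim by simp
  also have "\<dots> = u ^ 2" by (simp add: power2_eq_square)
  also have "\<dots> \<le> u ^ (2 * r)" using elim r by (intro power_increasing) auto
  finally show ?case .
qed

lemma eventually_cutoff_large:
  assumes r: "r \<ge> 2"
  shows "eventually (\<lambda>u. scaled_h r u * scaled_cutoff r x u \<ge> C \<and> scaled_cutoff r x u \<ge> C \<and>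
     scaled_cutoff r x u \<ge> C * u) at_top"
proof -
  have 1: "eventually (\<lambda>u. scaled_h r u * (scaled_cutoff r x u + (0 * u + 0)) \<ge> \<bar>C\<bar> + 1) at_top"
    using scaled_cutoff_asymptotics(3)[OF r, of x 0 0] unfolding filterlim_at_top by blast
  show ?thesis
    using 1 scaled_cutoff_asymptotics(2)[OF r, of x "- C" 0] eventually_ge_at_top[of 1]
  proof eventually_elim
    case (elim u)
    interpret scaling r u using r elim by unfold_locales auto
    have a: "h * scaled_cutoff r x u \<ge> \<bar>C\<bar> + 1" using elim by simp
    hence "h * scaled_cutoff r x u > 0" by linarith
    hence "scaled_cutoff r x u > 0" using h_pos by (simp add: zero_less_mult_iff)
    hence "h * scaled_cutoff r x u \<le> scaled_cutoff r x u" using h_le_1 by (simp add: mult_left_le_one_le h_pos less_imp_le)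
    moreover have "scaled_cutoff r x u - C * u > 0" using elim(2) h_pos by (simp add: zero_less_mult_iff)
    ultimately show ?case using a by linarith
  qed
qed

theorem high_sum_tendsto:
  assumes r: "r \<ge> 2"
  shows "((\<lambda>u. scaling.high_sum r u (scaled_cutoff r x u)) \<longlongrightarrow> exp (- x)) at_top"
proof (rule tendsto_sandwich)
  show "eventually (\<lambda>u. scaling.high_sum r u (scaled_cutoff r x u) \<le>
      2 * power_exp_tail r (scaled_h r u) (scaled_cutoff r x u + (0 * u + -1)) + scaling.noncorner_bound r u (scaled_cutoff r x u) + label_tail r u) at_top"
    using eventually_cutoff_large[OF r, of "max (max 1 (real r ^ 3)) ((real r)\<^sup>2 * side_bound r)" x] eventually_u_big[OF r, of "real r ^ (3 * (r + 1))"] eventually_ge_at_top[of 1]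
  proof eventually_elim
    case (elim u)
    interpret scaling r u using r elim by unfold_locales auto
    have "(real r)\<^sup>2 * side_bound r * u \<le> max (max 1 (real r ^ 3)) ((real r)\<^sup>2 * side_bound r) * u"
      using u by (intro mult_right_mono) auto
    hence "(real r)\<^sup>2 * side_bound r * u \<le> scaled_cutoff r x u" using elim(1) by linarith
    moreover have "1 \<le> h * scaled_cutoff r x u" "real r ^ 3 \<le> scaled_cutoff r x u" using elim(1) by auto
    ultimately show ?case using high_sum_le[OF _ _ _ elim(2)] by simp
  qed
  show "eventually (\<lambda>u. 2 * power_exp_tail r (scaled_h r u) (scaled_cutoff r x u + (0 * u + (real r + 1))) /
      (1 + real (r - 1) * fact (r - 1) / (scaled_h r u * (scaled_cutoff r x u + (0 * u + 0))) ^ r)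
      \<le> scaling.high_sum r u (scaled_cutoff r x u)) at_top"
    using eventually_cutoff_large[OF r, of 1 x] eventually_ge_at_top[of 1]
  proof eventually_elim
    case (elim u)
    interpret scaling r u using r elim by unfold_locales auto
    show ?case using high_sum_ge[of "scaled_cutoff r x u"] elim by (simp add: add.assoc)
  qed
  have inv: "((\<lambda>u. real (r - 1) * fact (r - 1) / (scaled_h r u * (scaled_cutoff r x u + (0 * u + 0))) ^ r) \<longlongrightarrow> 0) at_top"
    using scaled_cutoff_asymptotics(3)[OF r, of x 0 0] r
    by (intro tendsto_divide_0[OF tendsto_const] filterlim_at_top_imp_at_infinity filterlim_pow_at_top) auto
  have "((\<lambda>u. 2 * power_exp_tail r (scaled_h r u) (scaled_cutoff r x u + (0 * u + (real r + 1))) /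
      (1 + real (r - 1) * fact (r - 1) / (scaled_h r u * (scaled_cutoff r x u + (0 * u + 0))) ^ r)) \<longlongrightarrow> 2 * (exp (- x) / 2) / (1 + 0)) at_top"
    by (intro tendsto_intros scaled_cutoff_asymptotics(4)[OF r] inv) auto
  thus "((\<lambda>u. 2 * power_exp_tail r (scaled_h r u) (scaled_cutoff r x u + (0 * u + (real r + 1))) /
      (1 + real (r - 1) * fact (r - 1) / (scaled_h r u * (scaled_cutoff r x u + (0 * u + 0))) ^ r)) \<longlongrightarrow> exp (- x)) at_top" by simp
  have "((\<lambda>u. label_tail r u * u ^ 0) \<longlongrightarrow> 0) at_top" by (rule label_tail_tendsto_0)
  hence "((\<lambda>u. 2 * power_exp_tail r (scaled_h r u) (scaled_cutoff r x u + (0 * u + -1)) + scaling.noncorner_bound r u (scaled_cutoff r x u) + label_tail r u)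
     \<longlongrightarrow> 2 * (exp (- x) / 2) + 0 + 0) at_top"
    by (intro tendsto_intros scaled_cutoff_asymptotics(4)[OF r] noncorner_bound_tendsto_0 r) simp
  thus "((\<lambda>u. 2 * power_exp_tail r (scaled_h r u) (scaled_cutoff r x u + (0 * u + -1)) + scaling.noncorner_bound r u (scaled_cutoff r x u) + label_tail r u)
     \<longlongrightarrow> exp (- x)) at_top" by simp
qed

section \<open>Decay of the characteristic function\<close>

lemma one_over_one_plus_le_exp:
  fixes y :: real
  assumes "0 \<le> y" "y \<le> 1"
  shows "1 / (1 + y) \<le> exp (- y / 2)"
proof -
  have "exp (y / 2) \<le> 1 + y / 2 + (y / 2)\<^sup>2" using assms by (intro exp_bound) auto
  also have "(y / 2)\<^sup>2 \<le> y / 2"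
    using assms mult_left_le[of "y / 2" "y / 2"] by (simp add: power2_eq_square)
  finally have "exp (y / 2) \<le> 1 + y" by simp
  thus ?thesis using assms by (simp add: exp_minus divide_simps)
qed

lemma sin_ge_linear:
  assumes "\<bar>\<theta>\<bar> \<le> pi / 2"
  shows "\<bar>sin \<theta>\<bar> \<ge> 2 / pi * \<bar>\<theta>\<bar>"
proof -
  have *: "sin y \<ge> 2 / pi * y" if "0 \<le> y" "y \<le> pi / 2" for y
  proof -
    have "concave_on {0..pi} sin"
    proof (rule f''_le0_imp_concave)
      show "convex {0..pi}" by simp
      show "(sin has_real_derivative cos x) (at x)" if "x \<in> {0..pi}" for x by (auto intro!: derivative_eq_intros)
      show "(cos has_real_derivative - sin x) (at x)" if "x \<in> {0..pi}" for x by (auto intro!: derivative_eq_intros)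
      show "- sin x \<le> 0" if "x \<in> {0..pi}" for x using that by (simp add: sin_ge_zero)
    qed
    from concave_onD[OF this, of "2 * y / pi" 0 "pi / 2"] that
    show ?thesis by (simp add: field_simps)
  qed
  show ?thesis
  proof (cases "\<theta> \<ge> 0")
    case True
    have "sin \<theta> \<ge> 0" using True assms by (intro sin_ge_zero) auto
    thus ?thesis using *[of \<theta>] True assms by simp
  next
    case False
    have "sin (- \<theta>) \<ge> 0" using False assms by (intro sin_ge_zero) auto
    thus ?thesis using *[of "- \<theta>"] False assms by simp
  qed
qed

text \<open>
The difference of consecutive binomials \<open>binomial (m + j, j)\<close> is a binomial with \<open>j\<close> decreased, and
\<open>\<bar>sin (A - B)\<bar> \<le> \<bar>sin A\<bar> + \<bar>sin B\<bar>\<close>. Each of the \<open>j\<close> steps down to the constant 1 costs a factor 2.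
\<close>

lemma binomial_sines_large:
  "\<exists>i\<le>j. \<bar>sin (real ((m + i + j) choose j) * y)\<bar> \<ge> \<bar>sin y\<bar> / 2 ^ j"
proof (induction j arbitrary: m)
  case (Suc j)
  from Suc.IH[of "m + 1"] obtain i where i: "i \<le> j" "\<bar>sin y\<bar> / 2 ^ j \<le> \<bar>sin (real ((m + 1 + i + j) choose j) * y)\<bar>"
    by auto
  define A where "A = real ((m + Suc i + Suc j) choose Suc j) * y"
  define B where "B = real ((m + i + Suc j) choose Suc j) * y"
  have "real ((m + 1 + i + j) choose j) * y = A - B"
    unfolding A_def B_def by (simp add: algebra_simps)
  hence "\<bar>sin (real ((m + 1 + i + j) choose j) * y)\<bar> = \<bar>sin A * cos B - cos A * sin B\<bar>" by (simp add: sin_diff)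
  also have "\<dots> \<le> \<bar>sin A\<bar> * \<bar>cos B\<bar> + \<bar>cos A\<bar> * \<bar>sin B\<bar>"
    by (rule order_trans[OF abs_triangle_ineq4]) (simp add: abs_mult)
  also have "\<dots> \<le> \<bar>sin A\<bar> * 1 + 1 * \<bar>sin B\<bar>" by (intro add_mono mult_mono) auto
  finally have "\<bar>sin y\<bar> / 2 ^ j \<le> \<bar>sin A\<bar> + \<bar>sin B\<bar>" using i by linarith
  hence "\<bar>sin y\<bar> / 2 ^ Suc j \<le> \<bar>sin A\<bar> \<or> \<bar>sin y\<bar> / 2 ^ Suc j \<le> \<bar>sin B\<bar>"
    by (simp add: field_simps) linarith
  thus ?case
  proof
    assume "\<bar>sin y\<bar> / 2 ^ Suc j \<le> \<bar>sin A\<bar>"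
    thus ?thesis unfolding A_def using i(1) by (intro exI[of _ "Suc i"]) auto
  next
    assume "\<bar>sin y\<bar> / 2 ^ Suc j \<le> \<bar>sin B\<bar>"
    thus ?thesis unfolding B_def using i(1) by (intro exI[of _ i]) auto
  qed
qed simp

lemma prod_norm_subset_le:
  assumes "finite K" "F \<subseteq> K" "\<And>k. k \<in> K \<Longrightarrow> norm (f k :: complex) \<le> 1"
  shows "norm (prod f K) \<le> norm (prod f F)"
proof -
  have "prod f K = prod f (K - F) * prod f F" by (rule prod.subset_diff[OF assms(2,1)])
  hence "norm (prod f K) = norm (prod f (K - F)) * norm (prod f F)" by (simp add: norm_mult)
  also have "norm (prod f (K - F)) \<le> 1"
    unfolding prod_norm[symmetric] using assms(3) by (intro prod_le_1) auto
  finally show ?thesis by (simp add: mult_right_mono)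
qed

context scaling
begin

abbreviation label_char :: "(nat \<Rightarrow> nat) \<Rightarrow> real \<Rightarrow> complex" where
  "label_char k t \<equiv> geom_char (exp (- S)) (label_dim r k) t"

lemma label_char_le_1: "k \<in> irrep_labels r \<Longrightarrow> norm (label_char k t) \<le> 1"
  using S_pos by (intro norm_geom_char_le_1 dim_ge_1) auto

lemma prod_label_char_le:
  assumes K: "finite K" "K \<subseteq> irrep_labels r" and F: "F \<subseteq> K" and \<eta>: "\<eta> \<ge> 0"
    and le: "\<And>k. k \<in> F \<Longrightarrow> (norm (label_char k t))\<^sup>2 \<le> exp (- \<eta>)"
  shows "norm (\<Prod>k\<in>K. label_char k t) \<le> exp (- \<eta> * card F / 2)"
proof -
  have "norm (\<Prod>k\<in>K. label_char k t) \<le> norm (\<Prod>k\<in>F. label_char k t)"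
    using K F label_char_le_1 by (intro prod_norm_subset_le) auto
  also have "\<dots> \<le> (\<Prod>k\<in>F. exp (- \<eta> / 2))"
    unfolding prod_norm[symmetric]
  proof (intro prod_mono conjI)
    fix k assume "k \<in> F"
    have "(norm (label_char k t))\<^sup>2 \<le> (exp (- \<eta> / 2))\<^sup>2" using le[OF \<open>k \<in> F\<close>] by (simp flip: exp_double)
    thus "norm (label_char k t) \<le> exp (- \<eta> / 2)" by (rule power2_le_imp_le) simp
  qed auto
  also have "\<dots> = exp (- \<eta> * card F / 2)" by (simp flip: exp_of_nat_mult)
  finally show ?thesis .
qed

text \<open>
Here \<open>\<bar>dim k * t\<bar> \<le> 1\<close>, so that the sine may be replaced by its argument.
\<close>

lemma label_char_major:
  assumes k: "k \<in> irrep_labels r" and Sd: "S * label_dim r k \<le> u" and t: "\<bar>t\<bar> \<le> S / u"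
  shows "norm (label_char k t) \<le> exp (- (part_variance (exp (- S)) (label_dim r k) * t\<^sup>2 / 2000))"
proof -
  define d where "d = label_dim r k"
  define V where "V = part_variance (exp (- S)) d"
  define w where "w = occupation (exp (- S)) d"
  have d1: "d \<ge> 1" unfolding d_def by (rule dim_ge_1[OF k])
  have q: "0 < exp (- S)" "exp (- S) < 1" using S_pos by auto
  have w: "w > 0" unfolding w_def by (rule occupation_pos[OF q d1])
  have V0: "V \<ge> 0" unfolding V_def by (rule part_variance_nonneg[OF S_pos d1])
  have dt: "\<bar>real d * t\<bar> \<le> 1"
  proof -
    have "real d * \<bar>t\<bar> \<le> (u / S) * (S / u)"
      using Sd t S_pos u by (intro mult_mono) (auto simp: d_def field_simps)
    thus ?thesis using S_pos u by (simp add: abs_mult)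
  qed
  have "\<bar>sin (real d * t / 2)\<bar> \<ge> 2 / pi * \<bar>real d * t / 2\<bar>"
    using dt pi_gt3 by (intro sin_ge_linear) auto
  moreover have "2 / pi \<ge> 1 / 2" using pi_less_4 by (simp add: field_simps)
  ultimately have "\<bar>sin (real d * t / 2)\<bar> \<ge> 1 / 2 * \<bar>real d * t / 2\<bar>"
    by (meson abs_ge_zero mult_right_mono order_trans)
  hence "(1 / 2 * \<bar>real d * t / 2\<bar>)\<^sup>2 \<le> \<bar>sin (real d * t / 2)\<bar>\<^sup>2" by (intro power_mono) auto
  hence "(real d)\<^sup>2 * t\<^sup>2 / 16 \<le> (sin (real d * t / 2))\<^sup>2" by (simp add: power_mult_distrib power_divide)
  hence "4 * w * (1 + w) * ((real d)\<^sup>2 * t\<^sup>2 / 16) \<le> 4 * w * (1 + w) * (sin (real d * t / 2))\<^sup>2"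
    using w by (intro mult_left_mono) auto
  also have "4 * w * (1 + w) * ((real d)\<^sup>2 * t\<^sup>2 / 16) = V * t\<^sup>2 / 4"
    by (simp add: V_def w_def part_variance_def)
  finally have sn: "V * t\<^sup>2 / 4 \<le> 4 * w * (1 + w) * (sin (real d * t / 2))\<^sup>2" .
  have Vt: "V * t\<^sup>2 \<le> 216"
  proof -
    have "V \<le> 216 / S\<^sup>2 * exp (- (S / 2) * d)" unfolding V_def by (rule part_variance_le_exp[OF S_pos d1])
    also have "\<dots> \<le> 216 / S\<^sup>2 * 1" using S_pos by (intro mult_left_mono) auto
    finally have "V \<le> 216 / S\<^sup>2" by simp
    moreover have "S / u \<le> S" using u S_pos by (simp add: field_simps)
    hence "t\<^sup>2 \<le> S\<^sup>2" using t by (intro power2_le_iff_abs_le[THEN iffD2]) auto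
    ultimately have "V * t\<^sup>2 \<le> 216 / S\<^sup>2 * S\<^sup>2" using V0 S_pos by (intro mult_mono) auto
    thus ?thesis using S_pos by simp
  qed
  \<comment> \<open>The divisor 500 only ensures \<open>y \<le> 1\<close>.\<close>
  define y where "y = V * t\<^sup>2 / 500"
  have y: "0 \<le> y" "y \<le> 1" using Vt V0 by (auto simp: y_def)
  have "(norm (label_char k t))\<^sup>2 = 1 / (1 + 4 * w * (1 + w) * (sin (real d * t / 2))\<^sup>2)"
    unfolding w_def d_def[symmetric] by (rule norm_geom_char_sq[OF q d1])
  also have "\<dots> \<le> 1 / (1 + y)"
  proof -
    have "y \<le> V * t\<^sup>2 / 4" using y(1) by (simp add: y_def)
    thus ?thesis using sn y(1) by (intro frac_le) auto
  qed
  also have "\<dots> \<le> exp (- y / 2)" by (rule one_over_one_plus_le_exp[OF y])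
  also have "\<dots> = (exp (- (V * t\<^sup>2 / 2000)))\<^sup>2" by (simp add: y_def flip: exp_double)
  finally show ?thesis unfolding V_def d_def by (rule power2_le_imp_le) simp
qed

lemma label_char_small:
  fixes t y :: real
  assumes k: "k \<in> irrep_labels r" and Sd: "S * label_dim r k \<le> 1"
    and y: "0 \<le> y" "y \<le> 1" "y * (S * label_dim r k)\<^sup>2 \<le> (sin (label_dim r k * t / 2))\<^sup>2"
  shows "(norm (label_char k t))\<^sup>2 \<le> exp (- (y / 2))"
proof -
  define d where "d = label_dim r k"
  define w where "w = occupation (exp (- S)) d"
  have d1: "d \<ge> 1" unfolding d_def by (rule dim_ge_1[OF k])
  have q: "0 < exp (- S)" "exp (- S) < 1" using S_pos by auto
  have x: "S * d > 0" using S_pos d1 by simp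
  have o: "occupation (exp (- S)) d > 0" by (rule occupation_pos[OF q d1])
  have "y = 1 / X * (y * X)" if "X > 0" for X using that by simp
  from this[of "(S * d)\<^sup>2"] x have "y = 1 / (S * d)\<^sup>2 * (y * (S * d)\<^sup>2)" by (meson zero_less_power)
  also have "\<dots> \<le> 4 * w * (1 + w) * (sin (real d * t / 2))\<^sup>2"
    unfolding w_def using occupation_product_ge[OF S_pos d1] Sd y o by (intro mult_mono) (auto simp: d_def)
  finally have "1 / (1 + 4 * w * (1 + w) * (sin (real d * t / 2))\<^sup>2) \<le> 1 / (1 + y)"
    using y by (intro frac_le) auto
  also have "\<dots> \<le> exp (- y / 2)" by (rule one_over_one_plus_le_exp[OF y(1,2)])
  finally show ?thesis unfolding d_def[symmetric] norm_geom_char_sq[OF q d1] w_def by simp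
qed

text \<open>
All entries at most \<open>u^2\<close>. Every factor of Weyl's formula is then at most \<open>u^2\<close>, and there are
\<open>r * (r + 1) / 2\<close> factors, whence \<open>S * dim k \<le> 1 / u\<close>.
\<close>

definition box_labels :: "(nat \<Rightarrow> nat) set" where
  "box_labels = ({1..r} \<rightarrow>\<^sub>E {1..nat \<lfloor>u\<^sup>2\<rfloor>})"

lemma box_labels:
  "finite box_labels" "box_labels \<subseteq> irrep_labels r" "real (card box_labels) \<ge> (u\<^sup>2 / 2) ^ r"
  "\<And>k. k \<in> box_labels \<Longrightarrow> S * label_dim r k \<le> 1 / u"
proof -
  show "finite box_labels" unfolding box_labels_def by (intro finite_PiE) auto
  show sub: "box_labels \<subseteq> irrep_labels r" unfolding box_labels_def irrep_labels_def by (intro PiE_mono) auto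
  have "u\<^sup>2 \<ge> 1" using u by simp
  moreover have "z / 2 \<le> real (nat \<lfloor>z\<rfloor>)" if "z \<ge> 1" for z :: real
  proof -
    have "\<lfloor>z\<rfloor> \<ge> 1" using that by simp
    moreover have "real (nat \<lfloor>z\<rfloor>) = of_int \<lfloor>z\<rfloor>" using that by simp
    moreover have "z < of_int \<lfloor>z\<rfloor> + 1" by linarith
    ultimately show ?thesis by linarith
  qed
  ultimately have "u\<^sup>2 / 2 \<le> real (nat \<lfloor>u\<^sup>2\<rfloor>)" by blast
  hence "(u\<^sup>2 / 2) ^ r \<le> real (nat \<lfloor>u\<^sup>2\<rfloor>) ^ r" by (intro power_mono) auto
  thus "real (card box_labels) \<ge> (u\<^sup>2 / 2) ^ r" unfolding box_labels_def by (subst card_PiE) auto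
  fix k assume k: "k \<in> box_labels"
  have "irrep_dim r k \<le> (u\<^sup>2) ^ card (pos_root_pairs r)"
  proof (rule irrep_dim_le_power)
    show "k \<in> irrep_labels r" using k sub by auto
    fix i assume "i \<in> {1..r}"
    hence "k i \<le> nat \<lfloor>u\<^sup>2\<rfloor>" using k by (auto simp: box_labels_def PiE_iff)
    hence "real (k i) \<le> real (nat \<lfloor>u\<^sup>2\<rfloor>)" by (simp only: of_nat_le_iff)
    also have "\<dots> \<le> u\<^sup>2" by (rule of_nat_floor) simp
    finally show "real (k i) \<le> u\<^sup>2" .
  qed
  also have "\<dots> = u ^ (r * (r + 1))" unfolding card_pos_root_pairs[symmetric] by (simp add: power_mult)
  finally have "S * label_dim r k \<le> S * u ^ (r * (r + 1))" using S_pos by (simp add: real_label_dim)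
  also have "\<dots> \<le> 1 / u"
  proof -
    have "r * (r + 1) + 1 \<le> 2 * r\<^sup>2"
    proof -
      obtain s where "r = s + 2" using r by (metis add.commute le_Suc_ex)
      thus ?thesis by (simp add: power2_eq_square)
    qed
    hence "u ^ (r * (r + 1) + 1) \<le> u ^ (2 * r\<^sup>2)" using u by (intro power_increasing) auto
    thus ?thesis using u by (simp add: S_eq field_simps)
  qed
  finally show "S * label_dim r k \<le> 1 / u" .
qed

text \<open>
For frequencies within a factor \<open>u\<close> of \<open>S\<close>, each label of the box contributes a factor bounded away from
1 by a multiple of \<open>u^-2\<close>, and there are at least \<open>(u^2 / 2) ^ r\<close> of them.
\<close>

lemma char_middle:
  assumes K: "finite K" "K \<subseteq> irrep_labels r" "box_labels \<subseteq> K" and t: "S / u \<le> \<bar>t\<bar>" "\<bar>t\<bar> \<le> S * u"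
  shows "norm (\<Prod>k\<in>K. label_char k t) \<le> exp (- (1 / (16 * u\<^sup>2)) / 2 * card box_labels / 2)"
proof -
  define y where "y = 1 / (16 * u\<^sup>2)"
  have y: "0 \<le> y" "y \<le> 1" using u by (auto simp: y_def divide_le_eq_1 intro: order_trans[of 1 "u\<^sup>2"])
  have "(norm (label_char k t))\<^sup>2 \<le> exp (- (y / 2))" if k: "k \<in> box_labels" for k
  proof (rule label_char_small[OF _ _ y])
    define d where "d = label_dim r k"
    show "k \<in> irrep_labels r" using k box_labels by auto
    have Sd: "S * d \<le> 1 / u" using box_labels(4)[OF k] by (simp add: d_def)
    also have "1 / u \<le> 1" using u by simp
    finally show "S * label_dim r k \<le> 1" by (simp add: d_def)
    have "\<bar>real d * t\<bar> \<le> real d * (S * u)" using t by (simp add: abs_mult mult_left_mono)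
    also have "\<dots> \<le> 1" using Sd u by (simp add: field_simps)
    finally have dt: "\<bar>real d * t\<bar> \<le> 1" .
    have "\<bar>sin (real d * t / 2)\<bar> \<ge> 2 / pi * \<bar>real d * t / 2\<bar>"
      using dt pi_gt3 by (intro sin_ge_linear) auto
    moreover have "2 / pi \<ge> 1 / 2" using pi_less_4 by (simp add: field_simps)
    ultimately have s: "\<bar>sin (real d * t / 2)\<bar> \<ge> 1 / 2 * \<bar>real d * t / 2\<bar>"
      by (meson abs_ge_zero mult_right_mono order_trans)
    have "1 / (4 * u) * (S * d) = real d * (S / u) / 4" by (simp add: mult.commute)
    also have "\<dots> \<le> real d * \<bar>t\<bar> / 4" using t by (intro divide_right_mono mult_left_mono) auto
    also have "\<dots> \<le> \<bar>sin (real d * t / 2)\<bar>" using s by (simp add: abs_mult)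
    finally have "(1 / (4 * u) * (S * d))\<^sup>2 \<le> \<bar>sin (real d * t / 2)\<bar>\<^sup>2"
      using u S_pos by (intro power_mono) auto
    thus "y * (S * label_dim r k)\<^sup>2 \<le> (sin (label_dim r k * t / 2))\<^sup>2"
      by (simp add: y_def power_mult_distrib power_divide flip: d_def)
  qed
  from prod_label_char_le[OF K _ this] y show ?thesis unfolding y_def by simp
qed

text \<open>
The number of disjoint blocks of \<open>r + 1\<close> consecutive corner labels of dimension at most \<open>u\<close>.
\<close>

definition block_count :: nat where "block_count = nat \<lfloor>u powr (1 / r) / (r + 1)\<rfloor>"

definition block_const :: real where "block_const = 1 / (16 * 4 ^ r)"

text \<open>
By \<open>binomial_sines_large\<close> every block contains a corner label \<open>k\<close> with \<open>\<bar>sin (dim k * t / 2)\<bar>\<close> at least a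
constant times \<open>\<bar>t\<bar>\<close>. As \<open>S * dim k \<le> S * u \<le> \<bar>t\<bar>\<close>, its factor is bounded away from 1 by a constant.
\<close>

lemma char_minor:
  assumes K: "finite K" "K \<subseteq> irrep_labels r" "\<And>k. k \<in> irrep_labels r \<Longrightarrow> S * label_dim r k \<le> 1 \<Longrightarrow> k \<in> K"
    and t: "S * u \<le> \<bar>t\<bar>" "\<bar>t\<bar> \<le> pi"
  shows "norm (\<Prod>k\<in>K. label_char k t) \<le> exp (- (block_const / 2) * block_count / 2)"
proof -
  define y where "y = block_const"
  have y: "0 \<le> y" "y \<le> 1" by (auto simp: y_def block_const_def divide_le_eq_1 intro: order_trans[of 1 "16"])
  have sint: "\<bar>sin (t / 2)\<bar> \<ge> \<bar>t\<bar> / 4"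
  proof -
    have "\<bar>sin (t / 2)\<bar> \<ge> 2 / pi * \<bar>t / 2\<bar>" using t by (intro sin_ge_linear) auto
    moreover have "2 / pi \<ge> 1 / 2" using pi_less_4 by (simp add: field_simps)
    ultimately have "\<bar>sin (t / 2)\<bar> \<ge> 1 / 2 * \<bar>t / 2\<bar>" by (meson abs_ge_zero mult_right_mono order_trans)
    thus ?thesis by simp
  qed
  have "\<exists>i\<le>r. \<bar>sin (real ((b * (r + 1) + i + r) choose r) * (t / 2))\<bar> \<ge> \<bar>sin (t / 2)\<bar> / 2 ^ r" for b
    by (rule binomial_sines_large)
  then obtain g where g: "\<And>b. g b \<le> r"
    "\<And>b. \<bar>sin (real ((b * (r + 1) + g b + r) choose r) * (t / 2))\<bar> \<ge> \<bar>sin (t / 2)\<bar> / 2 ^ r" by metis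
  define m where "m = (\<lambda>b. b * (r + 1) + g b)"
  define F where "F = (\<lambda>b. corner_label r 1 (m b)) ` {..<block_count}"
  have m_div: "m b div (r + 1) = b" for b
  proof -
    have "m b div (r + 1) = b + g b div (r + 1)" unfolding m_def by (rule div_mult_self3) simp
    thus ?thesis using g(1)[of b] by simp
  qed
  have inj: "inj_on (\<lambda>b. corner_label r 1 (m b)) {..<block_count}"
  proof (rule inj_onI)
    fix b c assume "corner_label r 1 (m b) = corner_label r 1 (m c)"
    hence "corner_label r 1 (m b) 1 = corner_label r 1 (m c) 1" by simp
    hence "m b = m c" using r by (simp add: corner_label_def)
    thus "b = c" using m_div by metis
  qed
  have dim: "label_dim r (corner_label r 1 (m b)) = (m b + r) choose r" for b
    using label_dim_corner[of r 1 "m b"] r by simp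
  have dim_le: "real (label_dim r (corner_label r 1 (m b))) \<le> u" if b: "b < block_count" for b
  proof -
    have bc: "real block_count \<le> u powr (1 / r) / (r + 1)" unfolding block_count_def using u by simp
    have "b * (r + 1) + r + 1 \<le> block_count * (r + 1)"
    proof -
      have "(b + 1) * (r + 1) \<le> block_count * (r + 1)" using b by (intro mult_right_mono) auto
      thus ?thesis by simp
    qed
    hence "m b + 1 \<le> block_count * (r + 1)" unfolding m_def using g(1)[of b] by linarith
    hence "real (m b + 1) \<le> real block_count * real (r + 1)" by (metis of_nat_le_iff of_nat_mult)
    also have "\<dots> \<le> u powr (1 / r)" using bc by (simp add: field_simps)
    finally have mb: "real (m b + 1) \<le> u powr (1 / r)" .
    have "irrep_dim r (corner_label r 1 (m b)) = (\<Prod>d=1..r. (real (m b) + real d) / real d)"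
      using dim[of b] by (simp add: binomial_eq_prod flip: real_label_dim)
    also have "\<dots> \<le> (\<Prod>d=1..r. real (m b + 1))"
    proof (intro prod_mono conjI)
      fix d assume "d \<in> {1..r}"
      hence "real d \<ge> 1" by simp
      hence "real (m b) * 1 \<le> real (m b) * real d" by (intro mult_left_mono) auto
      thus "(real (m b) + real d) / real d \<le> real (m b + 1)" using \<open>real d \<ge> 1\<close>
        by (simp add: divide_le_eq distrib_right)
    qed auto
    also have "\<dots> = real (m b + 1) ^ r" by simp
    also have "\<dots> \<le> (u powr (1 / r)) ^ r" using mb by (intro power_mono) auto
    also have "\<dots> = u" using u r by (simp add: powr_power)
    finally show ?thesis by (simp add: real_label_dim)
  qed
  have Su: "S * u \<le> 1"
  proof -
    have "u ^ 1 \<le> u ^ (2 * r\<^sup>2)" using u r by (intro power_increasing) auto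
    thus ?thesis using u by (simp add: S_eq field_simps)
  qed
  have Sd: "S * label_dim r (corner_label r 1 (m b)) \<le> S * u" if "b < block_count" for b
    using dim_le[OF that] S_pos by (intro mult_left_mono) auto
  have "(norm (label_char k t))\<^sup>2 \<le> exp (- (y / 2))" if k: "k \<in> F" for k
  proof -
    obtain b where b: "b < block_count" "k = corner_label r 1 (m b)" using k by (auto simp: F_def)
    show ?thesis unfolding b(2)
    proof (rule label_char_small[OF corner_label_in_labels _ y])
      define d where "d = label_dim r (corner_label r 1 (m b))"
      show "S * label_dim r (corner_label r 1 (m b)) \<le> 1" using Sd[OF b(1)] Su by linarith
      have "1 / (4 * 2 ^ r) * (S * d) \<le> 1 / (4 * 2 ^ r) * \<bar>t\<bar>"
        using Sd[OF b(1)] t by (intro mult_left_mono) (auto simp: d_def)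
      also have "\<dots> = (\<bar>t\<bar> / 4) / 2 ^ r" by simp
      also have "\<dots> \<le> \<bar>sin (t / 2)\<bar> / 2 ^ r" using sint by (intro divide_right_mono) auto
      also have "\<dots> \<le> \<bar>sin (real d * t / 2)\<bar>" using g(2)[of b] unfolding d_def dim unfolding m_def by simp
      finally have "(1 / (4 * 2 ^ r) * (S * d))\<^sup>2 \<le> \<bar>sin (real d * t / 2)\<bar>\<^sup>2"
        using S_pos by (intro power_mono) auto
      moreover have "(1 / (4 * 2 ^ r) * (S * d))\<^sup>2 = y * (S * d)\<^sup>2"
      proof -
        have "((2::real) ^ r)\<^sup>2 = 4 ^ r" by (simp add: power2_eq_square flip: power_mult_distrib)
        thus ?thesis by (simp add: y_def block_const_def power_mult_distrib power_divide)
      qed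
      ultimately show "y * (S * label_dim r (corner_label r 1 (m b)))\<^sup>2 \<le> (sin (label_dim r (corner_label r 1 (m b)) * t / 2))\<^sup>2"
        unfolding d_def[symmetric] by simp
    qed
  qed
  moreover have "F \<subseteq> K"
  proof
    fix k assume "k \<in> F"
    then obtain b where b: "b < block_count" "k = corner_label r 1 (m b)" by (auto simp: F_def)
    show "k \<in> K" unfolding b(2) using Sd[OF b(1)] Su by (intro K(3) corner_label_in_labels) linarith
  qed
  ultimately have "norm (\<Prod>k\<in>K. label_char k t) \<le> exp (- (y / 2) * card F / 2)"
    using y by (intro prod_label_char_le K) auto
  moreover have "card F = block_count" unfolding F_def using inj by (simp add: card_image)
  ultimately show ?thesis by (simp add: y_def)
qed

end

section \<open>Moments and a uniform bound\<close>

context scaling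
begin

abbreviation label_variance :: "(nat \<Rightarrow> nat) \<Rightarrow> real" where
  "label_variance k \<equiv> part_variance (exp (- S)) (label_dim r k)"

definition char_error :: real where
  "char_error = exp (- (1 / (16 * u\<^sup>2)) / 2 * (u\<^sup>2 / 2) ^ r / 2) + exp (- (block_const / 2) * block_count / 2)"

lemma label_variance_nonneg: "k \<in> irrep_labels r \<Longrightarrow> label_variance k \<ge> 0"
  by (intro part_variance_nonneg S_pos dim_ge_1)

text \<open>
A common pattern for the moment estimates: a bound by \<open>g\<close> where \<open>S * dim k \<le> u\<close>, and the tail for the
other labels.
\<close>

lemma split_low_high_dim:
  fixes f :: "(nat \<Rightarrow> nat) \<Rightarrow> real"
  assumes F: "finite F" "F \<subseteq> irrep_labels r" and c: "c \<ge> 0"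
    and low: "\<And>k. k \<in> F \<Longrightarrow> S * label_dim r k \<le> u \<Longrightarrow> f k \<le> g k" and g: "\<And>k. k \<in> F \<Longrightarrow> g k \<ge> 0"
    and high: "\<And>k. k \<in> F \<Longrightarrow> S * label_dim r k > u \<Longrightarrow> f k \<le> c * exp (- (S / 2) * label_dim r k)"
  shows "sum f F \<le> sum g F + c * label_tail r u"
proof -
  define A where "A = {k \<in> F. S * label_dim r k \<le> u}"
  define B where "B = {k \<in> F. S * label_dim r k > u}"
  have AB: "F = A \<union> B" "A \<inter> B = {}" "finite A" "finite B" using F by (auto simp: A_def B_def)
  have "sum f F = sum f A + sum f B" unfolding AB(1) by (rule sum.union_disjoint) (use AB in auto)
  also have "sum f A \<le> sum g A" using low by (intro sum_mono) (auto simp: A_def)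
  also have "sum g A \<le> sum g F" using g F by (intro sum_mono2) (auto simp: A_def)
  also have "sum f B \<le> (\<Sum>k\<in>B. c * exp (- (S / 2) * label_dim r k))" using high by (intro sum_mono) (auto simp: B_def)
  also have "\<dots> = c * (\<Sum>k\<in>B. exp (- (S / 2) * label_dim r k))" by (simp add: sum_distrib_left)
  also have "\<dots> \<le> c * label_tail r u" using c AB F by (intro mult_left_mono tail_sum_le) (auto simp: B_def)
  finally show ?thesis by simp
qed

lemma variance_lower:
  assumes K: "finite K" "K \<subseteq> irrep_labels r" "box_labels \<subseteq> K"
  shows "(u\<^sup>2 / 2) ^ r / (4 * S\<^sup>2) \<le> (\<Sum>k\<in>K. label_variance k)"
proof -
  have "(u\<^sup>2 / 2) ^ r / (4 * S\<^sup>2) \<le> real (card box_labels) * (1 / (4 * S\<^sup>2))"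
    using box_labels(3) S_pos by (simp add: divide_right_mono)
  also have "\<dots> = (\<Sum>k\<in>box_labels. 1 / (4 * S\<^sup>2))" by simp
  also have "\<dots> \<le> (\<Sum>k\<in>box_labels. label_variance k)"
  proof (rule sum_mono)
    fix k assume k: "k \<in> box_labels"
    have "1 / u \<le> 1" using u by simp
    hence "S * label_dim r k \<le> 1" using box_labels(4)[OF k] by linarith
    thus "1 / (4 * S\<^sup>2) \<le> label_variance k" using k box_labels(2) by (intro part_variance_ge S_pos dim_ge_1) auto
  qed
  also have "\<dots> \<le> (\<Sum>k\<in>K. label_variance k)" using K label_variance_nonneg by (intro sum_mono2) auto
  finally show ?thesis .
qed

lemma variance_upper:
  assumes K: "finite K" "K \<subseteq> irrep_labels r"
  shows "(\<Sum>k\<in>K. label_variance k) \<le> 216 / S\<^sup>2 * (2 * real r / S) ^ r"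
proof -
  have "(\<Sum>k\<in>K. label_variance k) \<le> (\<Sum>k\<in>K. 216 / S\<^sup>2 * exp (- (S / 2) * label_dim r k))"
    using K by (intro sum_mono part_variance_le_exp S_pos dim_ge_1) auto
  also have "\<dots> = 216 / S\<^sup>2 * (\<Sum>k\<in>K. exp (- (S / 2) * label_dim r k))" by (simp add: sum_distrib_left)
  also have "\<dots> \<le> 216 / S\<^sup>2 * (real r / (S / 2)) ^ r"
  proof (rule mult_left_mono)
    show "(\<Sum>k\<in>K. exp (- (S / 2) * label_dim r k)) \<le> (real r / (S / 2)) ^ r"
      using K S_pos r by (intro sum_exp_label_dim_le) auto
  qed simp
  finally show ?thesis by (simp add: mult.commute)
qed

lemma high_variance_le:
  assumes D: "finite D" "D \<subseteq> irrep_labels r" and B: "(\<Sum>k\<in>D. exp (- S * label_dim r k)) \<le> B"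
  shows "(\<Sum>k\<in>D. label_variance k) \<le> ((1 + u)\<^sup>2 * B + 216 * label_tail r u) / S\<^sup>2"
proof -
  have "(\<Sum>k\<in>D. label_variance k) \<le> (\<Sum>k\<in>D. (1 + u)\<^sup>2 / S\<^sup>2 * exp (- S * label_dim r k)) + 216 / S\<^sup>2 * label_tail r u"
  proof (rule split_low_high_dim[OF D])
    fix k assume k: "k \<in> D" and Sd: "S * label_dim r k \<le> u"
    have d: "label_dim r k \<ge> 1" using k D by (intro dim_ge_1) auto
    have "label_variance k \<le> (1 + S * label_dim r k)\<^sup>2 * exp (- (S * label_dim r k)) / S\<^sup>2" by (rule part_variance_le[OF S_pos d])
    also have "\<dots> \<le> (1 + u)\<^sup>2 * exp (- (S * label_dim r k)) / S\<^sup>2"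
      using Sd S_pos by (intro divide_right_mono mult_right_mono power_mono) auto
    finally show "label_variance k \<le> (1 + u)\<^sup>2 / S\<^sup>2 * exp (- S * label_dim r k)" by simp
  next
    fix k assume "k \<in> D"
    thus "label_variance k \<le> 216 / S\<^sup>2 * exp (- (S / 2) * label_dim r k)"
      using D by (intro part_variance_le_exp S_pos dim_ge_1) auto
  qed auto
  also have "\<dots> = (1 + u)\<^sup>2 / S\<^sup>2 * (\<Sum>k\<in>D. exp (- S * label_dim r k)) + 216 / S\<^sup>2 * label_tail r u" by (simp add: sum_distrib_left)
  also have "\<dots> \<le> (1 + u)\<^sup>2 / S\<^sup>2 * B + 216 / S\<^sup>2 * label_tail r u" using B by (intro add_right_mono mult_left_mono) auto
  finally show ?thesis by (simp add: add_divide_distrib)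
qed

lemma high_mean_le:
  assumes D: "finite D" "D \<subseteq> irrep_labels r" and B: "(\<Sum>k\<in>D. exp (- S * label_dim r k)) \<le> B"
  shows "(\<Sum>k\<in>D. label_dim r k * occupation (exp (- S)) (label_dim r k)) \<le> ((1 + u) * B + 216 * label_tail r u) / S"
proof -
  have "(\<Sum>k\<in>D. label_dim r k * occupation (exp (- S)) (label_dim r k)) \<le> (\<Sum>k\<in>D. (1 + u) / S * exp (- S * label_dim r k)) + 216 / S * label_tail r u"
  proof (rule split_low_high_dim[OF D])
    fix k assume k: "k \<in> D" and Sd: "S * label_dim r k \<le> u"
    have d: "label_dim r k \<ge> 1" using k D by (intro dim_ge_1) auto
    have "label_dim r k * occupation (exp (- S)) (label_dim r k) \<le> exp (- (S * label_dim r k)) * (1 + S * label_dim r k) / S" by (rule occupation_le[OF S_pos d])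
    also have "\<dots> \<le> exp (- (S * label_dim r k)) * (1 + u) / S"
      using Sd S_pos by (intro divide_right_mono mult_left_mono) auto
    finally show "label_dim r k * occupation (exp (- S)) (label_dim r k) \<le> (1 + u) / S * exp (- S * label_dim r k)" by (simp add: mult.commute)
  next
    fix k assume "k \<in> D"
    thus "label_dim r k * occupation (exp (- S)) (label_dim r k) \<le> 216 / S * exp (- (S / 2) * label_dim r k)"
      using D by (intro mean_part_le_exp S_pos dim_ge_1) auto
  qed (use S_pos u in auto)
  also have "\<dots> = (1 + u) / S * (\<Sum>k\<in>D. exp (- S * label_dim r k)) + 216 / S * label_tail r u" by (simp add: sum_distrib_left)
  also have "\<dots> \<le> (1 + u) / S * B + 216 / S * label_tail r u" using B S_pos u by (intro add_right_mono mult_left_mono) auto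
  finally show ?thesis using add_divide_distrib[of "(1 + u) * B" "216 * label_tail r u" S] by simp
qed

lemma third_moment_sum_le:
  assumes K: "finite K" "K \<subseteq> irrep_labels r"
  shows "(\<Sum>k\<in>K. label_variance k * label_dim r k * (1 + occupation (exp (- S)) (label_dim r k)))
     \<le> (1 + u) / S * (\<Sum>k\<in>K. label_variance k) + 216 * label_tail r u / S ^ 3"
proof -
  have "(\<Sum>k\<in>K. label_variance k * label_dim r k * (1 + occupation (exp (- S)) (label_dim r k)))
     \<le> (\<Sum>k\<in>K. (1 + u) / S * label_variance k) + 216 / S ^ 3 * label_tail r u"
  proof (rule split_low_high_dim[OF K])
    fix k assume k: "k \<in> K" and Sd: "S * label_dim r k \<le> u"
    have d: "label_dim r k \<ge> 1" using k K by (intro dim_ge_1) auto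
    have "label_variance k * label_dim r k * (1 + occupation (exp (- S)) (label_dim r k)) \<le> label_variance k * ((1 + S * label_dim r k) / S)"
      by (rule third_moment_le[OF S_pos d])
    also have "\<dots> \<le> label_variance k * ((1 + u) / S)"
      using Sd S_pos k K label_variance_nonneg by (intro mult_left_mono divide_right_mono) auto
    finally show "label_variance k * label_dim r k * (1 + occupation (exp (- S)) (label_dim r k)) \<le> (1 + u) / S * label_variance k"
      by (simp only: mult.commute)
  next
    fix k assume "k \<in> K"
    thus "label_variance k * label_dim r k * (1 + occupation (exp (- S)) (label_dim r k)) \<le> 216 / S ^ 3 * exp (- (S / 2) * label_dim r k)"
      using K by (intro third_moment_le_exp S_pos dim_ge_1) auto
    show "(1 + u) / S * label_variance k \<ge> 0" using \<open>k \<in> K\<close> K S_pos u label_variance_nonneg[of k] by auto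
  qed (use S_pos in auto)
  thus ?thesis by (simp add: sum_distrib_left)
qed

text \<open>
The removed set \<open>D\<close> contains no label with \<open>S * dim k \<le> 1\<close>, so that the estimates away from 0 are not
affected by it. Near 0 only labels with \<open>S * dim k \<le> u\<close> are used, and by the assumption \<open>small\<close> these
carry at least half of the variance.
\<close>

lemma label_char_prod_bound:
  assumes K: "finite K" "K \<subseteq> irrep_labels r" "\<And>k. k \<in> irrep_labels r \<Longrightarrow> S * label_dim r k \<le> u \<Longrightarrow> k \<in> K"
    and D: "D \<subseteq> K" "\<And>k. k \<in> D \<Longrightarrow> S * label_dim r k > 1" and B: "(\<Sum>k\<in>D. exp (- S * label_dim r k)) \<le> B"
    and small: "((1 + u)\<^sup>2 * B + 216 * label_tail r u) + 216 * label_tail r u \<le> (u\<^sup>2 / 2) ^ r / 8"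
    and t: "\<bar>t\<bar> \<le> pi"
  shows "norm (\<Prod>k\<in>K - D. label_char k t) \<le> exp (- (1 / 4000 * (\<Sum>k\<in>K. label_variance k) * t\<^sup>2)) + char_error"
proof -
  have box: "box_labels \<subseteq> K - D"
  proof
    fix k assume k: "k \<in> box_labels"
    have "1 / u \<le> 1" using u by simp
    hence Sd: "S * label_dim r k \<le> 1" using box_labels(4)[OF k] by linarith
    moreover have "k \<in> K" using Sd u k box_labels(2) by (intro K(3)) auto
    ultimately show "k \<in> K - D" using D(2)[of k] by auto
  qed
  have KD: "finite (K - D)" "K - D \<subseteq> irrep_labels r" using K by auto
  have e: "exp (- (1 / (16 * u\<^sup>2)) / 2 * (u\<^sup>2 / 2) ^ r / 2) \<le> char_error" "exp (- (block_const / 2) * block_count / 2) \<le> char_error"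
    unfolding char_error_def by auto
  have p: "0 \<le> exp (- (1 / 4000 * (\<Sum>k\<in>K. label_variance k) * t\<^sup>2))" by simp
  consider "\<bar>t\<bar> \<le> S / u" | "S / u \<le> \<bar>t\<bar>" "\<bar>t\<bar> \<le> S * u" | "S * u \<le> \<bar>t\<bar>" by linarith
  thus ?thesis
  proof cases
    case 1
    define A where "A = {k \<in> K - D. S * label_dim r k \<le> u}"
    define C where "C = {k \<in> K. S * label_dim r k > u}"
    have "(\<Sum>k\<in>K. label_variance k) \<le> (\<Sum>k\<in>A \<union> D \<union> C. label_variance k)"
      using K D label_variance_nonneg by (intro sum_mono2) (auto simp: A_def C_def finite_subset[OF D(1) K(1)])
    also have "\<dots> \<le> (\<Sum>k\<in>A \<union> D. label_variance k) + (\<Sum>k\<in>C. label_variance k)"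
      using K D label_variance_nonneg
      by (subst sum_Un) (auto simp: A_def C_def finite_subset[OF D(1) K(1)] intro!: sum_nonneg)
    also have "(\<Sum>k\<in>A \<union> D. label_variance k) \<le> (\<Sum>k\<in>A. label_variance k) + (\<Sum>k\<in>D. label_variance k)"
      using K D label_variance_nonneg
      by (subst sum_Un) (auto simp: A_def C_def finite_subset[OF D(1) K(1)] intro!: sum_nonneg)
    also have "(\<Sum>k\<in>D. label_variance k) \<le> ((1 + u)\<^sup>2 * B + 216 * label_tail r u) / S\<^sup>2"
      using K D B by (intro high_variance_le) (auto intro: finite_subset)
    also have "(\<Sum>k\<in>C. label_variance k) \<le> (\<Sum>k\<in>C. 216 / S\<^sup>2 * exp (- (S / 2) * label_dim r k))"
      using K by (intro sum_mono part_variance_le_exp S_pos dim_ge_1) (auto simp: C_def)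
    also have "\<dots> = 216 / S\<^sup>2 * (\<Sum>k\<in>C. exp (- (S / 2) * label_dim r k))" by (simp add: sum_distrib_left)
    also have "\<dots> \<le> 216 / S\<^sup>2 * label_tail r u" using K by (intro mult_left_mono tail_sum_le) (auto simp: C_def)
    finally have "(\<Sum>k\<in>K. label_variance k) \<le> (\<Sum>k\<in>A. label_variance k) + (((1 + u)\<^sup>2 * B + 216 * label_tail r u) + 216 * label_tail r u) / S\<^sup>2"
      by (simp add: add_divide_distrib)
    also have "(((1 + u)\<^sup>2 * B + 216 * label_tail r u) + 216 * label_tail r u) / S\<^sup>2 \<le> (u\<^sup>2 / 2) ^ r / 8 / S\<^sup>2"
      by (intro divide_right_mono small) auto
    also have "\<dots> = 1 / 2 * ((u\<^sup>2 / 2) ^ r / (4 * S\<^sup>2))" by simp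
    also have "\<dots> \<le> 1 / 2 * (\<Sum>k\<in>K. label_variance k)" using box by (intro mult_left_mono variance_lower K) auto
    finally have half: "1 / 2 * (\<Sum>k\<in>K. label_variance k) \<le> (\<Sum>k\<in>A. label_variance k)" by simp
    have "norm (\<Prod>k\<in>K - D. label_char k t) \<le> norm (\<Prod>k\<in>A. label_char k t)"
      using KD label_char_le_1 by (intro prod_norm_subset_le) (auto simp: A_def)
    also have "\<dots> \<le> (\<Prod>k\<in>A. exp (- (label_variance k * t\<^sup>2 / 2000)))"
      unfolding prod_norm[symmetric] using K 1 by (intro prod_mono conjI label_char_major) (auto simp: A_def)
    also have "\<dots> = exp (- ((\<Sum>k\<in>A. label_variance k) * t\<^sup>2 / 2000))"
      using K by (simp add: A_def sum_distrib_right sum_divide_distrib sum_negf flip: exp_sum)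
    also have "\<dots> \<le> exp (- (1 / 4000 * (\<Sum>k\<in>K. label_variance k) * t\<^sup>2))"
      using mult_right_mono[OF half, of "t\<^sup>2"] by (simp add: mult_ac)
    finally show ?thesis using e by (smt (verit) exp_ge_zero)
  next
    case 2
    have "norm (\<Prod>k\<in>K - D. label_char k t) \<le> exp (- (1 / (16 * u\<^sup>2)) / 2 * card box_labels / 2)"
      using 2 by (intro char_middle KD box)
    also have "\<dots> \<le> exp (- (1 / (16 * u\<^sup>2)) / 2 * (u\<^sup>2 / 2) ^ r / 2)"
      using box_labels(3) by (simp add: divide_right_mono)
    finally show ?thesis using e p by linarith
  next
    case 3
    have "norm (\<Prod>k\<in>K - D. label_char k t) \<le> exp (- (block_const / 2) * block_count / 2)"
    proof (rule char_minor[OF KD _ 3 t])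
      fix k assume "k \<in> irrep_labels r" "S * label_dim r k \<le> 1"
      thus "k \<in> K - D" using K(3)[of k] D(2)[of k] u by auto
    qed
    thus ?thesis using e p by linarith
  qed
qed

end

lemma power_times_exp_neg_root_tendsto_0:
  fixes c :: real
  assumes "c > 0" "r \<ge> 1"
  shows "((\<lambda>u. u ^ N * exp (- c * u powr (1 / real r))) \<longlongrightarrow> 0) at_top"
proof -
  have "filterlim (\<lambda>u::real. c * u powr (1 / real r)) at_top at_top"
    using assms by (intro filterlim_tendsto_pos_mult_at_top[OF tendsto_const] real_powr_at_top) auto
  from filterlim_compose[OF tendsto_power_div_exp_0[of "r * N"] this]
  have "((\<lambda>u. (1 / c) ^ (r * N) * ((c * u powr (1 / real r)) ^ (r * N) / exp (c * u powr (1 / real r)))) \<longlongrightarrow> (1 / c) ^ (r * N) * 0) at_top"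
    by (intro tendsto_intros)
  hence lim: "((\<lambda>u. (1 / c) ^ (r * N) * ((c * u powr (1 / real r)) ^ (r * N) / exp (c * u powr (1 / real r)))) \<longlongrightarrow> 0) at_top" by simp
  show ?thesis
  proof (rule Lim_transform_eventually[OF lim])
    show "eventually (\<lambda>u. (1 / c) ^ (r * N) * ((c * u powr (1 / real r)) ^ (r * N) / exp (c * u powr (1 / real r)))
      = u ^ N * exp (- c * u powr (1 / real r))) at_top"
      using eventually_gt_at_top[of 0]
    proof eventually_elim
      case (elim u)
      have "(u powr (1 / real r)) ^ (r * N) = u ^ N"
        using elim assms by (simp add: power_mult powr_power)
      moreover have "(1 / c) ^ (r * N) * c ^ (r * N) = 1" using assms by (simp flip: power_mult_distrib)
      moreover have "exp (- c * u powr (1 / real r)) = 1 / exp (c * u powr (1 / real r))" by (simp add: exp_minus inverse_eq_divide)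
      ultimately show ?case by (simp add: power_mult_distrib mult.assoc[symmetric])
    qed
  qed
qed

text \<open>
The two exponents grow like \<open>u\<close> and \<open>u powr (1 / r)\<close> at least, which beats every power of \<open>u\<close>.
\<close>

lemma char_error_tendsto_0:
  assumes r: "r \<ge> 2"
  shows "((\<lambda>u. scaling.char_error r u * u ^ N) \<longlongrightarrow> 0) at_top"
proof (rule Lim_null_comparison)
  define b where "b = 1 / (16 * 4 ^ r) / 4 / (real r + 1)"
  define C where "C = exp (1 / (16 * 4 ^ r) / 4 :: real)"
  have b: "b > 0" by (simp add: b_def)
  show "eventually (\<lambda>u. norm (scaling.char_error r u * u ^ N) \<le>
      u ^ N * exp (- (1 / 256) * u powr (1 / real 1)) + C * (u ^ N * exp (- b * u powr (1 / real r)))) at_top"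
    using eventually_ge_at_top[of 2]
  proof eventually_elim
    case (elim u)
    interpret scaling r u using r elim by unfold_locales auto
    have "exp (- (1 / (16 * u\<^sup>2)) / 2 * (u\<^sup>2 / 2) ^ r / 2) \<le> exp (- (1 / 256) * u powr (1 / real 1))"
    proof -
      have "u\<^sup>2 / 2 \<ge> 1" using elim power_mono[of 2 u 2] by simp
      hence "(u\<^sup>2 / 2) ^ 2 \<le> (u\<^sup>2 / 2) ^ r" using r by (intro power_increasing) auto
      hence "(u\<^sup>2 / 2) ^ 2 / (64 * u\<^sup>2) \<le> (u\<^sup>2 / 2) ^ r / (64 * u\<^sup>2)" by (intro divide_right_mono) auto
      moreover have "(u\<^sup>2 / 2) ^ 2 / (64 * u\<^sup>2) = u * u / 256" using elim by (simp add: power2_eq_square)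
      moreover have "u * 1 \<le> u * u" using elim by (intro mult_left_mono) auto
      ultimately have "u / 256 \<le> (u\<^sup>2 / 2) ^ r / (64 * u\<^sup>2)" by linarith
      thus ?thesis using elim by simp
    qed
    moreover have "exp (- (block_const / 2) * block_count / 2) \<le> C * exp (- b * u powr (1 / real r))"
    proof -
      define z where "z = u powr (1 / real r) / real (r + 1)"
      have "real (nat \<lfloor>y\<rfloor>) \<ge> y - 1" for y :: real by linarith
      from this[of z] have "real block_count \<ge> z - 1" by (simp only: block_count_def z_def)
      hence "block_const / 4 * (z - 1) \<le> block_const / 4 * real block_count"
        by (intro mult_left_mono) (auto simp: block_const_def)
      hence "- (block_const / 2) * block_count / 2 \<le> block_const / 4 - block_const / 4 * z" by (simp add: algebra_simps)
      also have "\<dots> = 1 / (16 * 4 ^ r) / 4 + - b * u powr (1 / real r)" by (simp add: block_const_def b_def z_def add.commute)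
      finally have "exp (- (block_const / 2) * block_count / 2) \<le> exp (1 / (16 * 4 ^ r) / 4 + - b * u powr (1 / real r))" by simp
      thus ?thesis unfolding exp_add C_def .
    qed
    ultimately have "char_error \<le> exp (- (1 / 256) * u powr (1 / real 1)) + C * exp (- b * u powr (1 / real r))"
      unfolding char_error_def by linarith
    hence "char_error * u ^ N \<le> (exp (- (1 / 256) * u powr (1 / real 1)) + C * exp (- b * u powr (1 / real r))) * u ^ N"
      using u by (intro mult_right_mono) auto
    moreover have "char_error \<ge> 0" by (simp add: char_error_def)
    ultimately show ?case using u by (simp add: algebra_simps abs_mult)
  qed
  have "((\<lambda>u. u ^ N * exp (- (1 / 256) * u powr (1 / real 1)) + C * (u ^ N * exp (- b * u powr (1 / real r)))) \<longlongrightarrow> 0 + C * 0) at_top"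
    using b r by (intro tendsto_intros power_times_exp_neg_root_tendsto_0) auto
  thus "((\<lambda>u. u ^ N * exp (- (1 / 256) * u powr (1 / real 1)) + C * (u ^ N * exp (- b * u powr (1 / real r)))) \<longlongrightarrow> 0) at_top" by simp
qed

section \<open>The limit law\<close>

text \<open>
No label of dimension above \<open>n\<close> occurs in a representation of dimension \<open>n\<close>, so a finite set \<open>K\<close> of
labels that contains the others is sufficient.
\<close>

lemma reps_avoiding_eq:
  assumes r: "r \<ge> 1" and K: "finite K" "K \<subseteq> irrep_labels r"
    and all: "\<And>k. k \<in> irrep_labels r \<Longrightarrow> label_dim r k \<le> n \<Longrightarrow> k \<in> K"
  shows "{X \<in> reps_of_dim r n. \<forall>k\<in>D. X k = 0} =
    {X. (\<forall>k. k \<notin> K - D \<longrightarrow> X k = 0) \<and> (\<Sum>k\<in>K - D. label_dim r k * X k) = n}" (is "?L = ?R")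
proof -
  have rep_dim: "rep_dim r X = real (\<Sum>k\<in>rep_support X. label_dim r k * X k)" for X
    by (simp add: rep_dim_def real_label_dim)
  have sums: "(\<Sum>k\<in>rep_support X. label_dim r k * X k) = (\<Sum>k\<in>K - D. label_dim r k * X k)"
    if "rep_support X \<subseteq> K - D" for X
    using that K by (intro sum.mono_neutral_left) (auto simp: rep_support_def)
  show ?thesis
  proof (intro equalityI subsetI)
    fix X assume X: "X \<in> ?L"
    hence fin: "finite (rep_support X)" and sub: "rep_support X \<subseteq> irrep_labels r"
      and "rep_dim r X = real n"
      by (auto simp: reps_of_dim_def fin_dim_reps_def)
    hence n: "(\<Sum>k\<in>rep_support X. label_dim r k * X k) = n" unfolding rep_dim by (simp only: of_nat_eq_iff)
    have supp: "rep_support X \<subseteq> K - D"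
    proof
      fix k assume k: "k \<in> rep_support X"
      have "label_dim r k * 1 \<le> label_dim r k * X k" using k by (intro mult_left_mono) (auto simp: rep_support_def)
      also have "\<dots> \<le> n" unfolding n[symmetric] using fin k by (intro member_le_sum) auto
      finally have "k \<in> K" using k sub by (intro all) auto
      moreover have "k \<notin> D" using X k by (auto simp: rep_support_def)
      ultimately show "k \<in> K - D" by simp
    qed
    have "\<forall>k. k \<notin> K - D \<longrightarrow> X k = 0" using supp by (auto simp: rep_support_def)
    thus "X \<in> ?R" using sums[OF supp] n by simp
  next
    fix X assume X: "X \<in> ?R"
    hence supp: "rep_support X \<subseteq> K - D" by (auto simp: rep_support_def)
    hence "rep_support X \<subseteq> irrep_labels r" "finite (rep_support X)" using K by (auto intro: finite_subset)
    moreover have "rep_dim r X = real n" using X unfolding rep_dim sums[OF supp] by simp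
    ultimately show "X \<in> ?L" using X by (auto simp: reps_of_dim_def fin_dim_reps_def)
  qed
qed

lemma prob_height_le:
  assumes r: "r \<ge> 1" and n: "n \<ge> 1" and K: "finite K" "K \<subseteq> irrep_labels r"
    and all: "\<And>k. k \<in> irrep_labels r \<Longrightarrow> label_dim r k \<le> n \<Longrightarrow> k \<in> K"
    and Q: "\<And>X. Q X \<longleftrightarrow> rep_height r X \<le> real r / 2 * M"
  shows "\<P>(X in rep_measure r n. Q X) =
     real (weighted_count (K - high_labels r M) (label_dim r) n) / real (weighted_count K (label_dim r) n)"
proof -
  have height: "rep_height r X \<le> real r / 2 * M \<longleftrightarrow> (\<forall>k\<in>high_labels r M. X k = 0)" if X: "X \<in> reps_of_dim r n" for X
  proof -
    have fin: "finite (rep_support X)" and sub: "rep_support X \<subseteq> irrep_labels r" and dim: "rep_dim r X = real n"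
      using X by (auto simp: reps_of_dim_def fin_dim_reps_def)
    have ne: "rep_support X \<noteq> {}" using dim n by (auto simp: rep_dim_def)
    have "rep_height r X \<le> real r / 2 * M \<longleftrightarrow> (\<forall>k\<in>rep_support X. weight_height r (\<lambda>i. real (k i) - 1) \<le> real r / 2 * M)"
      unfolding rep_height_def using fin ne by (subst Max_le_iff) auto
    also have "\<dots> \<longleftrightarrow> (\<forall>k\<in>high_labels r M. X k = 0)"
      using sub by (force simp: high_labels_def rep_support_def not_le)
    finally show ?thesis .
  qed
  have "\<P>(X in rep_measure r n. Q X) = measure (uniform_count_measure (reps_of_dim r n)) {X \<in> reps_of_dim r n. Q X}"
    by (simp add: rep_measure_def space_uniform_count_measure)
  also have "\<dots> = real (card {X \<in> reps_of_dim r n. Q X}) / real (card (reps_of_dim r n))"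
    by (rule measure_uniform_count_measure) (auto intro: finite_reps_of_dim r)
  also have "{X \<in> reps_of_dim r n. Q X} = {X \<in> reps_of_dim r n. \<forall>k\<in>high_labels r M. X k = 0}"
    using height Q by auto
  also have "card \<dots> = weighted_count (K - high_labels r M) (label_dim r) n"
    unfolding weighted_count_def by (subst reps_avoiding_eq[OF r K all]) auto
  also have "card (reps_of_dim r n) = weighted_count K (label_dim r) n"
    using reps_avoiding_eq[OF r K all, where D = "{}"] by (simp add: weighted_count_def)
  finally show ?thesis .
qed

text \<open>
The Poisson limit: \<open>exp (- p / (1 - p)) \<le> 1 - p \<le> exp (- p)\<close>.
\<close>

lemma prod_one_minus_tendsto:
  fixes p :: "nat \<Rightarrow> 'k \<Rightarrow> real"
  assumes p: "eventually (\<lambda>n. \<forall>k\<in>D n. 0 \<le> p n k \<and> p n k \<le> \<delta> n) sequentially" and \<delta>: "\<delta> \<longlonglongrightarrow> 0"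
    and lim: "(\<lambda>n. \<Sum>k\<in>D n. p n k) \<longlonglongrightarrow> L"
  shows "(\<lambda>n. \<Prod>k\<in>D n. 1 - p n k) \<longlonglongrightarrow> exp (- L)"
proof (rule tendsto_sandwich)
  have \<delta>1: "eventually (\<lambda>n. \<delta> n < 1) sequentially" using \<delta> by (rule order_tendstoD) simp
  show "eventually (\<lambda>n. exp (- ((\<Sum>k\<in>D n. p n k) / (1 - \<delta> n))) \<le> (\<Prod>k\<in>D n. 1 - p n k)) sequentially"
    using p \<delta>1
  proof eventually_elim
    case (elim n)
    show ?case
    proof (cases "finite (D n)")
      case True
      have "exp (- ((\<Sum>k\<in>D n. p n k) / (1 - \<delta> n))) = (\<Prod>k\<in>D n. exp (- (p n k / (1 - \<delta> n))))"
        using True by (simp add: sum_divide_distrib flip: exp_sum sum_negf)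
      also have "\<dots> \<le> (\<Prod>k\<in>D n. 1 - p n k)"
      proof (intro prod_mono conjI)
        fix k assume "k \<in> D n"
        hence pk: "0 \<le> p n k" "p n k \<le> \<delta> n" using elim by auto
        hence "p n k / (1 - p n k) \<le> p n k / (1 - \<delta> n)" using elim by (intro divide_left_mono) auto
        hence "exp (- (p n k / (1 - \<delta> n))) \<le> exp (- (p n k / (1 - p n k)))" by simp
        also have "\<dots> \<le> 1 - p n k"
        proof -
          have "1 + p n k / (1 - p n k) = 1 / (1 - p n k)" using pk elim by (simp add: field_simps)
          hence "1 / (1 - p n k) \<le> exp (p n k / (1 - p n k))" using exp_ge_add_one_self[of "p n k / (1 - p n k)"] by simp
          thus ?thesis using pk elim by (simp add: exp_minus field_simps)
        qed
        finally show "exp (- (p n k / (1 - \<delta> n))) \<le> 1 - p n k" .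
      qed auto
      finally show ?thesis .
    qed simp
  qed
  show "eventually (\<lambda>n. (\<Prod>k\<in>D n. 1 - p n k) \<le> exp (- (\<Sum>k\<in>D n. p n k))) sequentially"
    using p \<delta>1
  proof eventually_elim
    case (elim n)
    show ?case
    proof (cases "finite (D n)")
      case True
      have "(\<Prod>k\<in>D n. 1 - p n k) \<le> (\<Prod>k\<in>D n. exp (- p n k))"
      proof (intro prod_mono conjI)
        fix k assume k: "k \<in> D n"
        show "0 \<le> 1 - p n k" using elim k by force
        show "1 - p n k \<le> exp (- p n k)" using exp_ge_add_one_self[of "- p n k"] by simp
      qed
      also have "\<dots> = exp (- (\<Sum>k\<in>D n. p n k))" using True by (simp flip: exp_sum sum_negf)
      finally show ?thesis .
    qed simp
  qed
  have "(\<lambda>n. exp (- ((\<Sum>k\<in>D n. p n k) / (1 - \<delta> n)))) \<longlonglongrightarrow> exp (- (L / (1 - 0)))"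
    by (intro tendsto_intros lim \<delta>) simp
  thus "(\<lambda>n. exp (- ((\<Sum>k\<in>D n. p n k) / (1 - \<delta> n)))) \<longlonglongrightarrow> exp (- L)" by simp
  show "(\<lambda>n. exp (- (\<Sum>k\<in>D n. p n k))) \<longlonglongrightarrow> exp (- L)" by (intro tendsto_intros lim)
qed

lemma finite_labels_of_bounded_dim:
  assumes "r \<ge> 1"
  shows "finite {k \<in> irrep_labels r. real (label_dim r k) \<le> c}"
proof (rule finite_subset)
  show "{k \<in> irrep_labels r. real (label_dim r k) \<le> c} \<subseteq> {1..r} \<rightarrow>\<^sub>E {1..nat \<lfloor>c\<rfloor>}"
  proof
    fix k assume k: "k \<in> {k \<in> irrep_labels r. real (label_dim r k) \<le> c}"
    hence kU: "k \<in> irrep_labels r" by simp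
    have "k i \<in> {1..nat \<lfloor>c\<rfloor>}" if "i \<in> {1..r}" for i
    proof -
      have "real (k i) \<le> c" using label_dim_ge_label[OF kU that] k by (simp add: order_trans[of _ "real (label_dim r k)"])
      thus ?thesis using label_ge_1[OF kU that] by (simp add: le_nat_floor)
    qed
    thus "k \<in> {1..r} \<rightarrow>\<^sub>E {1..nat \<lfloor>c\<rfloor>}" using kU by (simp add: irrep_labels_def PiE_iff)
  qed
qed (auto intro: finite_PiE)

text \<open>
The infinite sums for the mean and for the weight of the high labels are replaced by finite ones
with a controlled error, and no rate of convergence is involved.
\<close>

lemma (in scaling) truncation_exists:
  assumes e: "e > 0" and n: "mean_dim r S = real n"
  shows "\<exists>K. finite K \<and> K \<subseteq> irrep_labels r \<and> (\<forall>k\<in>irrep_labels r. label_dim r k \<le> n \<longrightarrow> k \<in> K) \<and>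
    (\<forall>k\<in>irrep_labels r. S * label_dim r k \<le> u \<longrightarrow> k \<in> K) \<and>
    \<bar>(\<Sum>k\<in>K. label_dim r k * occupation (exp (- S)) (label_dim r k)) - real n\<bar> \<le> 1 \<and>
    \<bar>(\<Sum>k\<in>K \<inter> high_labels r M. exp (- S * label_dim r k)) - high_sum M\<bar> \<le> e"
proof -
  let ?U = "irrep_labels r" and ?H = "high_labels r M" and ?FU = "finite_subsets_at_top (irrep_labels r)"
  have HU: "?H \<subseteq> ?U" by (auto simp: high_labels_def)
  define F0 where "F0 = {k \<in> ?U. real (label_dim r k) \<le> max (real n) (u / S)}"
  have F0: "finite F0" "F0 \<subseteq> ?U" unfolding F0_def using finite_labels_of_bounded_dim[of r] r by auto
  have ev0: "eventually (\<lambda>K. finite K \<and> F0 \<subseteq> K \<and> K \<subseteq> ?U) ?FU"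
    unfolding eventually_finite_subsets_at_top using F0 by (intro exI[of _ F0]) auto
  have "((\<lambda>k. label_dim r k * occupation (exp (- S)) (label_dim r k)) has_sum real n) ?U"
    using has_sum_mean_dim[of r S] r S_pos n by simp
  hence "((\<lambda>K. \<Sum>k\<in>K. label_dim r k * occupation (exp (- S)) (label_dim r k)) \<longlongrightarrow> real n) ?FU" by (simp add: has_sum_def)
  hence ev1: "eventually (\<lambda>K. dist (\<Sum>k\<in>K. label_dim r k * occupation (exp (- S)) (label_dim r k)) (real n) < 1) ?FU"
    by (rule tendstoD) simp
  have "((\<lambda>k. exp (- S * label_dim r k)) has_sum high_sum M) ?H"
    unfolding high_sum_def by (rule has_sum_infsum[OF summable_high])
  moreover have "((\<lambda>k. exp (- S * label_dim r k)) has_sum high_sum M) ?H \<longleftrightarrow>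
      ((\<lambda>k. if k \<in> ?H then exp (- S * label_dim r k) else 0) has_sum high_sum M) ?U"
    by (rule has_sum_cong_neutral) (use HU in auto)
  ultimately have "((\<lambda>k. if k \<in> ?H then exp (- S * label_dim r k) else 0) has_sum high_sum M) ?U" by blast
  hence "((\<lambda>K. \<Sum>k\<in>K. if k \<in> ?H then exp (- S * label_dim r k) else 0) \<longlongrightarrow> high_sum M) ?FU" by (simp add: has_sum_def)
  hence ev2: "eventually (\<lambda>K. dist (\<Sum>k\<in>K. if k \<in> ?H then exp (- S * label_dim r k) else 0) (high_sum M) < e) ?FU"
    by (rule tendstoD) (rule e)
  have ev: "eventually (\<lambda>K. (finite K \<and> F0 \<subseteq> K \<and> K \<subseteq> ?U) \<and>
      dist (\<Sum>k\<in>K. label_dim r k * occupation (exp (- S)) (label_dim r k)) (real n) < 1 \<and>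
      dist (\<Sum>k\<in>K. if k \<in> ?H then exp (- S * label_dim r k) else 0) (high_sum M) < e) ?FU"
    by (intro eventually_conj ev0 ev1 ev2)
  obtain K where KK: "(finite K \<and> F0 \<subseteq> K \<and> K \<subseteq> ?U) \<and>
      dist (\<Sum>k\<in>K. label_dim r k * occupation (exp (- S)) (label_dim r k)) (real n) < 1 \<and>
      dist (\<Sum>k\<in>K. if k \<in> ?H then exp (- S * label_dim r k) else 0) (high_sum M) < e"
    using eventually_happens'[OF finite_subsets_at_top_neq_bot ev] by (rule exE)
  have K: "finite K" "F0 \<subseteq> K" "K \<subseteq> ?U" using KK[THEN conjunct1] by simp_all
  note K1 = KK[THEN conjunct2, THEN conjunct1] and K2 = KK[THEN conjunct2, THEN conjunct2]
  have res: "(\<Sum>k\<in>K. if k \<in> ?H then exp (- S * label_dim r k) else 0) = (\<Sum>k\<in>K \<inter> ?H. exp (- S * label_dim r k))"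
    by (rule sum.inter_restrict[symmetric]) (rule K)
  show ?thesis
  proof (intro exI[of _ K] conjI ballI impI)
    show "finite K" "K \<subseteq> ?U" by fact+
    show "k \<in> K" if "k \<in> ?U" "label_dim r k \<le> n" for k
      by (rule subsetD[OF K(2)]) (use that in \<open>simp add: F0_def\<close>)
    show "k \<in> K" if "k \<in> ?U" "S * label_dim r k \<le> u" for k
    proof -
      have "real (label_dim r k) \<le> u / S" using that S_pos by (simp add: pos_le_divide_eq mult.commute)
      thus ?thesis using that(1) by (intro subsetD[OF K(2)]) (simp add: F0_def)
    qed
    show "\<bar>(\<Sum>k\<in>K. label_dim r k * occupation (exp (- S)) (label_dim r k)) - real n\<bar> \<le> 1"
      using K1 unfolding dist_real_def by linarith
    show "\<bar>(\<Sum>k\<in>K \<inter> ?H. exp (- S * label_dim r k)) - high_sum M\<bar> \<le> e"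
      using K2 unfolding dist_real_def res by linarith
  qed
qed

lemma (in scaling) sigma_lower:
  assumes K: "finite K" "K \<subseteq> irrep_labels r" "box_labels \<subseteq> K"
  shows "1 / (2 * 2 ^ r) * u\<^sup>2 \<le> S * sqrt (\<Sum>k\<in>K. label_variance k)"
proof (rule power2_le_imp_le)
  have "(1 / (2 * 2 ^ r) * u\<^sup>2)\<^sup>2 = (u\<^sup>2)\<^sup>2 / (4 * (2 ^ r)\<^sup>2)" by (simp add: power_mult_distrib power_divide)
  also have "\<dots> \<le> (u\<^sup>2) ^ r / (4 * 2 ^ r)"
  proof (intro frac_le mult_left_mono)
    show "(u\<^sup>2)\<^sup>2 \<le> (u\<^sup>2) ^ r" using u r by (intro power_increasing) auto
    show "(2::real) ^ r \<le> (2 ^ r)\<^sup>2" by (intro self_le_power) auto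
  qed (use u in auto)
  also have "\<dots> = S\<^sup>2 * ((u\<^sup>2 / 2) ^ r / (4 * S\<^sup>2))" using S_pos by (simp add: power_divide)
  also have "\<dots> \<le> S\<^sup>2 * (\<Sum>k\<in>K. label_variance k)" by (intro mult_left_mono variance_lower K) auto
  also have "\<dots> = (S * sqrt (\<Sum>k\<in>K. label_variance k))\<^sup>2"
    using label_variance_nonneg K by (subst power_mult_distrib, subst real_sqrt_pow2) (auto intro!: sum_nonneg)
  finally show "(1 / (2 * 2 ^ r) * u\<^sup>2)\<^sup>2 \<le> (S * sqrt (\<Sum>k\<in>K. label_variance k))\<^sup>2" .
  have "(\<Sum>k\<in>K. label_variance k) \<ge> 0" using K by (intro sum_nonneg label_variance_nonneg) auto
  thus "0 \<le> S * sqrt (\<Sum>k\<in>K. label_variance k)" using S_pos by simp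
qed

lemma eventually_minor_arc_small:
  assumes r: "r \<ge> 2" and B: "B > 0"
  shows "eventually (\<lambda>u. ((1 + u)\<^sup>2 * B + 216 * label_tail r u) + 216 * label_tail r u \<le> (u\<^sup>2 / 2) ^ r / 8) at_top"
proof -
  have "((\<lambda>u. label_tail r u * u ^ 0) \<longlongrightarrow> 0) at_top" by (rule label_tail_tendsto_0)
  hence "eventually (\<lambda>u. label_tail r u < 1) at_top" by (intro order_tendstoD) auto
  moreover have "eventually (\<lambda>u. (1 + u)\<^sup>2 * B + 432 \<le> (u\<^sup>2 / 2)\<^sup>2 / 8) at_top" using B by real_asymp
  ultimately show ?thesis using eventually_ge_at_top[of 2]
  proof eventually_elim
    case (elim u)
    have "u\<^sup>2 / 2 \<ge> 1" using elim power_mono[of 2 u 2] by simp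
    hence "(u\<^sup>2 / 2) ^ 2 \<le> (u\<^sup>2 / 2) ^ r" using r by (intro power_increasing) auto
    thus ?case using elim by linarith
  qed
qed

text \<open>
The quotient is the product of the local ratio, which tends to 1, and of the probability
\<open>\<Prod> (1 - q ^ dim k)\<close> over the high labels, which tends to \<open>exp (- exp (- x))\<close>.
\<close>

theorem height_count_ratio:
  fixes u :: "nat \<Rightarrow> real"
  assumes r: "r \<ge> 2" and u: "filterlim u at_top sequentially"
    and mean: "eventually (\<lambda>n. mean_dim r (scaled_S r (u n)) = real n) sequentially"
  shows "\<exists>K. (\<forall>n. finite (K n) \<and> K n \<subseteq> irrep_labels r) \<and>
    eventually (\<lambda>n. \<forall>k\<in>irrep_labels r. label_dim r k \<le> n \<longrightarrow> k \<in> K n) sequentially \<and>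
    (\<lambda>n. real (weighted_count (K n - high_labels r (scaled_cutoff r x (u n))) (label_dim r) n) /
       real (weighted_count (K n) (label_dim r) n)) \<longlonglongrightarrow> exp (- exp (- x))"
proof -
  let ?d = "label_dim r"
  define S where "S = (\<lambda>n. scaled_S r (u n))"
  define q where "q = (\<lambda>n. exp (- S n))"
  define M where "M = (\<lambda>n. scaled_cutoff r x (u n))"
  define H where "H = (\<lambda>n. high_labels r (M n))"
  define P where "P = (\<lambda>n K. (\<forall>k\<in>irrep_labels r. ?d k \<le> n \<longrightarrow> k \<in> K) \<and>
    (\<forall>k\<in>irrep_labels r. S n * ?d k \<le> u n \<longrightarrow> k \<in> K) \<and>
    \<bar>(\<Sum>k\<in>K. ?d k * occupation (q n) (?d k)) - real n\<bar> \<le> 1 \<and>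
    \<bar>(\<Sum>k\<in>K \<inter> H n. exp (- S n * ?d k)) - scaling.high_sum r (u n) (M n)\<bar> \<le> 1 / (real n + 1))"
  have r1: "r \<ge> 1" using r by simp
  have evu: "eventually (\<lambda>n. Q (u n)) sequentially" if "eventually Q at_top" for Q
    using that u by (rule eventually_compose_filterlim)
  have u1: "eventually (\<lambda>n. u n \<ge> 1) sequentially" by (rule evu[OF eventually_ge_at_top])
  have "\<exists>K. finite K \<and> K \<subseteq> irrep_labels r \<and> (u n \<ge> 1 \<and> mean_dim r (S n) = real n \<longrightarrow> P n K)" for n
  proof (cases "u n \<ge> 1 \<and> mean_dim r (S n) = real n")
    case True
    interpret scaling r "u n" using r True by unfold_locales auto
    show ?thesis using truncation_exists[of "1 / (real n + 1)" n "M n"] True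
      unfolding P_def q_def S_def H_def by auto
  qed auto
  then obtain K where K: "\<And>n. finite (K n)" "\<And>n. K n \<subseteq> irrep_labels r"
    "\<And>n. u n \<ge> 1 \<Longrightarrow> mean_dim r (S n) = real n \<Longrightarrow> P n (K n)" by metis
  have evP: "eventually (\<lambda>n. P n (K n)) sequentially"
    using u1 mean by eventually_elim (rule K(3), simp_all add: S_def)
  define \<sigma> where "\<sigma> = (\<lambda>n. sqrt (\<Sum>k\<in>K n. part_variance (q n) (?d k)))"
  \<comment> \<open>Any constant above the limit \<open>exp (- x)\<close> of the weight of the high labels.\<close>
  define B where "B = exp (- x) + 2"
  have B: "B > 0" by (simp add: B_def add_pos_pos)
  \<comment> \<open>The constant of \<open>sigma_lower\<close>. In terms of \<open>u\<close> it gives \<open>S * \<sigma> \<ge> c0 * u^2\<close>, on which all error terms rest.\<close>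
  define c0 :: real where "c0 = 1 / (2 * 2 ^ r)"
  have c0: "c0 > 0" by (simp add: c0_def)
  have hs: "(\<lambda>n. scaling.high_sum r (u n) (M n)) \<longlonglongrightarrow> exp (- x)"
    unfolding M_def by (rule filterlim_compose[OF high_sum_tendsto[OF r] u])
  have "(\<lambda>n. (\<Sum>k\<in>K n \<inter> H n. exp (- S n * ?d k)) - scaling.high_sum r (u n) (M n)) \<longlonglongrightarrow> 0"
  proof (rule Lim_null_comparison)
    show "eventually (\<lambda>n. norm ((\<Sum>k\<in>K n \<inter> H n. exp (- S n * ?d k)) - scaling.high_sum r (u n) (M n)) \<le> 1 / (real n + 1)) sequentially"
      using evP by eventually_elim (simp add: P_def)
    show "(\<lambda>n. 1 / (real n + 1)) \<longlonglongrightarrow> 0" by real_asymp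
  qed
  from tendsto_add[OF this hs] have Hlim: "(\<lambda>n. \<Sum>k\<in>K n \<inter> H n. exp (- S n * ?d k)) \<longlonglongrightarrow> exp (- x)" by simp
  hence "eventually (\<lambda>n. (\<Sum>k\<in>K n \<inter> H n. exp (- S n * ?d k)) < B) sequentially"
    by (rule order_tendstoD) (simp add: B_def)
  hence HB: "eventually (\<lambda>n. (\<Sum>k\<in>K n \<inter> H n. exp (- S n * ?d k)) \<le> B) sequentially"
    by eventually_elim simp
  have big: "eventually (\<lambda>n. scaled_h r (u n) * M n \<ge> 2 * real r ^ 3 \<and> M n \<ge> 2 * real r ^ 3) sequentially"
    unfolding M_def using evu[OF eventually_cutoff_large[OF r, of "2 * real r ^ 3" x]] by eventually_elim simp
  have HS: "eventually (\<lambda>n. \<forall>k\<in>H n. S n * ?d k \<ge> (scaled_h r (u n) * M n / real r ^ 3) ^ r \<and> S n * ?d k > 1) sequentially"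
    using big u1
  proof eventually_elim
    case (elim n)
    interpret scaling r "u n" using r elim by unfold_locales auto
    show ?case
    proof
      fix k assume k: "k \<in> H n"
      have r3: "real r ^ 3 > 0" using r by simp
      hence "M n \<ge> real r ^ 3" using elim by linarith
      hence 1: "S n * ?d k \<ge> (scaled_h r (u n) * M n / real r ^ 3) ^ r"
        using high_label_dim_ge[of k "M n"] k by (simp add: H_def S_def)
      have "2 \<le> scaled_h r (u n) * M n / real r ^ 3" using elim r3 by (simp add: le_divide_eq)
      hence "2 ^ r \<le> (scaled_h r (u n) * M n / real r ^ 3) ^ r" by (intro power_mono) auto
      moreover have "(2::real) ^ 1 \<le> 2 ^ r" using r by (intro power_increasing) auto
      ultimately show "S n * ?d k \<ge> (scaled_h r (u n) * M n / real r ^ 3) ^ r \<and> S n * ?d k > 1" using 1 by simp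
    qed
  qed
  have box: "eventually (\<lambda>n. scaling.box_labels r (u n) \<subseteq> K n) sequentially"
    using evP u1
  proof eventually_elim
    case (elim n)
    interpret scaling r "u n" using r elim by unfold_locales auto
    show ?case
    proof
      fix k assume k: "k \<in> box_labels"
      have "1 / u n \<le> 1" using elim by simp
      moreover have "S n * ?d k \<le> 1 / u n" using box_labels(4)[OF k] by (simp add: S_def)
      ultimately have "S n * ?d k \<le> u n" using elim(2) by linarith
      thus "k \<in> K n" using k box_labels(2) elim(1) unfolding P_def by blast
    qed
  qed
  have sigma_sq: "(\<sigma> n)\<^sup>2 = (\<Sum>k\<in>K n. part_variance (q n) (?d k))" if Sn: "S n > 0" for n
  proof -
    have "(\<Sum>k\<in>K n. part_variance (q n) (?d k)) \<ge> 0"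
    proof (rule sum_nonneg)
      fix k assume "k \<in> K n"
      hence "?d k \<ge> 1" using K(2) label_dim_ge_1[OF r1] by blast
      thus "part_variance (q n) (?d k) \<ge> 0" unfolding q_def by (rule part_variance_nonneg[OF Sn])
    qed
    thus ?thesis by (simp add: \<sigma>_def)
  qed
  have \<sigma>S: "eventually (\<lambda>n. S n > 0 \<and> S n \<le> 1 \<and> c0 * (u n)\<^sup>2 \<le> S n * \<sigma> n) sequentially"
    using box u1
  proof eventually_elim
    case (elim n)
    interpret scaling r "u n" using r elim by unfold_locales auto
    show ?case using sigma_lower[OF K(1) K(2) elim(1)] S_pos S_le_1 by (simp add: S_def c0_def \<sigma>_def q_def)
  qed
  have \<sigma>u: "eventually (\<lambda>n. c0 * (u n)\<^sup>2 \<le> \<sigma> n) sequentially"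
    using \<sigma>S
  proof eventually_elim
    case (elim n)
    have "0 \<le> c0 * (u n)\<^sup>2" using c0 by simp
    hence "0 \<le> S n * \<sigma> n" using elim by linarith
    hence "\<sigma> n \<ge> 0" using elim by (simp add: zero_le_mult_iff)
    hence "S n * \<sigma> n \<le> 1 * \<sigma> n" using elim by (intro mult_right_mono) auto
    thus ?case using elim by linarith
  qed
  have cu: "filterlim (\<lambda>n. c0 * (u n)\<^sup>2) at_top sequentially"
    by (intro filterlim_tendsto_pos_mult_at_top[OF tendsto_const c0] filterlim_pow_at_top u) simp
  have \<sigma>top: "filterlim \<sigma> at_top sequentially" by (rule filterlim_at_top_mono[OF cu \<sigma>u])
  have comp0: "(\<lambda>n. g (u n)) \<longlonglongrightarrow> 0" if "(g \<longlongrightarrow> 0) at_top" for g :: "real \<Rightarrow> real"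
    by (rule filterlim_compose[OF that u])
  have tail0: "((\<lambda>u. label_tail r u) \<longlongrightarrow> 0) at_top" using label_tail_tendsto_0[of r 0] by simp
  have evq: "eventually (\<lambda>n. 0 < q n \<and> q n < 1) sequentially"
    using \<sigma>S by eventually_elim (simp add: q_def)
  have "(\<lambda>n. (weighted_count (K n - H n) ?d n * (\<Prod>k\<in>K n - H n. 1 - q n ^ ?d k)) /
              (weighted_count (K n) ?d n * (\<Prod>k\<in>K n. 1 - q n ^ ?d k))) \<longlonglongrightarrow> 1"
  proof (rule thinned_count_ratio_tendsto_1[where \<sigma> = \<sigma> and c = "1 / 4000" and \<epsilon> = "\<lambda>n. scaling.char_error r (u n)" and M = "\<lambda>n. 1 / S n"])
    show "?d k \<ge> 1" if "k \<in> K n" for n k using label_dim_ge_1[OF r1] K(2) that by blast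
    show "eventually (\<lambda>n. \<sigma> n \<ge> 1 \<and> (\<sigma> n)\<^sup>2 = (\<Sum>k\<in>K n. part_variance (q n) (?d k))) sequentially"
      using filterlim_at_top[THEN iffD1, rule_format, OF \<sigma>top, of 1]
    proof eventually_elim
      case (elim n)
      hence "(\<Sum>k\<in>K n. part_variance (q n) (?d k)) \<ge> 0" unfolding \<sigma>_def
        by (meson linorder_not_le order_trans real_sqrt_lt_0_iff zero_le_one)
      thus ?case using elim by (simp add: \<sigma>_def)
    qed
    show "eventually (\<lambda>n. \<bar>(\<Sum>k\<in>K n. ?d k * occupation (q n) (?d k)) - real n\<bar> \<le> 1) sequentially"
      using evP by eventually_elim (simp add: P_def)
    show "eventually (\<lambda>n. scaling.char_error r (u n) \<ge> 0 \<and> (\<forall>t. \<bar>t\<bar> \<le> pi \<longrightarrow>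
        norm (\<Prod>k\<in>K n - H n. geom_char (q n) (?d k) t) \<le> exp (- (1 / 4000 * (\<sigma> n)\<^sup>2 * t\<^sup>2)) + scaling.char_error r (u n))) sequentially"
      using evP HS HB evu[OF eventually_minor_arc_small[OF r B]] u1
    proof eventually_elim
      case (elim n)
      interpret scaling r "u n" using r elim by unfold_locales auto
      have \<sigma>2: "(\<sigma> n)\<^sup>2 = (\<Sum>k\<in>K n. part_variance (exp (- S n)) (?d k))"
        using sigma_sq[of n] S_pos by (simp add: q_def S_def)
      have KH: "K n - H n = K n - (K n \<inter> H n)" by auto
      show ?case
      proof (intro conjI allI impI)
        show "char_error \<ge> 0" by (simp add: char_error_def)
        fix t :: real assume t: "\<bar>t\<bar> \<le> pi"
        show "norm (\<Prod>k\<in>K n - H n. geom_char (q n) (?d k) t) \<le> exp (- (1 / 4000 * (\<sigma> n)\<^sup>2 * t\<^sup>2)) + char_error"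
          unfolding \<sigma>2 KH q_def S_def
        proof (rule label_char_prod_bound[OF K(1) K(2) _ _ _ _ elim(4) t])
          show "k \<in> K n" if "k \<in> irrep_labels r" "scaled_S r (u n) * ?d k \<le> u n" for k
            using elim(1) that unfolding P_def S_def by blast
          show "scaled_S r (u n) * ?d k > 1" if "k \<in> K n \<inter> H n" for k using elim(2) that unfolding S_def by blast
          show "(\<Sum>k\<in>K n \<inter> H n. exp (- scaled_S r (u n) * ?d k)) \<le> B" using elim(3) by (simp add: S_def)
        qed auto
      qed
    qed
    show "eventually (\<lambda>n. \<forall>k\<in>K n. ?d k * occupation (q n) (?d k) \<le> 1 / S n) sequentially"
      using \<sigma>S
    proof eventually_elim
      case (elim n)
      show ?case unfolding q_def using elim K(2) label_dim_ge_1[OF r1] by (intro ballI mean_part_le) auto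
    qed
    show "(\<lambda>n. 1 / S n / \<sigma> n) \<longlonglongrightarrow> 0"
    proof (rule Lim_null_comparison)
      show "eventually (\<lambda>n. norm (1 / S n / \<sigma> n) \<le> 1 / (c0 * (u n)\<^sup>2)) sequentially"
        using \<sigma>S u1
      proof eventually_elim
        case (elim n)
        have "c0 * (u n)\<^sup>2 > 0" using c0 elim by simp
        hence "1 / (S n * \<sigma> n) \<le> 1 / (c0 * (u n)\<^sup>2)" "S n * \<sigma> n > 0" using elim by (auto intro!: divide_left_mono)
        thus ?case by simp
      qed
      show "(\<lambda>n. 1 / (c0 * (u n)\<^sup>2)) \<longlonglongrightarrow> 0"
        by (intro tendsto_divide_0[OF tendsto_const] filterlim_at_top_imp_at_infinity cu)
    qed
    show "(\<lambda>n. scaling.char_error r (u n) * (\<sigma> n)\<^sup>2) \<longlonglongrightarrow> 0"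
    proof (rule Lim_null_comparison)
      define N where "N = 2 * r\<^sup>2 * (r + 2)"
      show "eventually (\<lambda>n. norm (scaling.char_error r (u n) * (\<sigma> n)\<^sup>2) \<le> 216 * (2 * real r) ^ r * (scaling.char_error r (u n) * u n ^ N)) sequentially"
        using u1
      proof eventually_elim
        case (elim n)
        interpret scaling r "u n" using r elim by unfold_locales auto
        have "(\<sigma> n)\<^sup>2 = (\<Sum>k\<in>K n. label_variance k)"
          using sigma_sq[of n] S_pos by (simp add: q_def S_def)
        also have "\<dots> \<le> 216 / scaled_S r (u n) ^ 2 * (2 * real r / scaled_S r (u n)) ^ r" by (rule variance_upper[OF K(1) K(2)])
        also have "\<dots> = 216 * (2 * real r) ^ r * (1 / scaled_S r (u n)) ^ (r + 2)"
          by (simp add: power_divide power_add power2_eq_square)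
        also have "(1 / scaled_S r (u n)) ^ (r + 2) = u n ^ N"
        proof -
          have "1 / scaled_S r (u n) = u n ^ (2 * r\<^sup>2)" by (simp add: S_eq)
          thus ?thesis unfolding N_def by (simp only: power_mult[of "u n" "2 * r\<^sup>2"])
        qed
        finally have \<sigma>2: "(\<sigma> n)\<^sup>2 \<le> 216 * (2 * real r) ^ r * u n ^ N" .
        have ce: "char_error \<ge> 0" by (simp add: char_error_def)
        hence "norm (char_error * (\<sigma> n)\<^sup>2) = char_error * (\<sigma> n)\<^sup>2" by simp
        also have "\<dots> \<le> char_error * (216 * (2 * real r) ^ r * u n ^ N)" using \<sigma>2 ce by (rule mult_left_mono)
        finally show ?case by (simp only: mult_ac)
      qed
      have "(\<lambda>n. 216 * (2 * real r) ^ r * (scaling.char_error r (u n) * u n ^ N)) \<longlonglongrightarrow> 216 * (2 * real r) ^ r * 0"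
        by (intro tendsto_mult tendsto_const comp0[OF char_error_tendsto_0[OF r]])
      thus "(\<lambda>n. 216 * (2 * real r) ^ r * (scaling.char_error r (u n) * u n ^ N)) \<longlonglongrightarrow> 0" by simp
    qed
    show "(\<lambda>n. (\<Sum>k\<in>K n. part_variance (q n) (?d k) * ?d k * (1 + occupation (q n) (?d k))) / \<sigma> n ^ 3) \<longlonglongrightarrow> 0"
    proof (rule Lim_null_comparison)
      show "eventually (\<lambda>n. norm ((\<Sum>k\<in>K n. part_variance (q n) (?d k) * ?d k * (1 + occupation (q n) (?d k))) / \<sigma> n ^ 3)
          \<le> (1 + u n) / (c0 * (u n)\<^sup>2) + 216 * label_tail r (u n) / (c0 * (u n)\<^sup>2) ^ 3) sequentially"
        using \<sigma>S \<sigma>u u1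
      proof eventually_elim
        case (elim n)
        interpret scaling r "u n" using r elim by unfold_locales auto
        let ?b = "\<Sum>k\<in>K n. part_variance (q n) (?d k) * ?d k * (1 + occupation (q n) (?d k))"
        have cu0: "c0 * (u n)\<^sup>2 > 0" using c0 elim by simp
        have s0: "\<sigma> n > 0" "S n > 0" using elim cu0 by linarith+
        have \<sigma>2: "(\<sigma> n)\<^sup>2 = (\<Sum>k\<in>K n. label_variance k)"
          using sigma_sq[of n] S_pos by (simp add: q_def S_def)
        have "?b \<ge> 0"
        proof (intro sum_nonneg)
          fix k assume "k \<in> K n"
          hence d: "?d k \<ge> 1" "k \<in> irrep_labels r" using K(2) dim_ge_1 by auto
          have "part_variance (q n) (?d k) * (?d k * (1 + occupation (q n) (?d k))) \<ge> 0"
            unfolding q_def using part_variance_nonneg[OF s0(2) d(1)] one_plus_occupation_nonneg(1)[OF s0(2) d(1)] by simp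
          thus "part_variance (q n) (?d k) * ?d k * (1 + occupation (q n) (?d k)) \<ge> 0" by (simp only: mult.assoc)
        qed
        hence "norm (?b / \<sigma> n ^ 3) = ?b / \<sigma> n ^ 3" using s0 by simp
        also have "\<dots> \<le> ((1 + u n) / S n * (\<sigma> n)\<^sup>2 + 216 * label_tail r (u n) / S n ^ 3) / \<sigma> n ^ 3"
          using third_moment_sum_le[OF K(1) K(2), of n] s0 unfolding \<sigma>2 by (intro divide_right_mono) (auto simp: q_def S_def)
        also have "\<dots> = (1 + u n) / (S n * \<sigma> n) + 216 * label_tail r (u n) / (S n * \<sigma> n) ^ 3"
          using s0 by (simp add: add_divide_distrib power_mult_distrib power2_eq_square power3_eq_cube)
        also have "\<dots> \<le> (1 + u n) / (c0 * (u n)\<^sup>2) + 216 * label_tail r (u n) / (c0 * (u n)\<^sup>2) ^ 3"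
          using elim cu0 s0 tail_nonneg by (intro add_mono divide_left_mono power_mono) auto
        finally show ?case .
      qed
      have "((\<lambda>u. (1 + u) / (c0 * u\<^sup>2)) \<longlongrightarrow> 0) at_top" using c0 by real_asymp
      moreover have "((\<lambda>u. 1 / (c0 * u\<^sup>2) ^ 3) \<longlongrightarrow> 0) at_top" using c0 by real_asymp
      ultimately have "((\<lambda>u. (1 + u) / (c0 * u\<^sup>2) + 216 * (label_tail r u * (1 / (c0 * u\<^sup>2) ^ 3))) \<longlongrightarrow> 0 + 216 * (0 * 0)) at_top"
        by (intro tendsto_add tendsto_mult tendsto_const tail0)
      hence "((\<lambda>u. (1 + u) / (c0 * u\<^sup>2) + 216 * label_tail r u / (c0 * u\<^sup>2) ^ 3) \<longlongrightarrow> 0) at_top" by simp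
      thus "(\<lambda>n. (1 + u n) / (c0 * (u n)\<^sup>2) + 216 * label_tail r (u n) / (c0 * (u n)\<^sup>2) ^ 3) \<longlonglongrightarrow> 0" by (rule comp0)
    qed
    show "(\<lambda>n. (\<Sum>k\<in>K n - (K n - H n). ?d k * occupation (q n) (?d k)) / \<sigma> n) \<longlonglongrightarrow> 0"
    proof (rule Lim_null_comparison)
      show "eventually (\<lambda>n. norm ((\<Sum>k\<in>K n - (K n - H n). ?d k * occupation (q n) (?d k)) / \<sigma> n)
          \<le> ((1 + u n) * B + 216 * label_tail r (u n)) / (c0 * (u n)\<^sup>2)) sequentially"
        using \<sigma>S \<sigma>u u1 HB
      proof eventually_elim
        case (elim n)
        interpret scaling r "u n" using r elim by unfold_locales auto
        let ?E = "\<Sum>k\<in>K n \<inter> H n. ?d k * occupation (q n) (?d k)"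
        have KH: "K n - (K n - H n) = K n \<inter> H n" by auto
        have cu0: "c0 * (u n)\<^sup>2 > 0" using c0 elim by simp
        have s0: "\<sigma> n > 0" "S n > 0" using elim cu0 by linarith+
        have "?E \<ge> 0" unfolding q_def using K(2) dim_ge_1 by (intro sum_nonneg one_plus_occupation_nonneg(2) s0) auto
        hence "norm (?E / \<sigma> n) = ?E / \<sigma> n" using s0 by simp
        also have "\<dots> \<le> ((1 + u n) * B + 216 * label_tail r (u n)) / S n / \<sigma> n"
          using high_mean_le[of "K n \<inter> H n" B] K elim(4) s0 by (intro divide_right_mono) (auto simp: q_def S_def)
        also have "\<dots> = ((1 + u n) * B + 216 * label_tail r (u n)) / (S n * \<sigma> n)" by simp
        also have "\<dots> \<le> ((1 + u n) * B + 216 * label_tail r (u n)) / (c0 * (u n)\<^sup>2)"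
          using elim cu0 s0 tail_nonneg B by (intro divide_left_mono) auto
        finally show ?case unfolding KH .
      qed
      have "((\<lambda>u. ((1 + u) * B) / (c0 * u\<^sup>2)) \<longlongrightarrow> 0) at_top" using c0 B by real_asymp
      moreover have "((\<lambda>u. 1 / (c0 * u\<^sup>2)) \<longlongrightarrow> 0) at_top" using c0 by real_asymp
      ultimately have "((\<lambda>u. ((1 + u) * B) / (c0 * u\<^sup>2) + 216 * (label_tail r u * (1 / (c0 * u\<^sup>2)))) \<longlongrightarrow> 0 + 216 * (0 * 0)) at_top"
        by (intro tendsto_add tendsto_mult tendsto_const tail0)
      hence "((\<lambda>u. ((1 + u) * B + 216 * label_tail r u) / (c0 * u\<^sup>2)) \<longlongrightarrow> 0) at_top" by (simp add: add_divide_distrib)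
      thus "(\<lambda>n. ((1 + u n) * B + 216 * label_tail r (u n)) / (c0 * (u n)\<^sup>2)) \<longlonglongrightarrow> 0" by (rule comp0)
    qed
  qed (use K evq \<sigma>top in auto)
  note ratio = this
  define \<delta> where "\<delta> = (\<lambda>n. exp (- ((scaled_h r (u n) * M n / real r ^ 3) ^ r)))"
  have "filterlim (\<lambda>n. scaled_h r (u n) * M n) at_top sequentially"
    using filterlim_compose[OF scaled_cutoff_asymptotics(3)[OF r, of x 0 0] u] by (simp add: M_def)
  hence "filterlim (\<lambda>n. 1 / real r ^ 3 * (scaled_h r (u n) * M n)) at_top sequentially"
    using r by (intro filterlim_tendsto_pos_mult_at_top[OF tendsto_const]) auto
  hence "filterlim (\<lambda>n. (scaled_h r (u n) * M n / real r ^ 3) ^ r) at_top sequentially"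
    using r by (intro filterlim_pow_at_top) auto
  hence "filterlim (\<lambda>n. - ((scaled_h r (u n) * M n / real r ^ 3) ^ r)) at_bot sequentially"
    by (simp add: filterlim_uminus_at_bot)
  hence \<delta>0: "\<delta> \<longlonglongrightarrow> 0" unfolding \<delta>_def by (rule filterlim_compose[OF exp_at_bot])
  have pow: "q n ^ ?d k = exp (- S n * ?d k)" for n k
    by (simp add: q_def mult.commute flip: exp_of_nat_mult)
  have "(\<lambda>n. \<Prod>k\<in>K n \<inter> H n. 1 - q n ^ ?d k) \<longlonglongrightarrow> exp (- exp (- x))"
  proof (rule prod_one_minus_tendsto[OF _ \<delta>0])
    show "eventually (\<lambda>n. \<forall>k\<in>K n \<inter> H n. 0 \<le> q n ^ ?d k \<and> q n ^ ?d k \<le> \<delta> n) sequentially"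
      using HS by eventually_elim (auto simp: pow \<delta>_def)
    show "(\<lambda>n. \<Sum>k\<in>K n \<inter> H n. q n ^ ?d k) \<longlonglongrightarrow> exp (- x)" using Hlim by (simp add: pow)
  qed
  from tendsto_mult[OF ratio this]
  have "(\<lambda>n. (weighted_count (K n - H n) ?d n * (\<Prod>k\<in>K n - H n. 1 - q n ^ ?d k)) /
              (weighted_count (K n) ?d n * (\<Prod>k\<in>K n. 1 - q n ^ ?d k)) * (\<Prod>k\<in>K n \<inter> H n. 1 - q n ^ ?d k)) \<longlonglongrightarrow> exp (- exp (- x))"
    by simp
  hence "(\<lambda>n. real (weighted_count (K n - H n) ?d n) / real (weighted_count (K n) ?d n)) \<longlonglongrightarrow> exp (- exp (- x))"
  proof (rule Lim_transform_eventually)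
    show "eventually (\<lambda>n. (weighted_count (K n - H n) ?d n * (\<Prod>k\<in>K n - H n. 1 - q n ^ ?d k)) /
              (weighted_count (K n) ?d n * (\<Prod>k\<in>K n. 1 - q n ^ ?d k)) * (\<Prod>k\<in>K n \<inter> H n. 1 - q n ^ ?d k)
        = real (weighted_count (K n - H n) ?d n) / real (weighted_count (K n) ?d n)) sequentially"
      using evq
    proof eventually_elim
      case (elim n)
      have "1 - q n ^ ?d k \<noteq> 0" if "k \<in> K n" for k
        using power_in_unit_interval[of "q n" "?d k"] elim K(2)[of n] that label_dim_ge_1[OF r1, of k] by auto
      hence nz: "(\<Prod>k\<in>K n. 1 - q n ^ ?d k) \<noteq> 0" using K(1) by simp
      have "(\<Prod>k\<in>K n. 1 - q n ^ ?d k) = (\<Prod>k\<in>K n - H n. 1 - q n ^ ?d k) * (\<Prod>k\<in>K n \<inter> H n. 1 - q n ^ ?d k)"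
        using K(1) by (subst prod.union_disjoint[symmetric]) (auto intro!: prod.cong)
      hence "(weighted_count (K n - H n) ?d n * (\<Prod>k\<in>K n - H n. 1 - q n ^ ?d k)) /
              (weighted_count (K n) ?d n * (\<Prod>k\<in>K n. 1 - q n ^ ?d k)) * (\<Prod>k\<in>K n \<inter> H n. 1 - q n ^ ?d k)
        = (real (weighted_count (K n - H n) ?d n) * (\<Prod>k\<in>K n. 1 - q n ^ ?d k)) / (real (weighted_count (K n) ?d n) * (\<Prod>k\<in>K n. 1 - q n ^ ?d k))"
        by simp
      also have "\<dots> = real (weighted_count (K n - H n) ?d n) / real (weighted_count (K n) ?d n)"
        using nz by (rule mult_divide_mult_cancel_right)
      finally show ?case .
    qed
  qed
  moreover have "eventually (\<lambda>n. \<forall>k\<in>irrep_labels r. ?d k \<le> n \<longrightarrow> k \<in> K n) sequentially"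
    using evP by eventually_elim (simp add: P_def)
  ultimately show ?thesis using K unfolding H_def M_def by blast
qed

lemma height_event_iff:
  fixes h \<alpha> H x :: real
  assumes r: "r \<ge> 2" and h: "h > 0" and \<alpha>: "\<alpha> > 0"
  shows "2 / fact r * h * \<alpha> powr ((real r - 1) / real r) * H - \<alpha> / fact (r - 1) + (real r - 1) / real r * ln \<alpha> \<le> x
     \<longleftrightarrow> H \<le> real r / 2 * height_cutoff r x h \<alpha>"
proof -
  define P where "P = \<alpha> powr ((real r - 1) / real r)"
  define Y where "Y = x + \<alpha> / fact (r - 1) - (real r - 1) / real r * ln \<alpha>"
  have P: "P > 0" using \<alpha> by (simp add: P_def)
  have fr: "fact r = real r * fact (r - 1)" using r by (simp add: fact_reduce)
  define c where "c = 2 / fact r * h * P"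
  have c: "c > 0" using h P by (simp add: c_def)
  have "real r / 2 * height_cutoff r x h \<alpha> = Y / c"
    unfolding height_cutoff_def Y_def[symmetric] P_def[symmetric] c_def fr using h P r by (simp add: field_simps)
  moreover have "H \<le> Y / c \<longleftrightarrow> c * H \<le> Y" using c by (simp add: le_divide_eq mult.commute)
  moreover have "c * H \<le> Y \<longleftrightarrow> c * H - \<alpha> / fact (r - 1) + (real r - 1) / real r * ln \<alpha> \<le> x"
    unfolding Y_def by linarith
  ultimately have "H \<le> real r / 2 * height_cutoff r x h \<alpha> \<longleftrightarrow>
      c * H - \<alpha> / fact (r - 1) + (real r - 1) / real r * ln \<alpha> \<le> x" by (simp only:)
  thus ?thesis unfolding c_def P_def by blast
qed

theorem theorem6p5:
  fixes r :: nat and x :: real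
  assumes "r \<ge> 2"
  shows "(\<lambda>n. \<P>(X in rep_measure r n.
             2 / fact r * saddle_s r n powr ((real r + 1) / 2)
               * height_alpha r n powr ((real r - 1) / real r) * rep_height r X
             - height_alpha r n / fact (r - 1)
             + (real r - 1) / real r * ln (height_alpha r n) \<le> x))
         \<longlonglongrightarrow> exp (- exp (- x))"
proof -
  note r = assms
  have r1: "r \<ge> 1" using r by simp
  obtain S where S0: "S \<longlonglongrightarrow> 0" and S: "eventually (\<lambda>n. S n > 0 \<and> mean_dim r (S n) = real n \<and> saddle_q r n = exp (- S n) \<and>
       saddle_s r n = S n powr (2 / (real r * (real r + 1)))) sequentially"
    using saddle_point_exists[OF r1] by blast
  \<comment> \<open>This exponent makes \<open>scaled_S r (u n) = S n\<close>.\<close>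
  define c where "c = 1 / (2 * (real r)\<^sup>2)"
  have c: "c > 0" using r by (simp add: c_def)
  define u where "u = (\<lambda>n. S n powr (- c))"
  have "filterlim S (at_right 0) sequentially"
    using S0 by (rule tendsto_imp_filterlim_at_right) (use S in eventually_elim, simp)
  moreover have "filterlim (\<lambda>s::real. s powr (- c)) at_top (at_right 0)" using c by real_asymp
  ultimately have u: "filterlim u at_top sequentially" unfolding u_def by (rule filterlim_compose[rotated])
  have u_pow: "u n ^ m = S n powr (- (c * real m))" if "S n > 0" for n m
    using that by (simp add: u_def powr_power mult.commute)
  have h_eq: "scaled_h r (u n) = S n powr (1 / real r)" if "S n > 0" for n
    using that r by (simp add: scaled_h_def u_pow powr_minus_divide c_def power2_eq_square)
  have S_eq: "scaled_S r (u n) = S n" if "S n > 0" for n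
    using that r by (simp add: scaled_S_def h_eq powr_power)
  have "eventually (\<lambda>n. mean_dim r (scaled_S r (u n)) = real n) sequentially"
    using S by eventually_elim (simp add: S_eq)
  from height_count_ratio[OF r u this, of x] obtain K where
    K: "\<And>n. finite (K n)" "\<And>n. K n \<subseteq> irrep_labels r"
      "eventually (\<lambda>n. \<forall>k\<in>irrep_labels r. label_dim r k \<le> n \<longrightarrow> k \<in> K n) sequentially" and
    lim: "(\<lambda>n. real (weighted_count (K n - high_labels r (scaled_cutoff r x (u n))) (label_dim r) n) /
       real (weighted_count (K n) (label_dim r) n)) \<longlonglongrightarrow> exp (- exp (- x))" by blast
  have \<alpha>pos: "eventually (\<lambda>n. scaled_alpha r (u n) > 0) sequentially"
    using filterlim_compose[OF scaled_alpha_at_top[OF r1] u] by (simp add: filterlim_at_top_dense)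
  show ?thesis
  proof (rule Lim_transform_eventually[OF lim])
    show "eventually (\<lambda>n. real (weighted_count (K n - high_labels r (scaled_cutoff r x (u n))) (label_dim r) n) /
       real (weighted_count (K n) (label_dim r) n) = \<P>(X in rep_measure r n.
             2 / fact r * saddle_s r n powr ((real r + 1) / 2)
               * height_alpha r n powr ((real r - 1) / real r) * rep_height r X
             - height_alpha r n / fact (r - 1)
             + (real r - 1) / real r * ln (height_alpha r n) \<le> x)) sequentially"
      using S K(3) \<alpha>pos eventually_ge_at_top[of 1]
    proof eventually_elim
      case (elim n)
      have Sn: "S n > 0" using elim by simp
      have hpos: "scaled_h r (u n) > 0" using Sn by (simp add: h_eq)
      have h: "saddle_s r n powr ((real r + 1) / 2) = scaled_h r (u n)"
      proof -
        have "2 / (real r * (real r + 1)) * ((real r + 1) / 2) = 1 / real r" using r by (simp add: divide_simps)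
        thus ?thesis using elim Sn by (simp add: h_eq powr_powr)
      qed
      have \<alpha>: "height_alpha r n = scaled_alpha r (u n)"
      proof -
        have "saddle_s r n powr (- (real r + 1) / 2) = 1 / scaled_h r (u n)"
        proof -
          have "- (real r + 1) / 2 = - ((real r + 1) / 2)" by (simp only: minus_divide_left)
          thus ?thesis unfolding h[symmetric] by (simp only: powr_minus_divide)
        qed
        moreover have "Gamma (real r + 1) = fact r" using Gamma_fact[of r, where 'a = real] by (simp add: add.commute)
        moreover have "Gamma (real r) = fact (r - 1)"
          using Gamma_fact[of "r - 1", where 'a = real] r by (simp add: of_nat_diff)
        ultimately show ?thesis by (simp add: height_alpha_def scaled_alpha_def)
      qed
      show ?case
        unfolding h \<alpha> scaled_cutoff_def
        by (rule prob_height_le[OF r1 elim(4) K(1) K(2), symmetric])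
           (use elim(2) height_event_iff[OF r hpos elim(3)] in \<open>auto simp: scaled_cutoff_def\<close>)
    qed
  qed
qed

end
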